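(* Let $n\ge 3$ and let $(M^n,g)$ be a complete noncompact Riemannian manifold that has a conformal immersion $$\Phi:(M^n,g)\to(\mathbb{S}^n,g_{\mathbb{S}}).$$ Assume that $(M^n,g)$ is $n$-parabolic. Then $\Phi$ is injective.
   Context: Manifolds are smooth and connected; $(\mathbb{S}^n,g_{\mathbb{S}})$ is the standard unit round sphere. A conformal immersion is a smooth immersion $\Phi$ such that $\Phi^*g_{\mathbb{S}}$ is conformal to $g$. For a compact subset $K$ of a domain $\Omega$ in a Riemannian manifold and $1<p<\infty$, $$\mathrm{cap}_p(K,\Omega)=\inf\left\{\int_\Omega|\nabla\phi|^p\,dvol:\ \phi\in C_0^\infty(\Omega),\ \phi\ge 1\text{ on }K\right\}.$$ A complete noncompact Riemannian manifold $(M^n,g)$ is $p$-parabolic if $\mathrm{cap}_p(\bar U,M^n)=0$ for every bounded domain $U\subset M$; $n$-parabolic means this with $p=n=\dim M$. *)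

theory Defs
  imports "HOL-Analysis.Analysis"
begin

subsection \<open>Smooth maps between Euclidean spaces\<close>

text \<open>\<open>C_diff_on k S f\<close> expresses that f is k times continuously differentiable on the open set S:
  the first k iterated directional derivatives exist (as derivatives of Frechet differentiable
  functions) and are continuous.\<close>

primrec C_diff_on ::
    "nat \<Rightarrow> 'a::euclidean_space set \<Rightarrow> ('a \<Rightarrow> 'b::euclidean_space) \<Rightarrow> bool" where
  "C_diff_on 0 S f \<longleftrightarrow> continuous_on S f"
| "C_diff_on (Suc k) S f \<longleftrightarrow>
     (\<forall>x\<in>S. f differentiable (at x)) \<and>
     (\<forall>v. C_diff_on k S (\<lambda>x. frechet_derivative f (at x) v))"

definition smooth_on :: "'a::euclidean_space set \<Rightarrow> ('a \<Rightarrow> 'b::euclidean_space) \<Rightarrow> bool" where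
  "smooth_on S f \<longleftrightarrow> (\<forall>k. C_diff_on k S f)"


subsection \<open>Riemannian manifolds\<close>

text \<open>A chart is a pair of its domain and its coordinate map; only the values of the map on the
  domain matter.\<close>

type_synonym ('a, 'n) chart = "'a set \<times> ('a \<Rightarrow> real ^ 'n)"

text \<open>The data of a Riemannian manifold of dimension \<open>CARD('n)\<close>: \<open>gram M c x\<close> is the matrix
  of the metric at the point x with respect to the coordinate frame of the chart c.\<close>

record ('a, 'n::finite) riem_data =
  topo :: "'a topology"
  atlas :: "('a, 'n) chart set"
  gram :: "('a, 'n) chart \<Rightarrow> 'a \<Rightarrow> real ^ 'n ^ 'n"

abbreviation pts :: "('a, 'n::finite) riem_data \<Rightarrow> 'a set" where
  "pts M \<equiv> topspace (topo M)"

definition chart_inv :: "('a, 'n::finite) chart \<Rightarrow> real ^ 'n \<Rightarrow> 'a" where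
  "chart_inv c = inv_into (fst c) (snd c)"

definition smooth_manifold :: "('a, 'n::finite) riem_data \<Rightarrow> bool" where
  "smooth_manifold M \<longleftrightarrow>
     Hausdorff_space (topo M) \<and> second_countable (topo M) \<and> connected_space (topo M) \<and>
     (\<Union>c\<in>atlas M. fst c) = pts M \<and>
     (\<forall>c\<in>atlas M. openin (topo M) (fst c) \<and> open (snd c ` fst c) \<and>
        homeomorphic_map (subtopology (topo M) (fst c)) (top_of_set (snd c ` fst c)) (snd c)) \<and>
     (\<forall>c\<in>atlas M. \<forall>c'\<in>atlas M. smooth_on (snd c ` (fst c \<inter> fst c')) (snd c' \<circ> chart_inv c))"

text \<open>The last clause is the transformation law of a covariant 2-tensor under a change of
  coordinates.\<close>

definition riemannian_manifold :: "('a, 'n::finite) riem_data \<Rightarrow> bool" where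
  "riemannian_manifold M \<longleftrightarrow>
     smooth_manifold M \<and>
     (\<forall>c\<in>atlas M. smooth_on (snd c ` fst c) (gram M c \<circ> chart_inv c)) \<and>
     (\<forall>c\<in>atlas M. \<forall>x\<in>fst c.
        transpose (gram M c x) = gram M c x \<and>
        (\<forall>v. v \<noteq> 0 \<longrightarrow> v \<bullet> (gram M c x *v v) > 0)) \<and>
     (\<forall>c\<in>atlas M. \<forall>c'\<in>atlas M. \<forall>x\<in>fst c \<inter> fst c'.
        let J = jacobian (snd c' \<circ> chart_inv c) (at (snd c x))
        in gram M c x = transpose J ** gram M c' x ** J)"

text \<open>Pointwise quantities such as the norm of a gradient are computed in some chart around the
  point; by the transformation law they do not depend on the choice.\<close>

definition chart_at :: "('a, 'n::finite) riem_data \<Rightarrow> 'a \<Rightarrow> ('a, 'n) chart" where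
  "chart_at M x = (SOME c. c \<in> atlas M \<and> x \<in> fst c)"

definition metric_norm ::
    "('a, 'n::finite) riem_data \<Rightarrow> ('a, 'n) chart \<Rightarrow> 'a \<Rightarrow> real ^ 'n \<Rightarrow> real" where
  "metric_norm M c x v = sqrt (v \<bullet> (gram M c x *v v))"


subsection \<open>Riemannian distance and completeness\<close>

text \<open>The library notion \<open>piecewise_C1_differentiable_on\<close> does not ask for one-sided derivatives
  at the finitely many break points, so the length of such a curve may be infinite. It is therefore
  taken in \<open>ennreal\<close>; the infimum of the lengths is unaffected.\<close>

definition piecewise_C1_curve :: "('a, 'n::finite) riem_data \<Rightarrow> (real \<Rightarrow> 'a) \<Rightarrow> bool" where
  "piecewise_C1_curve M \<gamma> \<longleftrightarrow>
     continuous_map (top_of_set {0..1}) (topo M) \<gamma> \<and>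
     (\<forall>c\<in>atlas M. \<forall>a b. 0 \<le> a \<and> a \<le> b \<and> b \<le> 1 \<and> \<gamma> ` {a..b} \<subseteq> fst c \<longrightarrow>
        (snd c \<circ> \<gamma>) piecewise_C1_differentiable_on {a..b})"

definition curve_length :: "('a, 'n::finite) riem_data \<Rightarrow> (real \<Rightarrow> 'a) \<Rightarrow> ennreal" where
  "curve_length M \<gamma> =
     (\<integral>\<^sup>+ t \<in> {0..1}.
        (let c = chart_at M (\<gamma> t)
         in ennreal (metric_norm M c (\<gamma> t) (vector_derivative (snd c \<circ> \<gamma>) (at t)))) \<partial>lborel)"

definition riem_dist :: "('a, 'n::finite) riem_data \<Rightarrow> 'a \<Rightarrow> 'a \<Rightarrow> real" where
  "riem_dist M x y =
     enn2real (INF \<gamma> \<in> {\<gamma>. piecewise_C1_curve M \<gamma> \<and> \<gamma> 0 = x \<and> \<gamma> 1 = y}. curve_length M \<gamma>)"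

definition complete_manifold :: "('a, 'n::finite) riem_data \<Rightarrow> bool" where
  "complete_manifold M \<longleftrightarrow> Metric_space.mcomplete (pts M) (riem_dist M)"

definition bounded_in :: "('a, 'n::finite) riem_data \<Rightarrow> 'a set \<Rightarrow> bool" where
  "bounded_in M U \<longleftrightarrow> Metric_space.mbounded (pts M) (riem_dist M) U"


subsection \<open>Riemannian volume\<close>

text \<open>The volume is the unique Borel measure with density \<open>sqrt (det gram)\<close> with respect to
  Lebesgue measure in every chart.\<close>

definition volume :: "('a, 'n::finite) riem_data \<Rightarrow> 'a measure" where
  "volume M = (THE \<mu>.
     space \<mu> = pts M \<and>
     sets \<mu> = sigma_sets (pts M) {U. openin (topo M) U} \<and>
     (\<forall>c\<in>atlas M. \<forall>E\<in>sets \<mu>. E \<subseteq> fst c \<longrightarrow>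
        emeasure \<mu> E =
          (\<integral>\<^sup>+ y \<in> snd c ` E. ennreal (sqrt (det (gram M c (chart_inv c y)))) \<partial>lborel)))"


subsection \<open>Smooth functions, capacity and parabolicity\<close>

definition smooth_fun ::
    "('a, 'n::finite) riem_data \<Rightarrow> 'a set \<Rightarrow> ('a \<Rightarrow> 'b::euclidean_space) \<Rightarrow> bool" where
  "smooth_fun M \<Omega> f \<longleftrightarrow>
     (\<forall>c\<in>atlas M. smooth_on (snd c ` (fst c \<inter> \<Omega>)) (f \<circ> chart_inv c))"

definition test_fun :: "('a, 'n::finite) riem_data \<Rightarrow> 'a set \<Rightarrow> ('a \<Rightarrow> real) \<Rightarrow> bool" where
  "test_fun M \<Omega> \<phi> \<longleftrightarrow>
     smooth_fun M \<Omega> \<phi> \<and>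
     (let S = topo M closure_of {x\<in>\<Omega>. \<phi> x \<noteq> 0} in S \<subseteq> \<Omega> \<and> compactin (topo M) S)"

text \<open>The components of the gradient in a chart c are obtained from the partial derivatives by
  raising the index with the inverse matrix of the metric.\<close>

definition gradient ::
    "('a, 'n::finite) riem_data \<Rightarrow> ('a, 'n) chart \<Rightarrow> ('a \<Rightarrow> real) \<Rightarrow> 'a \<Rightarrow> real ^ 'n" where
  "gradient M c \<phi> x =
     matrix_inv (gram M c x) *v
       (\<chi> i. frechet_derivative (\<phi> \<circ> chart_inv c) (at (snd c x)) (axis i 1))"

definition grad_norm :: "('a, 'n::finite) riem_data \<Rightarrow> ('a \<Rightarrow> real) \<Rightarrow> 'a \<Rightarrow> real" where
  "grad_norm M \<phi> x = (let c = chart_at M x in metric_norm M c x (gradient M c \<phi> x))"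

definition capacity ::
    "('a, 'n::finite) riem_data \<Rightarrow> real \<Rightarrow> 'a set \<Rightarrow> 'a set \<Rightarrow> ennreal" where
  "capacity M p K \<Omega> =
     (INF \<phi> \<in> {\<phi>. test_fun M \<Omega> \<phi> \<and> (\<forall>x\<in>K. \<phi> x \<ge> 1)}.
        \<integral>\<^sup>+ x \<in> \<Omega>. ennreal (grad_norm M \<phi> x powr p) \<partial>volume M)"

definition domain_in :: "('a, 'n::finite) riem_data \<Rightarrow> 'a set \<Rightarrow> bool" where
  "domain_in M U \<longleftrightarrow> U \<noteq> {} \<and> openin (topo M) U \<and> connectedin (topo M) U"

definition parabolic :: "('a, 'n::finite) riem_data \<Rightarrow> real \<Rightarrow> bool" where
  "parabolic M p \<longleftrightarrow>
     (\<forall>U. domain_in M U \<and> bounded_in M U \<longrightarrow> capacity M p (topo M closure_of U) (pts M) = 0)"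


subsection \<open>Conformal immersions into the round sphere\<close>

text \<open>The round sphere is the unit sphere of a Euclidean space with the induced metric. So a smooth
  map into it is a smooth map into the ambient space with values in the sphere, its differential is given by
  the ambient one, and the pullback of the round metric is the pullback of the ambient
  inner product.\<close>

definition chart_differential ::
    "('a, 'n::finite) chart \<Rightarrow> ('a \<Rightarrow> 'b::euclidean_space) \<Rightarrow> 'a \<Rightarrow> real ^ 'n \<Rightarrow> 'b" where
  "chart_differential c \<Phi> x = frechet_derivative (\<Phi> \<circ> chart_inv c) (at (snd c x))"

definition smooth_sphere_immersion ::
    "('a, 'n::finite) riem_data \<Rightarrow> ('a \<Rightarrow> real ^ 'm::finite) \<Rightarrow> bool" where
  "smooth_sphere_immersion M \<Phi> \<longleftrightarrow>
     \<Phi> ` pts M \<subseteq> sphere 0 1 \<and> smooth_fun M (pts M) \<Phi> \<and>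
     (\<forall>c\<in>atlas M. \<forall>x\<in>fst c. inj (chart_differential c \<Phi> x))"

definition conformal_sphere_immersion ::
    "('a, 'n::finite) riem_data \<Rightarrow> ('a \<Rightarrow> real ^ 'm::finite) \<Rightarrow> bool" where
  "conformal_sphere_immersion M \<Phi> \<longleftrightarrow>
     smooth_sphere_immersion M \<Phi> \<and>
     (\<exists>u :: 'a \<Rightarrow> real. smooth_fun M (pts M) u \<and>
        (\<forall>c\<in>atlas M. \<forall>x\<in>fst c. \<forall>v w.
           chart_differential c \<Phi> x v \<bullet> chart_differential c \<Phi> x w =
             exp (2 * u x) * (v \<bullet> (gram M c x *v w))))"

end

theory Submission
  imports Defs "HOL-Combinatorics.Permutations"
begin

text \<open>Suppose that \<open>\<Phi> x = \<Phi> y = N\<close> with \<open>x \<noteq> y\<close>. Stereographic projection from \<open>N\<close> turns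
  \<open>\<Phi>\<close> into a conformal local diffeomorphism \<open>f\<close> from \<open>U = {z. \<Phi> z \<noteq> N}\<close> to Euclidean space
  of dimension \<open>n\<close>, and it sends punctured neighbourhoods of \<open>x\<close> and of \<open>y\<close> onto neighbourhoods of
  infinity. So over a far half space \<open>f\<close> has two sections, one with values near \<open>x\<close> and one with
  values near \<open>y\<close>. Each of them is continued along the lines of one direction \<open>e\<close> as far as
  possible (\<open>maximal_backward_section\<close>). Where the continuation along a line stops, it leaves
  every compact subset of \<open>M\<close> (\<open>maximal_section_leaves_compact\<close>).

  By parabolicity there are compactly supported functions \<open>\<phi>\<close> on \<open>M\<close> that are at least 1 near the
  starting point and have arbitrarily small \<open>n\<close>-energy. This energy is conformally invariant, so
  \<open>\<phi> \<circ> F\<close> has small \<open>n\<close>-energy on the Euclidean domain of a section \<open>F\<close>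
  (\<open>section_gradient\<close>, \<open>section_energy_le\<close>). A two-dimensional rectangle in direction \<open>e\<close> along
  which the continuation stops somewhere carries a function that drops from 1 to 0. As the
  exponent \<open>n \<ge> 3\<close> exceeds the dimension 2 of the rectangle, a Morrey estimate bounds its energy
  from below (\<open>rectangle_energy_lower_bound\<close>). By Fubini, rectangles inside the domain of the
  section are therefore found arbitrarily close to any given one
  that starts in the half space (\<open>exists_rectangle_in_section_domain\<close>). In dimension 2 there is only one plane, and
  \<open>z \<mapsto> z\<^sup>2\<close> on the punctured complex plane shows that the conclusion fails there.

  Through these rectangles one passes from each line to any other one, which makes the image of a
  maximal section dense in \<open>M\<close> (\<open>section_image_dense\<close>). Two dense open images meet. Where they
  meet the two sections agree, since both are inverse to \<open>f\<close>, and then they agree along a whole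
  line, back to the far half space; but there one takes values near \<open>x\<close> and the other near \<open>y\<close>
  (\<open>no_two_sheets\<close>).

  Two notions used by parabolicity need work of their own. The volume is a definite description,
  so the measure is constructed by gluing the chart densities and shown to be unique
  (\<open>volume_exists\<close>, \<open>volume_unique\<close>). Boundedness refers to the Riemannian distance, so this is
  shown to be a metric (\<open>riem_dist_metric\<close>), for which small chart balls are bounded
  (\<open>bounded_domain_exists\<close>).\<close>


section \<open>Change of variables\<close>

text \<open>The formula for absolutely integrable functions extends to nonnegative measurable ones with
  integrals in \<open>[0,\<infinity>]\<close>, because the two sides are integrable at the same time.\<close>

lemma nn_integral_change_of_variables_wellorder:
  fixes g :: "real^'k::{finite,wellorder} \<Rightarrow> real^'k::_" and h :: "real^'k::_ \<Rightarrow> real"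
  assumes S: "S \<in> sets borel"
    and der: "\<And>x. x \<in> S \<Longrightarrow> (g has_derivative g' x) (at x within S)"
    and inj: "inj_on g S"
    and nonneg: "\<And>y. y \<in> g ` S \<Longrightarrow> 0 \<le> h y"
    and m1: "(\<lambda>y. indicator (g ` S) y * h y) \<in> borel_measurable borel"
    and m2: "(\<lambda>x. indicator S x * (\<bar>det (matrix (g' x))\<bar> * h (g x))) \<in> borel_measurable borel"
  shows "(\<integral>\<^sup>+ y. ennreal (indicator (g ` S) y * h y) \<partial>lborel) =
         (\<integral>\<^sup>+ x. ennreal (indicator S x * (\<bar>det (matrix (g' x))\<bar> * h (g x))) \<partial>lborel)"
proof -
  let ?a = "\<lambda>y. indicator (g ` S) y * h y"
  let ?b = "\<lambda>x. indicator S x * (\<bar>det (matrix (g' x))\<bar> * h (g x))"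
  let ?h = "\<lambda>x. \<bar>det (matrix (g' x))\<bar> * h (g x)"
  have S': "S \<in> sets lebesgue" using S by simp
  have key: "?h absolutely_integrable_on S \<and> integral S ?h = b \<longleftrightarrow>
      h absolutely_integrable_on (g ` S) \<and> integral (g ` S) h = b" for b
    using has_absolute_integral_change_of_variables[OF S' der inj, of "\<lambda>y. vec (h y) :: real^1" "vec b"]
    by (simp add: absolutely_integrable_on_1_iff integral_on_1_eq vec_eq_iff)
  have na: "0 \<le> ?a y" for y using nonneg by (auto simp: indicator_def)
  have nb: "0 \<le> ?b y" for y using nonneg by (auto simp: indicator_def)
  have ia: "h absolutely_integrable_on (g ` S) \<longleftrightarrow> integrable lborel ?a"
    using m1 by (simp add: set_integrable_def integrable_completion)
  have ib: "?h absolutely_integrable_on S \<longleftrightarrow> integrable lborel ?b"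
    using m2 by (simp add: set_integrable_def integrable_completion)
  show ?thesis
  proof (cases "integrable lborel ?a")
    case True
    then have T: "h absolutely_integrable_on (g ` S)" using ia by simp
    then have U: "?h absolutely_integrable_on S" "integral S ?h = integral (g ` S) h"
      using key[of "integral (g ` S) h"] by auto
    have "integral (g ` S) h = integral\<^sup>L lborel ?a"
      using set_lebesgue_integral_eq_integral(2)[OF T] m1
      by (simp add: set_lebesgue_integral_def integral_completion)
    moreover have "integral S ?h = integral\<^sup>L lborel ?b"
      using set_lebesgue_integral_eq_integral(2)[OF U(1)] m2
      by (simp add: set_lebesgue_integral_def integral_completion)
    ultimately show ?thesis
      using nn_integral_eq_integral[OF True] nn_integral_eq_integral[of lborel ?b] ib U na nb by simp
  next
    case False
    then have "\<not> integrable lborel ?b" using key ia ib by blast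
    then have "(\<integral>\<^sup>+ x. ennreal (?b x) \<partial>lborel) = \<infinity>"
      using integrableI_nonneg[of ?b lborel] m2 nb by (auto simp: less_top[symmetric])
    moreover have "(\<integral>\<^sup>+ x. ennreal (?a x) \<partial>lborel) = \<infinity>"
      using integrableI_nonneg[of ?a lborel] m1 na False by (auto simp: less_top[symmetric])
    ultimately show ?thesis by simp
  qed
qed

text \<open>A copy of a finite type on which a well-order is available. The order is pulled back from an
  arbitrary injection into the natural numbers.\<close>

typedef 'n wo = "UNIV :: 'n set" morphisms of_wo to_wo ..

definition wo_rank :: "'n::finite wo \<Rightarrow> nat" where
  "wo_rank i = (SOME f. inj f) (of_wo i)"

lemma inj_wo_rank: "inj wo_rank"
proof (rule injI)
  fix x y :: "'n::finite wo"
  assume eq: "wo_rank x = wo_rank y"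
  have "\<exists>f :: 'n \<Rightarrow> nat. inj f"
    using finite_imp_inj_to_nat_seg[OF finite[of "UNIV :: 'n set"]] by blast
  then have "inj (SOME f :: 'n \<Rightarrow> nat. inj f)" by (rule someI_ex)
  then have "of_wo x = of_wo y" using eq unfolding wo_rank_def by (rule injD)
  then show "x = y" by (simp only: of_wo_inject)
qed

instantiation wo :: (finite) "{finite,wellorder}"
begin
definition less_eq_wo :: "'a wo \<Rightarrow> 'a wo \<Rightarrow> bool" where "x \<le> y \<longleftrightarrow> wo_rank x \<le> wo_rank y"
definition less_wo :: "'a wo \<Rightarrow> 'a wo \<Rightarrow> bool" where "x < y \<longleftrightarrow> wo_rank x < wo_rank y"
instance
proof
  have "UNIV \<subseteq> range (to_wo :: 'a \<Rightarrow> 'a wo)" by (metis of_wo_inverse rangeI subsetI)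
  then show "finite (UNIV :: 'a wo set)" by (rule finite_surj[OF finite])
next
  fix P :: "'a wo \<Rightarrow> bool" and a
  assume *: "\<And>x. (\<And>y. y < x \<Longrightarrow> P y) \<Longrightarrow> P x"
  have "wo_rank a = k \<longrightarrow> P a" for k a
  proof (induction k arbitrary: a rule: less_induct)
    case (less k)
    show ?case
    proof
      assume k: "wo_rank a = k"
      show "P a"
      proof (rule *)
        fix y assume "y < a"
        then show "P y" using less.IH k unfolding less_wo_def by blast
      qed
    qed
  qed
  then show "P a" by blast
next
  fix x y :: "'a wo"
  assume "x \<le> y" "y \<le> x"
  then show "x = y" unfolding less_eq_wo_def by (intro injD[OF inj_wo_rank] order.antisym)
qed (simp add: less_eq_wo_def less_wo_def less_le_not_le, simp add: less_eq_wo_def,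
  simp add: less_eq_wo_def, simp add: less_eq_wo_def linear)
end

definition wo_vec :: "real^'n::finite \<Rightarrow> real^'n wo" where "wo_vec x = (\<chi> i. x $ of_wo i)"
definition un_wo_vec :: "real^'n wo \<Rightarrow> real^'n::finite" where "un_wo_vec x = (\<chi> i. x $ to_wo i)"

lemma wo_vec_inverse[simp]: "un_wo_vec (wo_vec x) = x" "wo_vec (un_wo_vec y) = y"
  by (auto simp: wo_vec_def un_wo_vec_def vec_eq_iff to_wo_inverse of_wo_inverse)

lemma linear_wo_vec: "linear wo_vec" "linear un_wo_vec"
  by (auto intro!: linearI simp: wo_vec_def un_wo_vec_def vec_eq_iff)

lemma bounded_linear_wo_vec: "bounded_linear wo_vec" "bounded_linear un_wo_vec"
  using linear_wo_vec linear_linear by blast+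

lemma continuous_wo_vec: "continuous_on A wo_vec" "continuous_on B un_wo_vec"
  using bounded_linear_wo_vec linear_continuous_on by blast+

lemma measurable_wo_vec[measurable]: "wo_vec \<in> borel_measurable borel" "un_wo_vec \<in> borel_measurable borel"
  using continuous_wo_vec by (auto intro: borel_measurable_continuous_onI)

lemma distr_lborel_wo_vec: "distr lborel borel (wo_vec :: real^'n::finite \<Rightarrow> _) = lborel"
proof (rule lborel_eqI[symmetric])
  fix l u :: "real^'n wo"
  assume le: "\<And>b. b \<in> Basis \<Longrightarrow> l \<bullet> b \<le> u \<bullet> b"
  have le': "un_wo_vec l \<bullet> b \<le> un_wo_vec u \<bullet> b" if bB: "b \<in> Basis" for b
  proof -
    obtain i where b: "b = axis i 1" using bB by (auto simp: Basis_vec_def)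
    have "l \<bullet> axis (to_wo i) 1 \<le> u \<bullet> axis (to_wo i) 1" by (rule le) (simp add: axis_in_Basis_iff)
    then show ?thesis by (simp add: b inner_axis un_wo_vec_def)
  qed
  have "wo_vec -` box l u = box (un_wo_vec l) (un_wo_vec u)"
  proof -
    have "(\<forall>i. l $ i < x $ of_wo i \<and> x $ of_wo i < u $ i) \<longleftrightarrow>
        (\<forall>j. l $ to_wo j < x $ j \<and> x $ j < u $ to_wo j)" for x :: "real^'n"
      by (metis to_wo_inverse of_wo_inverse UNIV_I)
    then show ?thesis by (simp add: set_eq_iff mem_box_cart wo_vec_def un_wo_vec_def)
  qed
  then have "emeasure (distr lborel borel wo_vec) (box l u) = emeasure lborel (box (un_wo_vec l) (un_wo_vec u))"
    by (subst emeasure_distr) auto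
  also have "\<dots> = (\<Prod>b\<in>Basis. (un_wo_vec u - un_wo_vec l) \<bullet> b)"
    using le' by (rule emeasure_lborel_box)
  also have "(\<Prod>b\<in>Basis. (un_wo_vec u - un_wo_vec l) \<bullet> b) = (\<Prod>i\<in>UNIV. (u - l) $ to_wo i)"
    by (subst prod.reindex_bij_betw[where h="\<lambda>i. axis i 1" and S=UNIV, symmetric])
       (auto simp: bij_betw_def inj_on_def axis_eq_axis Basis_vec_def inner_axis un_wo_vec_def)
  also have "\<dots> = (\<Prod>i\<in>UNIV. (u - l) $ i)"
  proof -
    have b: "bij_betw to_wo UNIV UNIV"
      by (rule bij_betw_byWitness[where f'=of_wo]) (auto simp: to_wo_inverse of_wo_inverse)
    show ?thesis by (rule prod.reindex_bij_betw[OF b, of "\<lambda>i. (u - l) $ i"])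
  qed
  also have "\<dots> = (\<Prod>b\<in>Basis. (u - l) \<bullet> b)"
    by (subst prod.reindex_bij_betw[where h="\<lambda>i. axis i 1" and S=UNIV, symmetric])
       (auto simp: bij_betw_def inj_on_def axis_eq_axis Basis_vec_def inner_axis)
  finally show "emeasure (distr lborel borel wo_vec) (box l u) = (\<Prod>b\<in>Basis. (u - l) \<bullet> b)" .
qed simp

lemma nn_integral_wo_vec:
  fixes f :: "real^'n::finite wo \<Rightarrow> ennreal"
  assumes "f \<in> borel_measurable borel"
  shows "(\<integral>\<^sup>+ x. f (wo_vec x) \<partial>lborel) = (\<integral>\<^sup>+ y. f y \<partial>lborel)"
  by (subst distr_lborel_wo_vec[symmetric], subst nn_integral_distr) (use assms in auto)

text \<open>Renaming rows and columns by the same bijection conjugates the permutations in the Leibniz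
  formula, and conjugation preserves signs.\<close>

lemma det_wo:
  fixes A :: "real^'n::finite^'n"
  shows "det (\<chi> i j. A $ of_wo i $ of_wo j) = det A"
proof -
  have b: "bij_betw (to_wo :: 'n \<Rightarrow> _) UNIV UNIV"
    by (rule bij_betw_byWitness[where f'=of_wo]) (auto simp: to_wo_inverse of_wo_inverse)
  have i: "inj (to_wo :: 'n \<Rightarrow> _)" using b bij_betw_imp_inj_on by blast
  have inv: "inv_into UNIV to_wo x = of_wo x" for x :: "'n wo"
    by (rule inv_f_eq[OF i of_wo_inverse])
  let ?m = "map_permutation (UNIV :: 'n set) to_wo"
  have m: "?m p x = to_wo (p (of_wo x))" for p and x :: "'n wo"
    using bij_betw_imp_surj_on[OF b] by (simp add: map_permutation_def restrict_id_def inv)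
  have bb: "bij_betw ?m {p. p permutes UNIV} {p. p permutes UNIV}"
  proof -
    have "?m = (\<lambda>\<pi> x. if x \<in> UNIV then to_wo (\<pi> (inv_into UNIV to_wo x)) else x)"
      by (simp only: fun_eq_iff m inv UNIV_I if_True simp_thms)
    then show ?thesis using bij_betw_permutations[OF b] by (simp only:)
  qed
  have "det (\<chi> i j. A $ of_wo i $ of_wo j) =
    (\<Sum>p\<in>{p. p permutes UNIV}. of_int (sign (?m p)) * (\<Prod>i\<in>UNIV. A $ of_wo i $ of_wo (?m p i)))"
    unfolding det_def by (subst sum.reindex_bij_betw[OF bb, symmetric]) simp
  also have "\<dots> = (\<Sum>p\<in>{p. p permutes UNIV}. of_int (sign p) * (\<Prod>i\<in>UNIV. A $ i $ p i))"
  proof (rule sum.cong[OF refl], clarsimp simp del: of_int_mult)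
    fix p :: "'n \<Rightarrow> 'n" assume p: "p permutes UNIV"
    have "(\<Prod>i\<in>UNIV. A $ of_wo i $ of_wo (?m p i)) = (\<Prod>i\<in>UNIV. A $ i $ p i)"
      by (subst prod.reindex_bij_betw[OF b, symmetric]) (simp add: m to_wo_inverse)
    then show "of_int (sign (?m p)) * (\<Prod>i\<in>UNIV. A $ of_wo i $ of_wo (?m p i)) = of_int (sign p) * (\<Prod>i\<in>UNIV. A $ i $ p i)"
      using sign_map_permutation[OF i p] by simp
  qed
  also have "\<dots> = det A" unfolding det_def ..
  finally show ?thesis .
qed

text \<open>Renaming coordinates preserves Lebesgue measure and determinants, so the map can be conjugated
  to one over the well-ordered copy of the index type.\<close>

lemma nn_integral_change_of_variables:
  fixes g :: "real^'n::finite \<Rightarrow> real^'n" and h :: "real^'n \<Rightarrow> real"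
  assumes S: "S \<in> sets borel"
    and der: "\<And>x. x \<in> S \<Longrightarrow> (g has_derivative g' x) (at x within S)"
    and inj: "inj_on g S"
    and nonneg: "\<And>y. y \<in> g ` S \<Longrightarrow> 0 \<le> h y"
    and m1: "(\<lambda>y. indicator (g ` S) y * h y) \<in> borel_measurable borel"
    and m2: "(\<lambda>x. indicator S x * (\<bar>det (matrix (g' x))\<bar> * h (g x))) \<in> borel_measurable borel"
  shows "(\<integral>\<^sup>+ y. ennreal (indicator (g ` S) y * h y) \<partial>lborel) =
         (\<integral>\<^sup>+ x. ennreal (indicator S x * (\<bar>det (matrix (g' x))\<bar> * h (g x))) \<partial>lborel)"
proof -
  let ?W = "wo_vec :: real^'n \<Rightarrow> _" and ?U = "un_wo_vec :: _ \<Rightarrow> real^'n"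
  define G where "G = (\<lambda>x. ?W (g (?U x)))"
  define G' where "G' = (\<lambda>x v. ?W (g' (?U x) (?U v)))"
  define T where "T = ?U -` S"
  have TS: "T = ?W ` S" 
  proof
    show "T \<subseteq> ?W ` S" by (auto simp: T_def intro: image_eqI[of _ _ "?U _"])
  qed (auto simp: T_def)
  have US: "?U ` T = S" unfolding TS image_image by simp
  have GT: "G ` T = ?U -` (g ` S)"
  proof
    show "?U -` (g ` S) \<subseteq> G ` T"
    proof
      fix y assume "y \<in> ?U -` (g ` S)"
      then obtain x where "x \<in> S" "?U y = g x" by auto
      then have "y = G (?W x)" "?W x \<in> T" by (auto simp: G_def T_def) (metis wo_vec_inverse(2))
      then show "y \<in> G ` T" by blast
    qed
  qed (auto simp: G_def T_def)
  have 1: "T \<in> sets borel" unfolding T_def using measurable_sets[OF measurable_wo_vec(2) S] by simp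
  have 2: "(G has_derivative G' x) (at x within T)" if "x \<in> T" for x
  proof -
    have "(?U has_derivative ?U) (at x within T)"
      using bounded_linear_wo_vec(2) bounded_linear_imp_has_derivative by blast
    moreover have "(g has_derivative g' (?U x)) (at (?U x) within ?U ` T)"
      using der[of "?U x"] that US T_def by auto
    ultimately have "((g \<circ> ?U) has_derivative (g' (?U x) \<circ> ?U)) (at x within T)"
      by (rule diff_chain_within)
    then have "((\<lambda>y. ?W ((g \<circ> ?U) y)) has_derivative (\<lambda>v. ?W ((g' (?U x) \<circ> ?U) v))) (at x within T)"
      by (rule bounded_linear.has_derivative[OF bounded_linear_wo_vec(1)])
    then show ?thesis unfolding G_def G'_def o_def .
  qed
  have 3: "inj_on G T"
  proof (rule inj_onI)
    fix x y assume xy: "x \<in> T" "y \<in> T" "G x = G y"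
    then have "g (?U x) = g (?U y)" unfolding G_def by (metis wo_vec_inverse(1))
    then have "?U x = ?U y" using inj xy by (auto simp: T_def inj_on_def)
    then show "x = y" by (metis wo_vec_inverse(2))
  qed
  have detm: "det (matrix (G' x)) = det (matrix (g' (?U x)))" for x
  proof -
    have ax: "?U (axis j 1) = axis (of_wo j) 1" for j
      by (auto simp: un_wo_vec_def axis_def vec_eq_iff of_wo_inverse to_wo_inverse)
    have "matrix (G' x) = (\<chi> i j. matrix (g' (?U x)) $ of_wo i $ of_wo j)"
      by (simp add: matrix_def G'_def wo_vec_def vec_eq_iff ax)
    then show ?thesis by (simp add: det_wo)
  qed
  have i1: "indicator (G ` T) y * h (?U y) = indicator (g ` S) (?U y) * h (?U y)" for y
    unfolding GT by (simp add: indicator_def)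
  have i2: "indicator T x * (\<bar>det (matrix (G' x))\<bar> * h (?U (G x))) =
      indicator S (?U x) * (\<bar>det (matrix (g' (?U x)))\<bar> * h (g (?U x)))" for x
    by (simp add: detm T_def G_def indicator_def)
  have "(\<integral>\<^sup>+ y. ennreal (indicator (G ` T) y * h (?U y)) \<partial>lborel) =
     (\<integral>\<^sup>+ x. ennreal (indicator T x * (\<bar>det (matrix (G' x))\<bar> * h (?U (G x)))) \<partial>lborel)"
  proof (rule nn_integral_change_of_variables_wellorder[OF 1 2 3])
    show "\<And>y. y \<in> G ` T \<Longrightarrow> 0 \<le> h (?U y)" using nonneg unfolding GT by auto
    show "(\<lambda>y. indicator (G ` T) y * h (?U y)) \<in> borel_measurable borel"
      unfolding i1 using measurable_compose[OF measurable_wo_vec(2) m1] .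
    show "(\<lambda>x. indicator T x * (\<bar>det (matrix (G' x))\<bar> * h (?U (G x)))) \<in> borel_measurable borel"
      unfolding i2 using measurable_compose[OF measurable_wo_vec(2) m2] .
  qed
  then show ?thesis
    unfolding i1 i2
    using nn_integral_wo_vec[OF measurable_compose[OF measurable_compose[OF measurable_wo_vec(2) m1] measurable_ennreal]]
      nn_integral_wo_vec[OF measurable_compose[OF measurable_compose[OF measurable_wo_vec(2) m2] measurable_ennreal]]
    by (simp only: wo_vec_inverse)
qed


section \<open>Functions on rectangles\<close>

text \<open>The components are pointwise limits of difference quotients.\<close>

lemma borel_measurable_gradient:
  fixes u :: "'b::euclidean_space \<Rightarrow> real"
  assumes E: "open E" and der: "\<And>w. w \<in> E \<Longrightarrow> (u has_derivative (\<lambda>h. Du w \<bullet> h)) (at w)"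
  shows "(\<lambda>w. indicator E w *\<^sub>R Du w) \<in> borel_measurable borel"
  unfolding borel_measurable_euclidean_space[of "\<lambda>w. indicator E w *\<^sub>R Du w"]
proof
  fix b :: 'b assume "b \<in> Basis"
  define u0 where "u0 w = indicator E w *\<^sub>R u w" for w
  have "continuous_on E u"
    using der has_derivative_continuous by (metis continuous_at_imp_continuous_on)
  then have [measurable]: "u0 \<in> borel_measurable borel"
    unfolding u0_def by (intro borel_measurable_continuous_on_indicator) (use E in simp)
  have [measurable]: "E \<in> sets borel" using E by simp
  show "(\<lambda>w. indicator E w *\<^sub>R Du w \<bullet> b) \<in> borel_measurable borel"
  proof (rule borel_measurable_LIMSEQ_real)
    fix w :: 'b
    let ?q = "\<lambda>k. indicator E w * ((u0 (w + inverse (real (Suc k)) *\<^sub>R b) - u0 w) / inverse (real (Suc k)))"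
    show "?q \<longlonglongrightarrow> indicator E w *\<^sub>R Du w \<bullet> b"
    proof (cases "w \<in> E")
      case True
      let ?g = "\<lambda>t::real. u (w + t *\<^sub>R b)"
      have "(?g has_derivative (\<lambda>t. Du w \<bullet> (t *\<^sub>R b))) (at 0)"
      proof (rule has_derivative_compose[where f="\<lambda>t. w + t *\<^sub>R b" and g=u, simplified])
        show "((\<lambda>t. w + t *\<^sub>R b) has_derivative (\<lambda>t. t *\<^sub>R b)) (at 0)"
          by (auto intro!: derivative_eq_intros)
      qed (use der[OF True] in simp)
      then have "(?g has_field_derivative (Du w \<bullet> b)) (at 0)"
        by (simp add: has_field_derivative_def mult_commute_abs)
      then have "((\<lambda>h. (?g (0 + h) - ?g 0) / h) \<longlongrightarrow> Du w \<bullet> b) (at 0)"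
        by (simp only: DERIV_def)
      moreover have lim: "(\<lambda>k. inverse (real (Suc k))) \<longlonglongrightarrow> 0" using LIMSEQ_inverse_real_of_nat .
      moreover have "filterlim (\<lambda>k. inverse (real (Suc k))) (at 0) sequentially"
        using lim by (simp add: filterlim_at)
      ultimately have lim2: "(\<lambda>k. (?g (0 + inverse (real (Suc k))) - ?g 0) / inverse (real (Suc k))) \<longlonglongrightarrow> Du w \<bullet> b"
        using filterlim_compose by blast
      have "(\<lambda>k. w + inverse (real (Suc k)) *\<^sub>R b) \<longlonglongrightarrow> w + 0 *\<^sub>R b"
        by (intro tendsto_intros lim)
      then have "(\<lambda>k. w + inverse (real (Suc k)) *\<^sub>R b) \<longlonglongrightarrow> w" by simp
      then have ev: "\<forall>\<^sub>F k in sequentially. w + inverse (real (Suc k)) *\<^sub>R b \<in> E"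
        using E True by (rule topological_tendstoD)
      have "?q \<longlonglongrightarrow> Du w \<bullet> b"
        by (rule Lim_transform_eventually[OF lim2]) (use ev in \<open>eventually_elim; simp add: u0_def True\<close>)
      then show ?thesis using True by simp
    qed simp
  qed measurable
qed

lemma nn_integral_inverse_sqrt:
  "(\<integral>\<^sup>+ r. ennreal (indicator {0..1} r * (1 / (4 * sqrt r))) \<partial>lborel) = ennreal (1 / 2)"
proof -
  have "((\<lambda>r. 1 / (4 * sqrt r)) has_integral (sqrt 1 / 2 - sqrt 0 / 2)) {0..1}"
  proof (rule fundamental_theorem_of_calculus_interior)
    show "((\<lambda>r. sqrt r / 2) has_vector_derivative 1 / (4 * sqrt x)) (at x)" if "x \<in> {0<..<1}" for x
      using that by (auto intro!: derivative_eq_intros simp: has_real_derivative_iff_has_vector_derivative[symmetric] field_simps)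
  qed (auto intro!: continuous_intros)
  then have "((\<lambda>r. if r \<in> {0..1} then 1 / (4 * sqrt r) else 0) has_integral (1/2)) UNIV"
    by (subst has_integral_restrict_UNIV) simp
  moreover have "(\<lambda>r. if r \<in> {0..1} then 1 / (4 * sqrt r) else 0) = (\<lambda>r::real. indicator {0..1} r * (1 / (4 * sqrt r)))"
    by (auto simp: indicator_def)
  ultimately have "((\<lambda>r. indicator {0..1} r * (1 / (4 * sqrt r))) has_integral (1/2)) UNIV" by simp
  then show ?thesis
    by (intro nn_integral_has_integral_lborel) (auto simp: indicator_def)
qed

text \<open>The factor \<open>r\<close> is the Jacobian of the pencil of segments used below, and \<open>1 / sqrt r\<close> is
  integrable at 0. If \<open>a\<close> exceeds the first term, a power \<open>p - 1 \<ge> 2\<close> of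
  \<open>4 * \<Lambda> * a * sqrt r \<ge> 1\<close> supplies the missing factor \<open>r\<close>.\<close>

lemma young_pencil:
  fixes a r \<Lambda> :: real
  assumes "a \<ge> 0" "0 < r" "r \<le> 1" "\<Lambda> > 0" "p \<ge> 3"
  shows "\<Lambda> * a \<le> 1 / (4 * sqrt r) + \<Lambda> * (4 * \<Lambda>) ^ (p - 1) * (r * a ^ p)"
proof (cases "4 * \<Lambda> * a * sqrt r \<le> 1")
  case True
  then have "\<Lambda> * a \<le> 1 / (4 * sqrt r)" using assms by (simp add: field_simps)
  moreover have "0 \<le> \<Lambda> * (4 * \<Lambda>) ^ (p - 1) * (r * a ^ p)" using assms by simp
  ultimately show ?thesis by linarith
next
  case False
  then have big: "1 \<le> 4 * \<Lambda> * a * sqrt r" by simp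
  have "1 \<le> (4 * \<Lambda> * a * sqrt r) ^ (p - 1)" using big by simp
  also have "\<dots> = (4 * \<Lambda>) ^ (p - 1) * a ^ (p - 1) * sqrt r ^ (p - 1)" by (simp add: power_mult_distrib)
  also have "\<dots> \<le> (4 * \<Lambda>) ^ (p - 1) * a ^ (p - 1) * r"
  proof -
    have "sqrt r ^ (p - 1) \<le> sqrt r ^ 2" by (rule power_decreasing) (use assms in auto)
    then have "sqrt r ^ (p - 1) \<le> r" using assms by simp
    then show ?thesis using assms by (intro mult_left_mono) auto
  qed
  finally have "\<Lambda> * a * 1 \<le> \<Lambda> * a * ((4 * \<Lambda>) ^ (p - 1) * a ^ (p - 1) * r)"
    using assms by (intro mult_left_mono) auto
  also have "\<dots> = \<Lambda> * (4 * \<Lambda>) ^ (p - 1) * (r * (a * a ^ (p - 1)))" by (simp add: ac_simps)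
  also have "a * a ^ (p - 1) = a ^ p" using assms by (metis Suc_pred' power_Suc less_le_trans zero_less_numeral)
  finally show ?thesis using assms by (simp add: add_increasing)
qed

text \<open>The gauge integral of a derivative is always the increment. If the right-hand side is finite,
  the derivative is Lebesgue integrable and the two integrals agree.\<close>

lemma increment_le_nn_integral:
  fixes q :: "real \<Rightarrow> real"
  assumes der: "\<And>r. r \<in> {0..1} \<Longrightarrow> (q has_real_derivative q' r) (at r within {0..1})"
    and meas: "(\<lambda>r. indicator {0..1} r * q' r) \<in> borel_measurable borel"
  shows "ennreal (q 1 - q 0) \<le> (\<integral>\<^sup>+ r. ennreal (indicator {0..1} r * \<bar>q' r\<bar>) \<partial>lborel)"
proof (cases "(\<integral>\<^sup>+ r. ennreal (indicator {0..1} r * \<bar>q' r\<bar>) \<partial>lborel) = \<infinity>")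
  case False
  have eq: "norm (indicator {0..1} r *\<^sub>R q' r) = indicator {0..1} r * \<bar>q' r\<bar>" for r
    by (simp add: abs_mult)
  have int: "set_integrable lborel {0..1} q'"
    unfolding set_integrable_def
  proof (rule integrableI_bounded)
    show "(\<integral>\<^sup>+ r. ennreal (norm (indicator {0..1} r *\<^sub>R q' r)) \<partial>lborel) < \<infinity>"
      unfolding eq using False by (simp add: less_top)
  qed (use meas in simp)
  have "(q' has_integral (q 1 - q 0)) {0..1}"
    by (rule fundamental_theorem_of_calculus) (use der in \<open>auto simp: has_real_derivative_iff_has_vector_derivative\<close>)
  then have "q 1 - q 0 = (LINT r:{0..1}|lborel. q' r)"
    using set_borel_integral_eq_integral(2)[OF int] by (simp add: integral_unique)
  then have "q 1 - q 0 \<le> norm (LINT r|lborel. indicator {0..1} r *\<^sub>R q' r)"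
    by (simp add: set_lebesgue_integral_def)
  then have "ennreal (q 1 - q 0) \<le> ennreal (norm (LINT r|lborel. indicator {0..1} r *\<^sub>R q' r))"
    by (rule ennreal_leI)
  also have "\<dots> \<le> (\<integral>\<^sup>+ r. ennreal (norm (indicator {0..1} r *\<^sub>R q' r)) \<partial>lborel)"
    using int unfolding set_integrable_def by (rule integral_norm_bound_ennreal)
  finally show ?thesis unfolding eq .
qed simp

text \<open>A quantitative Morrey estimate in dimension 2, by way of the pencil of segments from the point
  where \<open>u \<le> 0\<close> to the points of the edge where \<open>u \<ge> 1\<close>. Along each segment the gradient
  integrates to at least 1. In the coordinates \<open>\<alpha>\<close> (end point on the edge) and \<open>r\<close> (position on
  the segment) the area element is \<open>t * r\<close>, so that \<open>young_pencil\<close> trades the average of the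
  gradient over the pencil for its \<open>p\<close>-energy. The constant depends neither on \<open>u\<close> nor on
  \<open>t\<close>, \<open>s0\<close> and \<open>v\<close>.\<close>

lemma rectangle_energy_lower_bound:
  fixes u :: "'b::euclidean_space \<Rightarrow> real" and v e d :: 'b
  assumes p: "p \<ge> 3" and E: "open E"
    and der: "\<And>w. w \<in> E \<Longrightarrow> (u has_derivative (\<lambda>h. Du w \<bullet> h)) (at w)"
    and t: "1 \<le> t" "t \<le> L" and s0: "s0 \<in> {0..1}"
    and rect: "\<And>\<tau> s. \<tau> \<in> {0..t} \<Longrightarrow> s \<in> {0..1} \<Longrightarrow> v + \<tau> *\<^sub>R e + s *\<^sub>R d \<in> E"
    and zero: "u (v + t *\<^sub>R e + s0 *\<^sub>R d) \<le> 0" and one: "\<And>s. s \<in> {0..1} \<Longrightarrow> 1 \<le> u (v + s *\<^sub>R d)"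
    and C: "C = (L * norm e + norm d + 1) * (4 * (L * norm e + norm d + 1)) ^ (p - 1)"
  shows "ennreal (1 / 2) \<le> ennreal C *
     (\<integral>\<^sup>+ \<tau>. indicator {0..L} \<tau> * (\<integral>\<^sup>+ s. indicator {0..1} s *
        (indicator E (v + \<tau> *\<^sub>R e + s *\<^sub>R d) * ennreal (norm (Du (v + \<tau> *\<^sub>R e + s *\<^sub>R d)) ^ p)) \<partial>lborel) \<partial>lborel)"
proof -
  define \<Lambda> where "\<Lambda> = L * norm e + norm d + 1"
  have L0: "\<Lambda> > 0" "L \<ge> 0" using t by (auto simp: \<Lambda>_def add_nonneg_pos)
  have C: "C = \<Lambda> * (4 * \<Lambda>) ^ (p - 1)" using C by (simp add: \<Lambda>_def)
  define D where "D w = indicator E w *\<^sub>R Du w" for w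
  have [measurable]: "D \<in> borel_measurable borel" unfolding D_def by (rule borel_measurable_gradient[OF E der])
  define H where "H w = ennreal (norm (D w) ^ p)" for w
  have [measurable]: "H \<in> borel_measurable borel" unfolding H_def by measurable
  have H: "indicator E w * ennreal (norm (Du w) ^ p) = H w" for w
    using p by (simp add: H_def D_def indicator_def power_0_left)
  define \<sigma> where "\<sigma> \<alpha> r = v + ((1 - r) * t) *\<^sub>R e + (s0 + r * (\<alpha> - s0)) *\<^sub>R d" for \<alpha> r
  have par: "s0 + r * (\<alpha> - s0) \<in> {0..1}" "(1 - r) * t \<in> {0..t}" if "\<alpha> \<in> {0..1}" "r \<in> {0..1}" for \<alpha> r
  proof -
    have "s0 + r * (\<alpha> - s0) = (1 - r) * s0 + r * \<alpha>" by (simp add: algebra_simps)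
    moreover have "0 \<le> (1 - r) * s0 + r * \<alpha>" using that s0 by simp
    moreover have "(1 - r) * s0 + r * \<alpha> \<le> (1 - r) * 1 + r * 1"
      using that s0 by (intro add_mono mult_left_mono) auto
    ultimately show "s0 + r * (\<alpha> - s0) \<in> {0..1}" by simp
    show "(1 - r) * t \<in> {0..t}" using that t by (auto intro!: mult_left_le_one_le)
  qed
  have \<sigma>E: "\<sigma> \<alpha> r \<in> E" if "\<alpha> \<in> {0..1}" "r \<in> {0..1}" for \<alpha> r
    unfolding \<sigma>_def by (rule rect[OF par(2)[OF that] par(1)[OF that]])
  have \<sigma>meas[measurable]: "(\<lambda>r. \<sigma> \<alpha> r) \<in> borel_measurable borel" for \<alpha> unfolding \<sigma>_def by measurable
  have A: "1 \<le> (\<integral>\<^sup>+ r. ennreal (indicator {0..1} r * (\<Lambda> * norm (D (\<sigma> \<alpha> r)))) \<partial>lborel)" if \<alpha>: "\<alpha> \<in> {0..1}" for \<alpha>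
  proof -
    define c where "c = (\<alpha> - s0) *\<^sub>R d - t *\<^sub>R e"
    have cn: "norm c \<le> \<Lambda>"
    proof -
      have "norm c \<le> \<bar>\<alpha> - s0\<bar> * norm d + t * norm e"
        unfolding c_def using norm_triangle_ineq4[of "(\<alpha> - s0) *\<^sub>R d" "t *\<^sub>R e"] t by simp
      moreover have "\<bar>\<alpha> - s0\<bar> * norm d \<le> norm d" using \<alpha> s0 by (intro mult_left_le_one_le) auto
      moreover have "t * norm e \<le> L * norm e" using t by (intro mult_right_mono) auto
      ultimately show ?thesis by (simp add: \<Lambda>_def)
    qed
    have sd: "(\<sigma> \<alpha> has_derivative (\<lambda>h. h *\<^sub>R c)) (at r within {0..1})" for r
      unfolding \<sigma>_def c_def by (auto intro!: derivative_eq_intros simp: algebra_simps)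
    let ?q = "\<lambda>r. u (\<sigma> \<alpha> r)" and ?q' = "\<lambda>r. D (\<sigma> \<alpha> r) \<bullet> c"
    have qd: "(?q has_real_derivative ?q' r) (at r within {0..1})" if r: "r \<in> {0..1}" for r
    proof -
      have "(?q has_derivative (\<lambda>h. Du (\<sigma> \<alpha> r) \<bullet> (h *\<^sub>R c))) (at r within {0..1})"
        by (rule has_derivative_compose[OF sd der[OF \<sigma>E[OF \<alpha> r]]])
      then show ?thesis using \<sigma>E[OF \<alpha> r] by (simp add: has_field_derivative_def D_def mult_commute_abs)
    qed
    have "1 \<le> ?q 1 - ?q 0" using zero one[OF \<alpha>] by (simp add: \<sigma>_def)
    then have "1 \<le> ennreal (?q 1 - ?q 0)" using ennreal_leI[of 1 "?q 1 - ?q 0"] by simp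
    also have "\<dots> \<le> (\<integral>\<^sup>+ r. ennreal (indicator {0..1} r * \<bar>?q' r\<bar>) \<partial>lborel)"
      by (rule increment_le_nn_integral[OF qd]) measurable
    also have "\<dots> \<le> (\<integral>\<^sup>+ r. ennreal (indicator {0..1} r * (\<Lambda> * norm (D (\<sigma> \<alpha> r)))) \<partial>lborel)"
    proof (intro nn_integral_mono ennreal_leI mult_left_mono)
      fix r
      have "\<bar>?q' r\<bar> \<le> norm (D (\<sigma> \<alpha> r)) * norm c" by (rule Cauchy_Schwarz_ineq2)
      also have "\<dots> \<le> norm (D (\<sigma> \<alpha> r)) * \<Lambda>" using cn by (intro mult_left_mono) auto
      finally show "\<bar>?q' r\<bar> \<le> \<Lambda> * norm (D (\<sigma> \<alpha> r))" by (simp add: mult.commute)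
    qed simp
    finally show ?thesis .
  qed
  (* The term 1 / (4 * sqrt r) of the Young inequality integrates to 1/2. *)
  have B: "ennreal (1/2) \<le> ennreal C * (\<integral>\<^sup>+ r. indicator {0..1} r * (ennreal r * H (\<sigma> \<alpha> r)) \<partial>lborel)" if \<alpha>: "\<alpha> \<in> {0..1}" for \<alpha>
  proof -
    have "(\<integral>\<^sup>+ r. ennreal (indicator {0..1} r * (\<Lambda> * norm (D (\<sigma> \<alpha> r)))) \<partial>lborel)
      \<le> (\<integral>\<^sup>+ r. ennreal (indicator {0..1} r * (1 / (4 * sqrt r))) + ennreal C * (indicator {0..1} r * (ennreal r * H (\<sigma> \<alpha> r))) \<partial>lborel)"
    proof (rule nn_integral_mono_AE)
      have "AE r in lborel. r \<noteq> (0::real)" by (rule AE_lborel_singleton)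
      then show "AE r in lborel. ennreal (indicator {0..1} r * (\<Lambda> * norm (D (\<sigma> \<alpha> r)))) \<le>
         ennreal (indicator {0..1} r * (1 / (4 * sqrt r))) + ennreal C * (indicator {0..1} r * (ennreal r * H (\<sigma> \<alpha> r)))"
      proof eventually_elim
        fix r :: real assume "r \<noteq> 0"
        show "ennreal (indicator {0..1} r * (\<Lambda> * norm (D (\<sigma> \<alpha> r)))) \<le>
         ennreal (indicator {0..1} r * (1 / (4 * sqrt r))) + ennreal C * (indicator {0..1} r * (ennreal r * H (\<sigma> \<alpha> r)))"
        proof (cases "r \<in> {0..1}")
          case True
          then have r: "0 < r" "r \<le> 1" using \<open>r \<noteq> 0\<close> by auto
          have C0: "C \<ge> 0" using L0 by (simp add: C)
          have "\<Lambda> * norm (D (\<sigma> \<alpha> r)) \<le> 1 / (4 * sqrt r) + C * (r * norm (D (\<sigma> \<alpha> r)) ^ p)"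
            using young_pencil[OF norm_ge_zero r L0(1) p] by (simp add: C)
          then have "ennreal (\<Lambda> * norm (D (\<sigma> \<alpha> r))) \<le> ennreal (1 / (4 * sqrt r) + C * (r * norm (D (\<sigma> \<alpha> r)) ^ p))"
            by (rule ennreal_leI)
          also have "\<dots> = ennreal (1 / (4 * sqrt r)) + ennreal C * (ennreal r * H (\<sigma> \<alpha> r))"
            using r C0 by (simp add: H_def ennreal_plus ennreal_mult)
          finally show ?thesis using True by simp
        qed simp
      qed
    qed
    also have "\<dots> = ennreal (1/2) + ennreal C * (\<integral>\<^sup>+ r. indicator {0..1} r * (ennreal r * H (\<sigma> \<alpha> r)) \<partial>lborel)"
      by (subst nn_integral_add, measurable)
        (subst nn_integral_inverse_sqrt, subst nn_integral_cmult, auto)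
    finally have le: "ennreal 1 \<le> ennreal (1/2) + ennreal C * (\<integral>\<^sup>+ r. indicator {0..1} r * (ennreal r * H (\<sigma> \<alpha> r)) \<partial>lborel)"
      using A[OF \<alpha>] by simp
    have "ennreal 1 = ennreal (1/2) + ennreal (1/2)" by (subst ennreal_plus[symmetric]) auto
    then have "ennreal (1/2) + ennreal (1/2) \<le> ennreal (1/2) + ennreal C * (\<integral>\<^sup>+ r. indicator {0..1} r * (ennreal r * H (\<sigma> \<alpha> r)) \<partial>lborel)"
      using le by simp
    then show ?thesis using ennreal_add_left_cancel_le[of "ennreal (1/2)"] by simp
  qed
  define g where "g \<tau> = (\<integral>\<^sup>+ s. indicator {0..1} s * H (v + \<tau> *\<^sub>R e + s *\<^sub>R d) \<partial>lborel)" for \<tau>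
  have gm[measurable]: "g \<in> borel_measurable borel" unfolding g_def by measurable
  have "ennreal (1/2) = (\<integral>\<^sup>+ \<alpha>. ennreal (1/2) * indicator {0..1::real} \<alpha> \<partial>lborel)"
    by (simp add: nn_integral_cmult_indicator)
  also have "\<dots> \<le> (\<integral>\<^sup>+ \<alpha>. ennreal C * (indicator {0..1} \<alpha> * (\<integral>\<^sup>+ r. indicator {0..1} r * (ennreal r * H (\<sigma> \<alpha> r)) \<partial>lborel)) \<partial>lborel)"
    by (intro nn_integral_mono) (use B in \<open>auto simp: indicator_def\<close>)
  also have "\<dots> = ennreal C * (\<integral>\<^sup>+ \<alpha>. indicator {0..1} \<alpha> * (\<integral>\<^sup>+ r. indicator {0..1} r * (ennreal r * H (\<sigma> \<alpha> r)) \<partial>lborel) \<partial>lborel)"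
    unfolding \<sigma>_def by (rule nn_integral_cmult) measurable
  also have "(\<integral>\<^sup>+ \<alpha>. indicator {0..1} \<alpha> * (\<integral>\<^sup>+ r. indicator {0..1} r * (ennreal r * H (\<sigma> \<alpha> r)) \<partial>lborel) \<partial>lborel)
     = (\<integral>\<^sup>+ \<alpha>. (\<integral>\<^sup>+ r. indicator {0..1} \<alpha> * (indicator {0..1} r * (ennreal r * H (\<sigma> \<alpha> r))) \<partial>lborel) \<partial>lborel)"
    unfolding \<sigma>_def by (intro nn_integral_cong nn_integral_cmult[symmetric]) measurable
  also have "\<dots> = (\<integral>\<^sup>+ r. (\<integral>\<^sup>+ \<alpha>. indicator {0..1} \<alpha> * (indicator {0..1} r * (ennreal r * H (\<sigma> \<alpha> r))) \<partial>lborel) \<partial>lborel)"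
    unfolding \<sigma>_def by (intro lborel_pair.Fubini') measurable
  also have "\<dots> \<le> (\<integral>\<^sup>+ r. indicator {0..1} r * g (t + (- t) * r) \<partial>lborel)"
  proof (rule nn_integral_mono_AE)
    have "AE r in lborel. r \<noteq> (0::real)" by (rule AE_lborel_singleton)
    then show "AE r in lborel. (\<integral>\<^sup>+ \<alpha>. indicator {0..1} \<alpha> * (indicator {0..1} r * (ennreal r * H (\<sigma> \<alpha> r))) \<partial>lborel)
        \<le> indicator {0..1} r * g (t + (- t) * r)"
    proof eventually_elim
      fix r :: real assume "r \<noteq> 0"
      show "(\<integral>\<^sup>+ \<alpha>. indicator {0..1} \<alpha> * (indicator {0..1} r * (ennreal r * H (\<sigma> \<alpha> r))) \<partial>lborel)
        \<le> indicator {0..1} r * g (t + (- t) * r)"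
      proof (cases "r \<in> {0..1}")
        case True
        then have r: "0 < r" "r \<le> 1" using \<open>r \<noteq> 0\<close> by auto
        let ?f = "\<lambda>s. indicator {0..1} s * H (v + ((1 - r) * t) *\<^sub>R e + s *\<^sub>R d)"
        (* For fixed r, the factor r is the derivative of the substitution s = (1 - r) * s0 + r * \<alpha>. *)
        have "(\<integral>\<^sup>+ \<alpha>. indicator {0..1} \<alpha> * (indicator {0..1} r * (ennreal r * H (\<sigma> \<alpha> r))) \<partial>lborel)
          \<le> (\<integral>\<^sup>+ \<alpha>. ennreal r * ?f ((1 - r) * s0 + r * \<alpha>) \<partial>lborel)"
        proof (rule nn_integral_mono)
          fix \<alpha> :: real
          have *: "(1 - r) * s0 + r * \<alpha> = s0 + r * (\<alpha> - s0)" by (simp add: algebra_simps)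
          show "indicator {0..1} \<alpha> * (indicator {0..1} r * (ennreal r * H (\<sigma> \<alpha> r))) \<le> ennreal r * ?f ((1 - r) * s0 + r * \<alpha>)"
            unfolding * using par(1)[of \<alpha> r] True by (auto simp: indicator_def \<sigma>_def)
        qed
        also have "\<dots> = ennreal r * (\<integral>\<^sup>+ \<alpha>. ?f ((1 - r) * s0 + r * \<alpha>) \<partial>lborel)"
          by (rule nn_integral_cmult) measurable
        also have "\<dots> = (\<integral>\<^sup>+ s. ?f s \<partial>lborel)"
          using nn_integral_real_affine[of ?f r "(1 - r) * s0"] r by simp
        also have "\<dots> = g ((1 - r) * t)" by (simp add: g_def)
        also have "(1 - r) * t = t + (- t) * r" by (simp add: algebra_simps)
        finally show ?thesis using True by simp
      qed simp
    qed
  qed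
  also have "\<dots> \<le> (\<integral>\<^sup>+ r. indicator {0..L} (t + (- t) * r) * g (t + (- t) * r) \<partial>lborel)"
  proof (intro nn_integral_mono)
    fix r :: real
    have "t + (- t) * r \<in> {0..L}" if "r \<in> {0..1}"
    proof -
      have "t * r \<le> t" "0 \<le> t * r" using that t by (auto intro: mult_left_le)
      then show ?thesis using t by simp
    qed
    then show "indicator {0..1} r * g (t + (- t) * r) \<le> indicator {0..L} (t + (- t) * r) * g (t + (- t) * r)"
      by (auto simp: indicator_def)
  qed
  also have "\<dots> \<le> ennreal \<bar>- t\<bar> * (\<integral>\<^sup>+ r. indicator {0..L} (t + (- t) * r) * g (t + (- t) * r) \<partial>lborel)"
  proof -
    have "1 \<le> ennreal \<bar>- t\<bar>" using t ennreal_leI[of 1 t] by simp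
    then have "x \<le> ennreal \<bar>- t\<bar> * x" for x
      using mult_right_mono[of 1 "ennreal \<bar>- t\<bar>" x] by simp
    then show ?thesis .
  qed
  also have "\<dots> = (\<integral>\<^sup>+ \<tau>. indicator {0..L} \<tau> * g \<tau> \<partial>lborel)"
    by (rule nn_integral_real_affine[symmetric]) (use t in auto)
  finally have "ennreal (1/2) \<le> ennreal C * (\<integral>\<^sup>+ \<tau>. indicator {0..L} \<tau> * g \<tau> \<partial>lborel)"
    by (simp add: mult_left_mono)
  then show ?thesis unfolding H g_def .
qed

lemma nn_integral_lborel_translate:
  fixes H :: "'b::euclidean_space \<Rightarrow> ennreal"
  assumes "H \<in> borel_measurable borel"
  shows "(\<integral>\<^sup>+ v. H (v + c) \<partial>lborel) = (\<integral>\<^sup>+ v. H v \<partial>lborel)"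
proof -
  have "(\<integral>\<^sup>+ v. H v \<partial>lborel) = (\<integral>\<^sup>+ v. H v \<partial>distr lborel borel ((+) c))"
    by (simp only: lborel_distr_plus)
  also have "\<dots> = (\<integral>\<^sup>+ v. H (c + v) \<partial>lborel)"
    using assms by (intro nn_integral_distr) auto
  finally show ?thesis by (simp add: add.commute)
qed

text \<open>When the base point runs through the whole space, every point is covered with the same weight,
  the area of the rectangle.\<close>

lemma nn_integral_rectangles:
  fixes H :: "'b::euclidean_space \<Rightarrow> ennreal"
  assumes [measurable]: "H \<in> borel_measurable borel" and L: "L \<ge> 0"
  shows "(\<integral>\<^sup>+ v. (\<integral>\<^sup>+ \<tau>. indicator {0..L} \<tau> * (\<integral>\<^sup>+ s. indicator {0..1} s * H (v + \<tau> *\<^sub>R e + s *\<^sub>R d) \<partial>lborel) \<partial>lborel) \<partial>lborel)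
     = ennreal L * (\<integral>\<^sup>+ v. H v \<partial>lborel)"
proof -
  have "(\<integral>\<^sup>+ v. (\<integral>\<^sup>+ \<tau>. indicator {0..L} \<tau> * (\<integral>\<^sup>+ s. indicator {0..1} s * H (v + \<tau> *\<^sub>R e + s *\<^sub>R d) \<partial>lborel) \<partial>lborel) \<partial>lborel)
     = (\<integral>\<^sup>+ \<tau>. (\<integral>\<^sup>+ v. indicator {0..L} \<tau> * (\<integral>\<^sup>+ s. indicator {0..1} s * H (v + \<tau> *\<^sub>R e + s *\<^sub>R d) \<partial>lborel) \<partial>lborel) \<partial>lborel)"
    by (rule lborel_pair.Fubini') measurable
  also have "\<dots> = (\<integral>\<^sup>+ \<tau>. indicator {0..L} \<tau> * (\<integral>\<^sup>+ v. H v \<partial>lborel) \<partial>lborel)"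
  proof (rule nn_integral_cong)
    fix \<tau> :: real
    have "(\<integral>\<^sup>+ v. indicator {0..L} \<tau> * (\<integral>\<^sup>+ s. indicator {0..1} s * H (v + \<tau> *\<^sub>R e + s *\<^sub>R d) \<partial>lborel) \<partial>lborel)
      = indicator {0..L} \<tau> * (\<integral>\<^sup>+ v. (\<integral>\<^sup>+ s. indicator {0..1} s * H (v + \<tau> *\<^sub>R e + s *\<^sub>R d) \<partial>lborel) \<partial>lborel)"
      by (rule nn_integral_cmult) measurable
    also have "(\<integral>\<^sup>+ v. (\<integral>\<^sup>+ s. indicator {0..1} s * H (v + \<tau> *\<^sub>R e + s *\<^sub>R d) \<partial>lborel) \<partial>lborel)
      = (\<integral>\<^sup>+ s. (\<integral>\<^sup>+ v. indicator {0..1} s * H (v + \<tau> *\<^sub>R e + s *\<^sub>R d) \<partial>lborel) \<partial>lborel)"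
      by (rule lborel_pair.Fubini') measurable
    also have "\<dots> = (\<integral>\<^sup>+ s. indicator {0..1::real} s * (\<integral>\<^sup>+ v. H v \<partial>lborel) \<partial>lborel)"
    proof (rule nn_integral_cong)
      fix s :: real
      have "(\<integral>\<^sup>+ v. indicator {0..1} s * H (v + \<tau> *\<^sub>R e + s *\<^sub>R d) \<partial>lborel)
         = indicator {0..1} s * (\<integral>\<^sup>+ v. H (v + (\<tau> *\<^sub>R e + s *\<^sub>R d)) \<partial>lborel)"
        by (subst nn_integral_cmult) (simp_all add: add.assoc)
      then show "(\<integral>\<^sup>+ v. indicator {0..1} s * H (v + \<tau> *\<^sub>R e + s *\<^sub>R d) \<partial>lborel)
         = indicator {0..1} s * (\<integral>\<^sup>+ v. H v \<partial>lborel)"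
        by (subst (asm) nn_integral_lborel_translate) auto
    qed
    also have "\<dots> = (\<integral>\<^sup>+ v. H v \<partial>lborel)"
      by (subst nn_integral_multc) auto
    finally show "(\<integral>\<^sup>+ v. indicator {0..L} \<tau> * (\<integral>\<^sup>+ s. indicator {0..1} s * H (v + \<tau> *\<^sub>R e + s *\<^sub>R d) \<partial>lborel) \<partial>lborel)
      = indicator {0..L} \<tau> * (\<integral>\<^sup>+ v. H v \<partial>lborel)" .
  qed
  also have "\<dots> = ennreal L * (\<integral>\<^sup>+ v. H v \<partial>lborel)"
    using L by (subst nn_integral_multc) auto
  finally show ?thesis .
qed


section \<open>Continuation of sections along lines\<close>

definition is_section :: "'a topology \<Rightarrow> ('a \<Rightarrow> 'b::topological_space) \<Rightarrow> 'b set \<Rightarrow> ('b \<Rightarrow> 'a) \<Rightarrow> bool" where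
  "is_section X f O' F \<longleftrightarrow> continuous_map (top_of_set O') X F \<and> (\<forall>w\<in>O'. f (F w) = w)"

text \<open>Spelled out through local inverses over balls, since these inverses are what continuation glues.\<close>

definition local_homeo :: "'a topology \<Rightarrow> ('a \<Rightarrow> 'b::metric_space) \<Rightarrow> bool" where
  "local_homeo X f \<longleftrightarrow> continuous_map X euclidean f \<and> (\<forall>z\<in>topspace X. \<exists>V G. \<exists>r>0. openin X V \<and> z \<in> V \<and>
      is_section X f (ball (f z) r) G \<and> G ` ball (f z) r = V \<and> (\<forall>v\<in>V. G (f v) = v))"

lemma is_sectionD:
  assumes "is_section X f S F" "w \<in> S"
  shows "F w \<in> topspace X" "f (F w) = w"
  using assms by (auto simp: is_section_def continuous_map_def)

lemma is_section_subset: "is_section X f S F \<Longrightarrow> T \<subseteq> S \<Longrightarrow> is_section X f T F"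
  by (auto simp: is_section_def intro: continuous_map_from_subtopology_mono)

lemma is_section_open_vimage:
  assumes "is_section X f S F" "open S" "openin X V"
  shows "open {w\<in>S. F w \<in> V}"
proof -
  have "openin (top_of_set S) {w\<in>topspace (top_of_set S). F w \<in> V}"
    using assms unfolding is_section_def by (intro openin_continuous_map_preimage[of _ X]) auto
  then show ?thesis using openin_open_trans[OF _ \<open>open S\<close>] by simp
qed

lemma local_homeoE:
  assumes "local_homeo X f" "z \<in> topspace X"
  obtains V G r where "r > 0" "openin X V" "z \<in> V" "is_section X f (ball (f z) r) G"
    "G ` ball (f z) r = V" "\<And>v. v \<in> V \<Longrightarrow> G (f v) = v"
  using assms unfolding local_homeo_def by metis

text \<open>The set where the sections agree is closed because the space is Hausdorff, and open because \<open>f\<close>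
  is injective near each point.\<close>

lemma section_unique:
  fixes f :: "'a \<Rightarrow> 'b::metric_space"
  assumes H: "Hausdorff_space X" and L: "local_homeo X f"
    and C: "connected C" and F: "is_section X f C F" and G: "is_section X f C G"
    and a: "a \<in> C" "F a = G a" and b: "b \<in> C"
  shows "F b = G b"
proof -
  let ?D = "{w\<in>C. F w = G w}"
  have "closedin (top_of_set C) {w \<in> topspace (top_of_set C). F w = G w}"
    using F G H unfolding is_section_def by (intro closedin_continuous_maps_eq) auto
  then have cl: "closedin (top_of_set C) ?D" by simp
  have "openin (top_of_set C) ?D"
  proof (subst openin_subopen, intro ballI)
    fix w assume w: "w \<in> ?D"
    then have "w \<in> C" by blast
    then have "F w \<in> topspace X" by (rule is_sectionD(1)[OF F])
    then obtain V K r where V: "openin X V" "F w \<in> V" "\<And>v. v \<in> V \<Longrightarrow> K (f v) = v"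
      using local_homeoE[OF L] by metis
    let ?T = "{u\<in>C. F u \<in> V} \<inter> {u\<in>C. G u \<in> V}"
    have "openin (top_of_set C) {w\<in>topspace (top_of_set C). F w \<in> V}"
      "openin (top_of_set C) {w\<in>topspace (top_of_set C). G w \<in> V}"
      using F G V(1) unfolding is_section_def by (intro openin_continuous_map_preimage[of _ X]; simp)+
    then have "openin (top_of_set C) ?T" using openin_Int by fastforce
    moreover have "w \<in> ?T" using w V(2) by simp
    moreover have "?T \<subseteq> ?D"
    proof
      fix u assume u: "u \<in> ?T"
      then have "F u = K u" "G u = K u"
        using V(3)[of "F u"] V(3)[of "G u"] is_sectionD(2)[OF F] is_sectionD(2)[OF G] by simp_all
      then show "u \<in> ?D" using u by simp
    qed
    ultimately show "\<exists>T. openin (top_of_set C) T \<and> w \<in> T \<and> T \<subseteq> ?D" by blast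
  qed
  then have "?D = {} \<or> ?D = C"
    using cl C unfolding connected_clopen by blast
  then show ?thesis using a b by blast
qed

text \<open>The shape of the domain of a continuation along lines: a union of half lines in direction \<open>-e\<close>.\<close>

definition backward :: "'b::real_normed_vector \<Rightarrow> 'b set \<Rightarrow> bool" where
  "backward e S \<longleftrightarrow> (\<forall>w\<in>S. \<forall>s\<ge>0. w - s *\<^sub>R e \<in> S)"

lemma backwardD: "backward e S \<Longrightarrow> w \<in> S \<Longrightarrow> s \<ge> 0 \<Longrightarrow> w - s *\<^sub>R e \<in> S"
  by (simp add: backward_def)

lemma backward_unique:
  fixes f :: "'a \<Rightarrow> 'b::real_normed_vector"
  assumes H: "Hausdorff_space X" and L: "local_homeo X f"
    and S: "backward e S" "is_section X f S F" and T: "backward e T" "is_section X f T G"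
    and w: "w \<in> S" "w \<in> T" and s: "s \<ge> 0"
    and eq: "F (w - s *\<^sub>R e) = G (w - s *\<^sub>R e)"
    and t: "t \<ge> 0"
  shows "F (w - t *\<^sub>R e) = G (w - t *\<^sub>R e)"
proof -
  define C where "C = (\<lambda>s. w - s *\<^sub>R e) ` {0..}"
  have "connected C" unfolding C_def
    by (intro connected_continuous_image continuous_intros) auto
  moreover have "C \<subseteq> S" "C \<subseteq> T" using backwardD S T w by (auto simp: C_def)
  moreover have "w - s *\<^sub>R e \<in> C" "w - t *\<^sub>R e \<in> C" using s t by (auto simp: C_def)
  ultimately show ?thesis
    using section_unique[OF H L _ is_section_subset[OF S(2)] is_section_subset[OF T(2)]] eq by blast
qed

lemma is_section_Union:
  assumes "\<And>p. p \<in> P \<Longrightarrow> open (S p)" "\<And>p. p \<in> P \<Longrightarrow> is_section X f (S p) (G p)"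
    and F: "\<And>p w. p \<in> P \<Longrightarrow> w \<in> S p \<Longrightarrow> F w = G p w"
  shows "is_section X f (\<Union>p\<in>P. S p) F"
  unfolding is_section_def continuous_map_def
proof (intro conjI ballI allI impI)
  let ?E = "\<Union>p\<in>P. S p"
  show "f (F w) = w" if "w \<in> ?E" for w
    using that assms is_sectionD(2) by fastforce
  show "F \<in> topspace (top_of_set ?E) \<rightarrow> topspace X"
    using assms is_sectionD(1) by fastforce
  fix V assume V: "openin X V"
  have "{w\<in>?E. F w \<in> V} = (\<Union>p\<in>P. {w\<in>S p. G p w \<in> V})"
    using F by auto
  moreover have "open (\<Union>p\<in>P. {w\<in>S p. G p w \<in> V})"
    using assms is_section_open_vimage[OF _ _ V] by (intro open_UN ballI) blast
  ultimately have "open {w\<in>?E. F w \<in> V}" by simp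
  then show "openin (top_of_set ?E) {w \<in> topspace (top_of_set ?E). F w \<in> V}"
    using open_subset[of "{w\<in>?E. F w \<in> V}" ?E] by (simp add: subset_eq)
qed

text \<open>Any two continuations agree on their overlap, because every half line is connected and reaches
  the initial domain. So the union of all continuations is again one.\<close>

lemma maximal_backward_section:
  fixes f :: "'a \<Rightarrow> 'b::real_normed_vector"
  assumes H: "Hausdorff_space X" and L: "local_homeo X f"
    and S0: "open S0" "backward e S0" "is_section X f S0 F0"
    and reach: "\<And>w. \<exists>s\<ge>0. w - s *\<^sub>R e \<in> S0"
  obtains E F where "open E" "backward e E" "is_section X f E F" "S0 \<subseteq> E"
    "\<And>w. w \<in> S0 \<Longrightarrow> F w = F0 w"
    "\<And>S G w. open S \<Longrightarrow> backward e S \<Longrightarrow> is_section X f S G \<Longrightarrow> S0 \<subseteq> S \<Longrightarrow>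
       (\<And>w. w \<in> S0 \<Longrightarrow> G w = F0 w) \<Longrightarrow> S \<subseteq> E"
proof -
  define P where "P S G \<longleftrightarrow> open S \<and> backward e S \<and> is_section X f S G \<and> S0 \<subseteq> S \<and> (\<forall>w\<in>S0. G w = F0 w)" for S G
  define E where "E = \<Union>{S. \<exists>G. P S G}"
  define Fw where "Fw w = (SOME z. \<exists>S G. P S G \<and> w \<in> S \<and> z = G w)" for w
  have agree: "G w = G' w" if "P S G" "P S' G'" "w \<in> S" "w \<in> S'" for S G S' G' w
  proof -
    obtain s where s: "s \<ge> 0" "w - s *\<^sub>R e \<in> S0" using reach by blast
    have "G (w - s *\<^sub>R e) = G' (w - s *\<^sub>R e)" using that s by (simp add: P_def)
    then show ?thesis
      using backward_unique[OF H L, of e S G S' G' w s 0] that s by (simp add: P_def)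
  qed
  have Fw: "Fw w = G w" if "P S G" "w \<in> S" for S G w
  proof -
    have "\<exists>S G. P S G \<and> w \<in> S \<and> Fw w = G w"
      unfolding Fw_def by (rule someI[where x="G w"]) (use that in blast)
    then show ?thesis using agree that by metis
  qed
  have P0: "P S0 F0" using S0 by (simp add: P_def)
  show thesis
  proof
    show "open E" unfolding E_def by (auto simp: P_def)
    show "backward e E" unfolding E_def backward_def P_def by blast
    show "S0 \<subseteq> E" using P0 unfolding E_def by blast
    show "Fw w = F0 w" if "w \<in> S0" for w using Fw[OF P0 that] .
    show "S \<subseteq> E" if "open S" "backward e S" "is_section X f S G" "S0 \<subseteq> S" "\<And>w. w \<in> S0 \<Longrightarrow> G w = F0 w" for S G
      using that unfolding E_def P_def by blast
    have "is_section X f (\<Union>p\<in>{(S, G). P S G}. fst p) Fw"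
      by (rule is_section_Union[where G=snd]) (use Fw in \<open>auto simp: P_def\<close>)
    moreover have "(\<Union>p\<in>{(S, G). P S G}. fst p) = E" unfolding E_def by fastforce
    ultimately show "is_section X f E Fw" by simp
  qed
qed


lemma local_homeo_continuous: "local_homeo X f \<Longrightarrow> continuous_map X euclidean f"
  by (simp add: local_homeo_def)

lemma is_section_Un:
  assumes "open A" "is_section X f A F" "open B" "is_section X f B G"
    and "\<And>w. w \<in> A \<Longrightarrow> w \<in> B \<Longrightarrow> F w = G w"
  shows "is_section X f (A \<union> B) (\<lambda>w. if w \<in> A then F w else G w)"
proof -
  let ?S = "\<lambda>b. if b then A else B" and ?G = "\<lambda>b. if b then F else G"
  have "is_section X f (\<Union>b\<in>UNIV. ?S b) (\<lambda>w. if w \<in> A then F w else G w)"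
    by (rule is_section_Union[where G="?G"]) (use assms in \<open>auto split: if_splits\<close>)
  moreover have "(\<Union>b\<in>UNIV. ?S b) = A \<union> B" by (auto simp: UNIV_bool)
  ultimately show ?thesis by simp
qed

text \<open>Near each of its values a section coincides with a local inverse of \<open>f\<close>, whose image is open.\<close>

lemma section_open_image:
  fixes f :: "'a \<Rightarrow> 'b::metric_space"
  assumes L: "local_homeo X f" and E: "open E" and F: "is_section X f E F"
  shows "openin X (F ` E)"
proof (subst openin_subopen, intro ballI)
  fix z assume "z \<in> F ` E"
  then obtain w where w: "w \<in> E" "z = F w" by auto
  obtain V G r where V: "r > 0" "openin X V" "z \<in> V" "is_section X f (ball (f z) r) G"
    "\<And>v. v \<in> V \<Longrightarrow> G (f v) = v"
    using local_homeoE[OF L] is_sectionD(1)[OF F w(1)] w(2) by metis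
  let ?D = "{u\<in>E. F u \<in> V}"
  let ?T = "{v\<in>V. f v \<in> ?D}"
  have "open ?D" using is_section_open_vimage[OF F E V(2)] .
  then have "openin X {v\<in>topspace X. f v \<in> ?D}"
    by (intro openin_continuous_map_preimage[OF local_homeo_continuous[OF L]]) (simp add: open_openin[symmetric])
  then have "openin X (V \<inter> {v\<in>topspace X. f v \<in> ?D})" using V(2) by blast
  moreover have "V \<inter> {v\<in>topspace X. f v \<in> ?D} = ?T" using openin_subset[OF V(2)] by auto
  ultimately have "openin X ?T" by simp
  moreover have "z \<in> ?T" using V(3) w is_sectionD(2)[OF F w(1)] by simp
  moreover have "?T \<subseteq> F ` E"
  proof
    fix v assume v: "v \<in> ?T"
    then have "F (f v) \<in> V" "f v \<in> E" by auto
    then have "G (f (F (f v))) = F (f v)" using V(5) by blast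
    then have "F (f v) = v" using V(5) v is_sectionD(2)[OF F \<open>f v \<in> E\<close>] by auto
    then show "v \<in> F ` E" using \<open>f v \<in> E\<close> by (metis imageI)
  qed
  ultimately show "\<exists>T. openin X T \<and> z \<in> T \<and> T \<subseteq> F ` E" by blast
qed

text \<open>If \<open>F (w - s *\<^sub>R e)\<close> accumulated at \<open>z\<close> as \<open>s\<close> tends to 0, then \<open>f z = w\<close>, and the local inverse of
  \<open>f\<close> at \<open>z\<close> would agree with \<open>F\<close> near some point of the half line. Gluing the two along a tube
  around the end of the half line would extend the section past \<open>w\<close>.\<close>

lemma maximal_section_no_limit_point:
  fixes f :: "'a \<Rightarrow> 'b::real_normed_vector"
  assumes H: "Hausdorff_space X" and L: "local_homeo X f"
    and E: "open E" "backward e E" "is_section X f E F"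
    and max: "\<And>S G. open S \<Longrightarrow> backward e S \<Longrightarrow> is_section X f S G \<Longrightarrow> E \<subseteq> S \<Longrightarrow>
       (\<And>w. w \<in> E \<Longrightarrow> G w = F w) \<Longrightarrow> S \<subseteq> E"
    and w: "w \<notin> E" "\<And>s. s > 0 \<Longrightarrow> w - s *\<^sub>R e \<in> E"
    and z: "z \<in> topspace X"
  shows "\<exists>V. openin X V \<and> z \<in> V \<and> (\<forall>\<^sub>F s in at_right 0. F (w - s *\<^sub>R e) \<notin> V)"
proof (rule ccontr)
  assume "\<not> ?thesis"
  then have acc: "\<exists>s>0. s < \<epsilon> \<and> F (w - s *\<^sub>R e) \<in> V" if "openin X V" "z \<in> V" "\<epsilon> > 0" for V \<epsilon>
    using that unfolding eventually_at_right_field by blast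
  have fz: "f z = w"
  proof (rule ccontr)
    assume ne: "f z \<noteq> w"
    define d where "d = dist (f z) w / 2"
    have d: "d > 0" using ne by (simp add: d_def)
    have "openin X {v\<in>topspace X. f v \<in> ball (f z) d}"
      by (intro openin_continuous_map_preimage[OF local_homeo_continuous[OF L]]) (simp add: open_openin[symmetric])
    then obtain s where s: "s > 0" "s < d / (norm e + 1)" "f (F (w - s *\<^sub>R e)) \<in> ball (f z) d"
      using acc[of "{v\<in>topspace X. f v \<in> ball (f z) d}" "d / (norm e + 1)"] z d by (auto simp: add_nonneg_pos)
    have "f (F (w - s *\<^sub>R e)) = w - s *\<^sub>R e" using is_sectionD(2)[OF E(3) w(2)[OF s(1)]] .
    then have "dist (f z) (w - s *\<^sub>R e) < d" using s(3) by simp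
    moreover have "dist (w - s *\<^sub>R e) w = s * norm e" using s(1) by (simp add: dist_norm)
    moreover have "s * norm e \<le> s * (norm e + 1)" using s(1) by simp
    moreover have "s * (norm e + 1) < d" using s(2) by (simp add: pos_less_divide_eq add_nonneg_pos)
    ultimately have "dist (f z) w < 2 * d" using dist_triangle[of "f z" w "w - s *\<^sub>R e"] by linarith
    then show False by (simp add: d_def)
  qed
  obtain V G r where V: "r > 0" "openin X V" "z \<in> V" "is_section X f (ball w r) G"
    "\<And>v. v \<in> V \<Longrightarrow> G (f v) = v"
    using local_homeoE[OF L z] fz by metis
  obtain s where s: "s > 0" "s < r / (norm e + 1)" "F (w - s *\<^sub>R e) \<in> V"
    using acc[OF V(2,3), of "r / (norm e + 1)"] V(1) by (auto simp: add_nonneg_pos)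
  define a where "a = w - s *\<^sub>R e"
  have sr: "s * norm e < r"
  proof -
    have "s * (norm e + 1) < r" using s(2) by (simp add: pos_less_divide_eq add_nonneg_pos)
    then show ?thesis using s(1) by (simp add: algebra_simps)
  qed
  let ?D = "{u\<in>E. F u \<in> V}"
  have "open ?D" using is_section_open_vimage[OF E(3,1) V(2)] .
  moreover have "a \<in> ?D" using s w(2) by (simp add: a_def)
  ultimately obtain \<rho>0 where r0: "\<rho>0 > 0" "ball a \<rho>0 \<subseteq> ?D" using open_contains_ball by metis
  define \<rho> where "\<rho> = min \<rho>0 (r - s * norm e)"
  have r: "\<rho> > 0" "\<rho> \<le> r - s * norm e" "ball a \<rho> \<subseteq> ?D" using r0 sr by (auto simp: \<rho>_def)
  have FG: "F u = G u" if "u \<in> ?D" for u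
    using V(5)[of "F u"] is_sectionD(2)[OF E(3), of u] that by simp
  (* The tube around the end of the half line on which the section is continued by G. *)
  define Q where "Q = (\<Union>t\<in>{0..s}. ball (a + t *\<^sub>R e) \<rho>)"
  have Qball: "Q \<subseteq> ball w r"
  proof
    fix u assume "u \<in> Q"
    then obtain t where t: "0 \<le> t" "t \<le> s" "dist (a + t *\<^sub>R e) u < \<rho>" by (auto simp: Q_def)
    have "w - (a + t *\<^sub>R e) = (s - t) *\<^sub>R e" by (simp add: a_def algebra_simps)
    then have "dist w (a + t *\<^sub>R e) = (s - t) * norm e" using t by (simp add: dist_norm)
    also have "\<dots> \<le> s * norm e" using t by (simp add: mult_right_mono)
    finally show "u \<in> ball w r" using t(3) r(2) dist_triangle[of w u "a + t *\<^sub>R e"] by simp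
  qed
  have Qrep: "\<exists>t\<in>{0..s}. u - t *\<^sub>R e \<in> ball a \<rho>" if uQ: "u \<in> Q" for u
  proof -
    obtain t where t: "t \<in> {0..s}" "dist (a + t *\<^sub>R e) u < \<rho>" using uQ unfolding Q_def by auto
    have "a - (u - t *\<^sub>R e) = a + t *\<^sub>R e - u" by (simp add: algebra_simps)
    then have "dist a (u - t *\<^sub>R e) = dist (a + t *\<^sub>R e) u" by (simp only: dist_norm)
    then have "u - t *\<^sub>R e \<in> ball a \<rho>" using t(2) by simp
    then show ?thesis using t(1) by blast
  qed
  have QI: "u \<in> Q" if "t \<in> {0..s}" "u - t *\<^sub>R e \<in> ball a \<rho>" for u t
  proof -
    have "a - (u - t *\<^sub>R e) = a + t *\<^sub>R e - u" by (simp add: algebra_simps)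
    then have "dist a (u - t *\<^sub>R e) = dist (a + t *\<^sub>R e) u" by (simp only: dist_norm)
    then have "u \<in> ball (a + t *\<^sub>R e) \<rho>" using that(2) by simp
    then show ?thesis unfolding Q_def using that(1) by blast
  qed
  have QE: "F u = G u" if u: "u \<in> E" "u \<in> Q" for u
  proof -
    obtain t where t: "0 \<le> t" "t \<le> s" "u - t *\<^sub>R e \<in> ball a \<rho>" using Qrep[OF u(2)] by auto
    define C where "C = (\<lambda>x. u - x *\<^sub>R e) ` {0..t}"
    have "connected C" unfolding C_def
      by (intro connected_continuous_image continuous_intros) auto
    moreover have CE: "C \<subseteq> E" using backwardD[OF E(2) u(1)] by (auto simp: C_def)
    moreover have "C \<subseteq> ball w r"
    proof -
      have "C \<subseteq> Q"
      proof
        fix y assume "y \<in> C"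
        then obtain x where x: "0 \<le> x" "x \<le> t" "y = u - x *\<^sub>R e" by (auto simp: C_def)
        have "y - (t - x) *\<^sub>R e = u - t *\<^sub>R e" by (simp add: x scaleR_diff_left)
        then have "y - (t - x) *\<^sub>R e \<in> ball a \<rho>" using t(3) by (simp only:)
        then show "y \<in> Q" using QI[of "t - x" y] x t(1,2) by simp
      qed
      then show ?thesis using Qball by blast
    qed
    moreover have "u \<in> C" "u - t *\<^sub>R e \<in> C" using t by (auto simp: C_def intro: image_eqI[of _ _ 0])
    moreover have "F (u - t *\<^sub>R e) = G (u - t *\<^sub>R e)" using FG t(3) r(3) by blast
    ultimately show ?thesis
      using section_unique[OF H L _ is_section_subset[OF E(3)] is_section_subset[OF V(4)]] by blast
  qed
  have "E \<union> Q \<subseteq> E"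
  proof (rule max)
    show "open (E \<union> Q)" using E(1) by (auto simp: Q_def)
    show "backward e (E \<union> Q)"
      unfolding backward_def
    proof (intro ballI allI impI)
      fix u and x :: real assume u: "u \<in> E \<union> Q" and x: "0 \<le> x"
      show "u - x *\<^sub>R e \<in> E \<union> Q"
      proof (cases "u \<in> E")
        case True then show ?thesis using backwardD[OF E(2)] x by blast
      next
        case False
        then obtain t where t: "0 \<le> t" "t \<le> s" "u - t *\<^sub>R e \<in> ball a \<rho>" using Qrep u by force
        show ?thesis
        proof (cases "x \<le> t")
          case True
          have "(u - x *\<^sub>R e) - (t - x) *\<^sub>R e = u - t *\<^sub>R e" by (simp add: scaleR_diff_left)
          then have "(u - x *\<^sub>R e) - (t - x) *\<^sub>R e \<in> ball a \<rho>" using t(3) by (simp only:)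
          then have "u - x *\<^sub>R e \<in> Q" using QI[of "t - x" "u - x *\<^sub>R e"] x t(1,2) True by simp
          then show ?thesis by blast
        next
          case False
          have "u - t *\<^sub>R e \<in> E" using t(3) r(3) by blast
          then have "(u - t *\<^sub>R e) - (x - t) *\<^sub>R e \<in> E" using backwardD[OF E(2)] False by simp
          then show ?thesis by (simp add: scaleR_diff_left)
        qed
      qed
    qed
    show "is_section X f (E \<union> Q) (\<lambda>u. if u \<in> E then F u else G u)"
      by (intro is_section_Un E is_section_subset[OF V(4) Qball] QE) (auto simp: Q_def)
  qed auto
  moreover have "w \<in> Q" using QI[of s w] s(1) r(1) by (simp add: a_def)
  ultimately show False using w(1) by blast
qed

text \<open>Points outside \<open>U\<close> are no limit points either, since \<open>f\<close> tends to infinity there. So each point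
  of the compact set has a neighbourhood that is avoided eventually, and finitely many of these
  cover it.\<close>

lemma maximal_section_leaves_compact:
  fixes f :: "'a \<Rightarrow> 'b::real_normed_vector"
  assumes H: "Hausdorff_space Y" and U: "openin Y U" and L: "local_homeo (subtopology Y U) f"
    and infty: "\<And>z R. z \<in> topspace Y - U \<Longrightarrow> \<exists>V. openin Y V \<and> z \<in> V \<and> (\<forall>v\<in>V \<inter> U. R < norm (f v))"
    and E: "open E" "backward e E" "is_section (subtopology Y U) f E F"
    and max: "\<And>S G. open S \<Longrightarrow> backward e S \<Longrightarrow> is_section (subtopology Y U) f S G \<Longrightarrow> E \<subseteq> S \<Longrightarrow>
       (\<And>w. w \<in> E \<Longrightarrow> G w = F w) \<Longrightarrow> S \<subseteq> E"
    and w: "w \<notin> E" "\<And>s. s > 0 \<Longrightarrow> w - s *\<^sub>R e \<in> E"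
    and K: "compactin Y K"
  shows "\<forall>\<^sub>F s in at_right 0. F (w - s *\<^sub>R e) \<notin> K"
proof -
  let ?U = "{V. openin Y V \<and> (\<forall>\<^sub>F s in at_right 0. F (w - s *\<^sub>R e) \<notin> V)}"
  have topU: "topspace (subtopology Y U) = U" using openin_subset[OF U] by auto
  have "\<exists>V\<in>?U. z \<in> V" if z: "z \<in> topspace Y" for z
  proof (cases "z \<in> U")
    case True
    have zX: "z \<in> topspace (subtopology Y U)" using True topU by simp
    have "\<exists>V. openin (subtopology Y U) V \<and> z \<in> V \<and> (\<forall>\<^sub>F s in at_right 0. F (w - s *\<^sub>R e) \<notin> V)"
    proof (rule maximal_section_no_limit_point[OF Hausdorff_space_subtopology[OF H] L E _ w zX])
      fix S G assume "open S" "backward e S" "is_section (subtopology Y U) f S G" "E \<subseteq> S"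
        "\<And>w. w \<in> E \<Longrightarrow> G w = F w"
      then show "S \<subseteq> E" by (rule max)
    qed
    then show ?thesis using openin_trans_full[OF _ U] by blast
  next
    case False
    obtain V where V: "openin Y V" "z \<in> V" "\<And>v. v \<in> V \<inter> U \<Longrightarrow> norm w + norm e < norm (f v)"
      using infty[of z "norm w + norm e"] z False by blast
    have "F (w - s *\<^sub>R e) \<notin> V" if s: "0 < s" "s < 1" for s
    proof
      assume "F (w - s *\<^sub>R e) \<in> V"
      then have "norm w + norm e < norm (w - s *\<^sub>R e)"
        using V(3)[of "F (w - s *\<^sub>R e)"] is_sectionD[OF E(3) w(2)[OF s(1)]] topU by simp
      moreover have "norm (w - s *\<^sub>R e) \<le> norm w + s * norm e"
        using norm_triangle_ineq4[of w "s *\<^sub>R e"] s by simp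
      moreover have "s * norm e \<le> norm e" using s by (simp add: mult_left_le_one_le)
      ultimately show False by linarith
    qed
    then have "\<forall>\<^sub>F s in at_right 0. F (w - s *\<^sub>R e) \<notin> V"
      unfolding eventually_at_right_field by (intro exI[of _ 1]) auto
    then show ?thesis using V by blast
  qed
  then have "K \<subseteq> \<Union> ?U" using compactin_subset_topspace[OF K] by blast
  then obtain \<F> where F: "finite \<F>" "\<F> \<subseteq> ?U" "K \<subseteq> \<Union> \<F>"
    using compactinD[OF K, of ?U] by blast
  have "\<forall>\<^sub>F s in at_right 0. \<forall>V\<in>\<F>. F (w - s *\<^sub>R e) \<notin> V"
    using F by (intro eventually_ball_finite) auto
  then show ?thesis by eventually_elim (use F(3) in blast)
qed

text \<open>The closure of the image is shown to be open. At a point of \<open>U\<close> in the closure, some local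
  inverse \<open>G\<close> of \<open>f\<close> agrees with \<open>F\<close> at some point \<open>wa\<close>. For any \<open>b\<close> in the ball where \<open>G\<close> lives,
  a rectangle in the domain of \<open>F\<close> whose last edge runs almost from \<open>wa\<close> to \<open>b\<close> carries the
  agreement to a point near \<open>b\<close>. A point outside \<open>U\<close> has a connected punctured neighbourhood
  inside \<open>U\<close>, to which the first case spreads.\<close>

lemma section_image_dense:
  fixes f :: "'a \<Rightarrow> 'b::real_inner"
  assumes H: "Hausdorff_space Y" and conn: "connected_space Y"
    and U: "openin Y U" and L: "local_homeo (subtopology Y U) f"
    and punctured: "\<And>z. z \<in> topspace Y - U \<Longrightarrow>
        \<exists>V. openin Y V \<and> z \<in> V \<and> V - {z} \<subseteq> U \<and> connectedin Y (V - {z})"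
    and e: "e \<noteq> 0" and half: "{w. w \<bullet> e < - R} \<subseteq> E"
    and E: "open E" "is_section (subtopology Y U) f E F"
    and rect: "\<And>v0 d L \<delta>. \<delta> > 0 \<Longrightarrow>
        (\<And>s t. s \<in> {0..1} \<Longrightarrow> t \<in> {0..1} \<Longrightarrow> (v0 + t *\<^sub>R e + s *\<^sub>R d) \<bullet> e < - R) \<Longrightarrow>
        \<exists>v\<in>ball v0 \<delta>. \<forall>t\<in>{0..L}. \<forall>s\<in>{0..1}. v + t *\<^sub>R e + s *\<^sub>R d \<in> E"
  shows "Y closure_of (F ` E) = topspace Y"
proof -
  let ?X = "subtopology Y U"
  define A where "A = F ` E"
  have topU: "topspace ?X = U" using openin_subset[OF U] by auto
  have AU: "A \<subseteq> U" using is_sectionD(1)[OF E(2)] topU by (auto simp: A_def)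
  have HX: "Hausdorff_space ?X" using H Hausdorff_space_subtopology by blast
  have fcont: "continuous_map ?X euclidean f" using local_homeo_continuous[OF L] .
  have step1: "\<exists>V. openin Y V \<and> z \<in> V \<and> V \<subseteq> Y closure_of A" if z: "z \<in> U" "z \<in> Y closure_of A" for z
  proof -
    obtain V G r where V: "r > 0" "openin ?X V" "z \<in> V" "is_section ?X f (ball (f z) r) G"
      "G ` ball (f z) r = V" "\<And>v. v \<in> V \<Longrightarrow> G (f v) = v"
      using local_homeoE[OF L] z(1) topU by metis
    have VY: "openin Y V" using openin_trans_full[OF V(2) U] .
    obtain a where a: "a \<in> A" "a \<in> V" using z(2) V(3) VY unfolding in_closure_of by blast
    then obtain wa where wa: "wa \<in> E" "a = F wa" by (auto simp: A_def)
    have fa: "f a = wa" using is_sectionD(2)[OF E(2)] wa by simp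
    have waB: "wa \<in> ball (f z) r"
    proof -
      obtain y where y: "y \<in> ball (f z) r" "a = G y" using a(2) V(5) by auto
      then show ?thesis using is_sectionD(2)[OF V(4) y(1)] fa by simp
    qed
    let ?D = "{u\<in>E. F u \<in> V}"
    have "open ?D" using is_section_open_vimage[OF E(2,1) V(2)] .
    then obtain \<rho>0 where r0: "\<rho>0 > 0" "ball wa \<rho>0 \<subseteq> ?D"
      using wa a open_contains_ball by (metis (mono_tags, lifting) mem_Collect_eq)
    have "G b \<in> Y closure_of A" if b: "b \<in> ball (f z) r" for b
      unfolding in_closure_of
    proof (intro conjI allI impI)
      show GbY: "G b \<in> topspace Y" using is_sectionD(1)[OF V(4) b] by auto
      fix T assume T: "G b \<in> T \<and> openin Y T"
      have "openin ?X (T \<inter> U)" using T openin_subtopology by blast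
      then have "open {u \<in> ball (f z) r. G u \<in> T \<inter> U}"
        using is_section_open_vimage[OF V(4)] by blast
      moreover have "b \<in> {u \<in> ball (f z) r. G u \<in> T \<inter> U}"
        using T b is_sectionD(1)[OF V(4) b] topU by simp
      ultimately obtain \<eta> where eta: "\<eta> > 0" "ball b \<eta> \<subseteq> {u \<in> ball (f z) r. G u \<in> T \<inter> U}"
        using open_contains_ball by metis
      obtain \<rho>1 where r1: "\<rho>1 > 0" "ball wa \<rho>1 \<subseteq> ball (f z) r"
        using waB open_contains_ball[of "ball (f z) r"] open_ball by blast
      define \<delta> where "\<delta> = min (min \<rho>0 \<rho>1) \<eta>"
      have \<delta>: "\<delta> > 0" "\<delta> \<le> \<rho>0" "\<delta> \<le> \<rho>1" "\<delta> \<le> \<eta>" using r0 r1 eta by (auto simp: \<delta>_def)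
      define d where "d = b - wa"
      (* L is so large that the translate by -L e of the segment from wa to b lies in the half space, even
         one unit further on in direction e. *)
      define L where "L = (\<bar>wa \<bullet> e\<bar> + \<bar>d \<bullet> e\<bar> + \<bar>R\<bar> + 1) / (e \<bullet> e) + 1"
      have ee: "e \<bullet> e > 0" using e by simp
      have L1: "L \<ge> 0" unfolding L_def using ee by (intro add_nonneg_nonneg divide_nonneg_pos) auto
      define v0 where "v0 = wa - L *\<^sub>R e"
      have "(v0 + t *\<^sub>R e + s *\<^sub>R d) \<bullet> e < - R" if st: "s \<in> {0..1}" "t \<in> {0..1}" for s t
      proof -
        have "(v0 + t *\<^sub>R e + s *\<^sub>R d) \<bullet> e = wa \<bullet> e - (L - t) * (e \<bullet> e) + s * (d \<bullet> e)"
          by (simp add: v0_def inner_add_left inner_diff_left algebra_simps)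
        moreover have "(L - t) * (e \<bullet> e) \<ge> (L - 1) * (e \<bullet> e)"
          using st ee by (intro mult_right_mono) auto
        moreover have "(L - 1) * (e \<bullet> e) = \<bar>wa \<bullet> e\<bar> + \<bar>d \<bullet> e\<bar> + \<bar>R\<bar> + 1"
          using ee by (simp add: L_def)
        moreover have "s * (d \<bullet> e) \<le> \<bar>d \<bullet> e\<bar>"
        proof -
          have "s * (d \<bullet> e) \<le> s * \<bar>d \<bullet> e\<bar>" using st by (intro mult_left_mono) auto
          also have "\<dots> \<le> \<bar>d \<bullet> e\<bar>" using st by (intro mult_left_le_one_le) auto
          finally show ?thesis .
        qed
        ultimately show ?thesis by linarith
      qed
      from rect[OF \<delta>(1) this, of L] obtain v where v: "v \<in> ball v0 \<delta>"
        "\<And>t s. t \<in> {0..L} \<Longrightarrow> s \<in> {0..1} \<Longrightarrow> v + t *\<^sub>R e + s *\<^sub>R d \<in> E" by blast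
      define p where "p = v + L *\<^sub>R e"
      have "wa - p = v0 - v" by (simp add: p_def v0_def algebra_simps)
      then have pw: "dist wa p < \<delta>" using v(1) by (simp add: dist_norm)
      have "b - (p + d) = wa - p" by (simp add: d_def)
      then have "dist b (p + d) = dist wa p" by (simp only: dist_norm)
      then have pb: "dist b (p + d) < \<delta>" using pw by simp
      have pD: "p \<in> ?D" using pw \<delta> r0(2) by (meson less_le_trans mem_ball subsetD)
      define C where "C = closed_segment p (p + d)"
      have CE: "C \<subseteq> E"
      proof
        fix u assume "u \<in> C"
        then obtain s where s: "0 \<le> s" "s \<le> 1" "u = (1 - s) *\<^sub>R p + s *\<^sub>R (p + d)"
          by (auto simp: C_def in_segment)
        then have "u = v + L *\<^sub>R e + s *\<^sub>R d" by (simp add: p_def algebra_simps)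
        then show "u \<in> E" using v(2)[of L s] s L1 by simp
      qed
      have pdB: "p + d \<in> ball b \<eta>" using pb \<delta> by simp
      have "p \<in> ball (f z) r" using pw \<delta> r1(2) by (meson less_le_trans mem_ball subsetD)
      moreover have "p + d \<in> ball (f z) r" using pdB eta(2) by blast
      ultimately have CB: "C \<subseteq> ball (f z) r" unfolding C_def
        by (intro closed_segment_subset) auto
      have "F p = G p" using V(6)[of "F p"] is_sectionD(2)[OF E(2), of p] pD by simp
      then have "F (p + d) = G (p + d)"
        using section_unique[OF HX L _ is_section_subset[OF E(2) CE] is_section_subset[OF V(4) CB], of p "p + d"]
        by (simp add: C_def)
      moreover have "p + d \<in> E" using CE by (auto simp: C_def)
      moreover have "G (p + d) \<in> T" using pdB eta(2) by blast
      ultimately show "\<exists>y. y \<in> A \<and> y \<in> T" unfolding A_def by (metis imageI)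
    qed
    then have "V \<subseteq> Y closure_of A" using V(5) by blast
    then show ?thesis using VY V(3) by blast
  qed
  have step2: "\<exists>V. openin Y V \<and> z \<in> V \<and> V \<subseteq> Y closure_of A" if z: "z \<in> topspace Y - U" "z \<in> Y closure_of A" for z
  proof -
    obtain V where V: "openin Y V" "z \<in> V" "V - {z} \<subseteq> U" "connectedin Y (V - {z})"
      using punctured[OF z(1)] by blast
    obtain a where a: "a \<in> A" "a \<in> V" using z(2) V unfolding in_closure_of by blast
    have az: "a \<in> V - {z}" using a AU z(1) by auto
    let ?S = "subtopology Y (V - {z})"
    have tS: "topspace ?S = V - {z}" using openin_subset[OF V(1)] by auto
    have cl: "closedin ?S ((V - {z}) \<inter> Y closure_of A)"
      by (metis closedin_closure_of closedin_subtopology_Int_closed)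
    have op: "openin ?S ((V - {z}) \<inter> Y closure_of A)"
    proof (subst openin_subopen, intro ballI)
      fix y assume y: "y \<in> (V - {z}) \<inter> Y closure_of A"
      then obtain W where W: "openin Y W" "y \<in> W" "W \<subseteq> Y closure_of A" using step1 V(3) by blast
      have "openin ?S (W \<inter> (V - {z}))" using W(1) openin_subtopology by blast
      then show "\<exists>T. openin ?S T \<and> y \<in> T \<and> T \<subseteq> (V - {z}) \<inter> Y closure_of A" using W y by blast
    qed
    have "connected_space ?S" using V(4) by (simp add: connectedin_def)
    then have "(V - {z}) \<inter> Y closure_of A = {} \<or> (V - {z}) \<inter> Y closure_of A = topspace ?S"
      using cl op unfolding connected_space_clopen_in by blast
    moreover have "a \<in> Y closure_of A"
      using a(1) AU openin_subset[OF U] closure_of_subset[of A Y] by blast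
    ultimately have "V - {z} \<subseteq> Y closure_of A" using az tS by blast
    then show ?thesis using V z(2) by blast
  qed
  have "openin Y (Y closure_of A)"
  proof (subst openin_subopen, intro ballI)
    fix z assume z: "z \<in> Y closure_of A"
    then have "z \<in> topspace Y" by (simp add: in_closure_of)
    then show "\<exists>T. openin Y T \<and> z \<in> T \<and> T \<subseteq> Y closure_of A" using step1 step2 z by blast
  qed
  moreover have "closedin Y (Y closure_of A)" by simp
  ultimately have "Y closure_of A = {} \<or> Y closure_of A = topspace Y"
    using conn unfolding connected_space_clopen_in by blast
  moreover have "Y closure_of A \<noteq> {}"
  proof -
    have "((- (\<bar>R\<bar> + 1) / (e \<bullet> e)) *\<^sub>R e) \<bullet> e < - R" using e by simp
    then have "E \<noteq> {}" using half by blast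
    then have "A \<noteq> {}" by (simp add: A_def)
    moreover have "A \<subseteq> Y closure_of A" using AU openin_subset[OF U] closure_of_subset[of A Y] by blast
    ultimately show ?thesis by blast
  qed
  ultimately show ?thesis unfolding A_def by blast
qed


section \<open>Two sections over a half space\<close>

text \<open>Suppose that every rectangle based near \<open>v0\<close> leaves \<open>E\<close>. Cut off at the first time of leaving,
  each of them carries a function \<open>\<phi> \<circ> F\<close> that is at least 1 on the first edge and vanishes just
  before the point of leaving, because \<open>F\<close> has left the compact support there. So each of them
  has energy bounded below, and integration over the base point bounds the energy of \<open>\<phi> \<circ> F\<close> on
  \<open>E\<close> from below, independently of \<open>\<phi>\<close>.\<close>

lemma exists_rectangle_in_section_domain:
  fixes F :: "'b::euclidean_space \<Rightarrow> 'a" and v0 d e :: 'b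
  assumes p: "p \<ge> 3" and e: "e \<noteq> 0" and E: "open E" "backward e E"
    and half: "{w. w \<bullet> e < - R} \<subseteq> E"
    and leave: "\<And>w K. w \<notin> E \<Longrightarrow> (\<And>s. s > 0 \<Longrightarrow> w - s *\<^sub>R e \<in> E) \<Longrightarrow> compactin Y K \<Longrightarrow>
       \<forall>\<^sub>F s in at_right 0. F (w - s *\<^sub>R e) \<notin> K"
    and test: "\<And>\<epsilon>. \<epsilon> > 0 \<Longrightarrow> \<exists>\<phi> K Du. compactin Y K \<and> (\<forall>w\<in>E. F w \<notin> K \<longrightarrow> \<phi> (F w) = 0) \<and>
       (\<forall>w. w \<bullet> e < - R \<longrightarrow> 1 \<le> \<phi> (F w)) \<and>
       (\<forall>w\<in>E. ((\<lambda>w. \<phi> (F w)) has_derivative (\<lambda>h. Du w \<bullet> h)) (at w)) \<and>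
       (\<integral>\<^sup>+ w. indicator E w * ennreal (norm (Du w) ^ p) \<partial>lborel) < ennreal \<epsilon>"
    and \<delta>: "\<delta> > 0"
    and edge: "\<And>s t. s \<in> {0..1} \<Longrightarrow> t \<in> {0..1} \<Longrightarrow> (v0 + t *\<^sub>R e + s *\<^sub>R d) \<bullet> e < - R"
  shows "\<exists>v\<in>ball v0 \<delta>. \<forall>t\<in>{0..L0}. \<forall>s\<in>{0..1}. v + t *\<^sub>R e + s *\<^sub>R d \<in> E"
proof (rule ccontr)
  assume neg: "\<not> ?thesis"
  define L where "L = max L0 1"
  have L: "L \<ge> L0" "L \<ge> 1" by (auto simp: L_def)
  define m where "m = max ((v0 + e) \<bullet> e) ((v0 + e + d) \<bullet> e)"
  have m: "m < - R" using edge[of 0 1] edge[of 1 1] by (simp add: m_def)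
  (* Rectangles based in the ball of radius \<rho> still start in the half space. *)
  define \<rho> where "\<rho> = min \<delta> ((- R - m) / norm e)"
  have \<rho>: "\<rho> > 0" "\<rho> \<le> \<delta>" using \<delta> m e by (auto simp: \<rho>_def)
  have edge': "(v + t *\<^sub>R e + s *\<^sub>R d) \<bullet> e < - R" if v: "v \<in> ball v0 \<rho>" and st: "s \<in> {0..1}" "t \<in> {0..1}" for v s t
  proof -
    have "(v - v0) \<bullet> e \<le> norm (v - v0) * norm e" by (rule norm_cauchy_schwarz)
    also have "\<dots> < \<rho> * norm e" using v e by (intro mult_strict_right_mono) (auto simp: dist_norm norm_minus_commute)
    also have "\<dots> \<le> (- R - m) / norm e * norm e" by (intro mult_right_mono) (auto simp: \<rho>_def)
    finally have 1: "(v - v0) \<bullet> e < - R - m" using e by simp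
    have "(v0 + t *\<^sub>R e + s *\<^sub>R d) \<bullet> e = v0 \<bullet> e + t * (e \<bullet> e) + s * (d \<bullet> e)"
      by (simp add: inner_add_left)
    also have "\<dots> \<le> v0 \<bullet> e + e \<bullet> e + max 0 (d \<bullet> e)"
    proof -
      have "t * (e \<bullet> e) \<le> e \<bullet> e" using st by (intro mult_left_le_one_le) auto
      moreover have "s * (d \<bullet> e) \<le> max 0 (d \<bullet> e)"
      proof -
        have "s * (d \<bullet> e) \<le> s * max 0 (d \<bullet> e)" using st by (intro mult_left_mono) auto
        also have "\<dots> \<le> max 0 (d \<bullet> e)" using st by (intro mult_left_le_one_le) auto
        finally show ?thesis .
      qed
      ultimately show ?thesis by linarith
    qed
    also have "\<dots> = m" by (simp add: m_def inner_add_left max_def)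
    finally have 2: "(v0 + t *\<^sub>R e + s *\<^sub>R d) \<bullet> e \<le> m" .
    have "(v + t *\<^sub>R e + s *\<^sub>R d) \<bullet> e = (v - v0) \<bullet> e + (v0 + t *\<^sub>R e + s *\<^sub>R d) \<bullet> e"
      by (simp add: inner_add_left inner_diff_left)
    then show ?thesis using 1 2 by linarith
  qed
  define C where "C = (L * norm e + norm d + 1) * (4 * (L * norm e + norm d + 1)) ^ (p - 1)"
  have C: "C > 0" unfolding C_def using L by (intro mult_pos_pos zero_less_power) (auto simp: add_nonneg_pos)
  define b where "b = measure lborel (ball v0 \<rho>)"
  have b: "b > 0" "emeasure lborel (ball v0 \<rho>) = ennreal b"
    using content_ball_pos[OF \<rho>(1), of v0] emeasure_eq_ennreal_measure[of lborel "ball v0 \<rho>"] emeasure_lborel_ball_finite[of v0 \<rho>]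
    by (auto simp: b_def less_top)
  (* This energy is so small that it contradicts the lower bound integrated over the ball, which has
     measure b. *)
  have "b / (4 * C * L) > 0" using b C L by simp
  from test[OF this] obtain \<phi> K Du where K: "compactin Y K" and out: "\<And>w. w \<in> E \<Longrightarrow> F w \<notin> K \<Longrightarrow> \<phi> (F w) = 0"
    and one: "\<And>w. w \<bullet> e < - R \<Longrightarrow> 1 \<le> \<phi> (F w)"
    and der: "\<And>w. w \<in> E \<Longrightarrow> ((\<lambda>w. \<phi> (F w)) has_derivative (\<lambda>h. Du w \<bullet> h)) (at w)"
    and small: "(\<integral>\<^sup>+ w. indicator E w * ennreal (norm (Du w) ^ p) \<partial>lborel) < ennreal (b / (4 * C * L))"
    by blast
  define H where "H w = indicator E w * ennreal (norm (Du w) ^ p)" for w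
  have Hm[measurable]: "H \<in> borel_measurable borel"
  proof -
    have [measurable]: "(\<lambda>w. indicator E w *\<^sub>R Du w) \<in> borel_measurable borel"
      by (rule borel_measurable_gradient[OF E(1) der])
    have "H = (\<lambda>w. ennreal (norm (indicator E w *\<^sub>R Du w) ^ p))"
      using p by (auto simp: H_def fun_eq_iff indicator_def power_0_left)
    moreover have "(\<lambda>w. ennreal (norm (indicator E w *\<^sub>R Du w) ^ p)) \<in> borel_measurable borel"
      by measurable
    ultimately show ?thesis by (simp only:)
  qed
  define I where "I v = (\<integral>\<^sup>+ \<tau>. indicator {0..L} \<tau> * (\<integral>\<^sup>+ s. indicator {0..1} s *
        H (v + \<tau> *\<^sub>R e + s *\<^sub>R d) \<partial>lborel) \<partial>lborel)" for v
  have [measurable]: "I \<in> borel_measurable borel" unfolding I_def by measurable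
  have low: "ennreal (1/2) \<le> ennreal C * I v" if v: "v \<in> ball v0 \<rho>" for v
  proof -
    define Z where "Z = {x \<in> {0..L} \<times> {0..1}. v + fst x *\<^sub>R e + snd x *\<^sub>R d \<notin> E}"
    have "Z \<noteq> {}"
    proof -
      have "v \<in> ball v0 \<delta>" using v \<rho> by auto
      then obtain t s where "t \<in> {0..L0}" "s \<in> {0..1}" "v + t *\<^sub>R e + s *\<^sub>R d \<notin> E" using neg by blast
      then have "(t, s) \<in> Z" using L by (auto simp: Z_def)
      then show ?thesis by blast
    qed
    moreover have "compact Z"
    proof -
      have "closed ((\<lambda>x. v + fst x *\<^sub>R e + snd x *\<^sub>R d) -` (- E))"
        using E(1) by (intro closed_vimage continuous_intros) auto
      moreover have "Z = ({0..L} \<times> {0..1}) \<inter> ((\<lambda>x. v + fst x *\<^sub>R e + snd x *\<^sub>R d) -` (- E))"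
        by (auto simp: Z_def)
      ultimately show ?thesis by (simp add: compact_Int_closed compact_Times)
    qed
    ultimately have "\<exists>x\<in>Z. \<forall>y\<in>Z. fst x \<le> fst y"
      by (intro continuous_attains_inf) (auto intro: continuous_intros)
    then obtain x where x: "x \<in> Z" "\<And>y. y \<in> Z \<Longrightarrow> fst x \<le> fst y" by blast
    (* The minimality of t1 makes the part of the rectangle before t1 lie in E completely. *)
    define t1 s0 where "t1 = fst x" and "s0 = snd x"
    have ts: "0 \<le> t1" "t1 \<le> L" "s0 \<in> {0..1}" "v + t1 *\<^sub>R e + s0 *\<^sub>R d \<notin> E"
      using x(1) by (auto simp: Z_def t1_def s0_def)
    have before: "v + t *\<^sub>R e + s *\<^sub>R d \<in> E" if "0 \<le> t" "t < t1" "s \<in> {0..1}" for t s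
    proof (rule ccontr)
      assume "v + t *\<^sub>R e + s *\<^sub>R d \<notin> E"
      then have "(t, s) \<in> Z" using that ts by (auto simp: Z_def)
      then show False using x(2) that by (fastforce simp: t1_def)
    qed
    have "t1 > 1"
    proof (rule ccontr)
      assume "\<not> t1 > 1"
      then have "(v + t1 *\<^sub>R e + s0 *\<^sub>R d) \<bullet> e < - R" using edge'[OF v ts(3)] ts(1) by simp
      then show False using half ts(4) by blast
    qed
    define w where "w = v + t1 *\<^sub>R e + s0 *\<^sub>R d"
    have wb: "w - s *\<^sub>R e \<in> E" if s: "s > 0" for s
    proof (cases "s \<le> t1")
      case True
      have "w - s *\<^sub>R e = v + (t1 - s) *\<^sub>R e + s0 *\<^sub>R d" by (simp add: w_def algebra_simps)
      then show ?thesis using before[of "t1 - s" s0] True s ts(3) by simp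
    next
      case False
      have "w - s *\<^sub>R e = (v + 0 *\<^sub>R e + s0 *\<^sub>R d) - (s - t1) *\<^sub>R e" by (simp add: w_def algebra_simps)
      then show ?thesis using backwardD[OF E(2) before[of 0 s0], of "s - t1"] False ts(3) \<open>t1 > 1\<close> by simp
    qed
    have "\<forall>\<^sub>F s in at_right 0. F (w - s *\<^sub>R e) \<notin> K"
      using leave[OF _ wb K] ts(4) by (simp add: w_def)
    then obtain c where c: "c > 0" "\<And>s. 0 < s \<Longrightarrow> s < c \<Longrightarrow> F (w - s *\<^sub>R e) \<notin> K"
      unfolding eventually_at_right_field by blast
    (* Stop shortly before t1, where F has left the support, but not before 1. *)
    define s where "s = min (c / 2) (t1 - 1)"
    have s: "0 < s" "s < c" "s \<le> t1 - 1" using c(1) \<open>t1 > 1\<close> by (auto simp: s_def)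
    define t where "t = t1 - s"
    have t: "1 \<le> t" "t \<le> L" "t < t1" using s ts by (auto simp: t_def)
    have wt: "w - s *\<^sub>R e = v + t *\<^sub>R e + s0 *\<^sub>R d" by (simp add: w_def t_def algebra_simps)
    have "\<phi> (F (v + t *\<^sub>R e + s0 *\<^sub>R d)) = 0"
      using out[OF wb[OF s(1)] c(2)[OF s(1,2)]] unfolding wt .
    then show ?thesis unfolding I_def H_def
      by (intro rectangle_energy_lower_bound[OF p E(1) der t(1,2) ts(3)])
         (use before t one edge'[OF v, of _ 0] in \<open>auto simp: C_def\<close>)
  qed
  have "ennreal (1/2 * b) = ennreal (1/2) * ennreal b" using b by (intro ennreal_mult) auto
  also have "\<dots> = ennreal (1/2) * emeasure lborel (ball v0 \<rho>)" by (simp only: b(2))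
  also have "\<dots> = (\<integral>\<^sup>+ v. ennreal (1/2) * indicator (ball v0 \<rho>) v \<partial>lborel)"
    by (rule nn_integral_cmult_indicator[symmetric]) simp
  also have "\<dots> \<le> (\<integral>\<^sup>+ v. ennreal C * I v \<partial>lborel)"
    by (intro nn_integral_mono) (use low in \<open>auto simp: indicator_def\<close>)
  also have "\<dots> = ennreal C * (\<integral>\<^sup>+ v. I v \<partial>lborel)" by (rule nn_integral_cmult) measurable
  also have "(\<integral>\<^sup>+ v. I v \<partial>lborel) = ennreal L * (\<integral>\<^sup>+ v. H v \<partial>lborel)"
    unfolding I_def by (rule nn_integral_rectangles) (use L in auto)
  also have "ennreal C * (ennreal L * (\<integral>\<^sup>+ v. H v \<partial>lborel)) \<le> ennreal C * (ennreal L * ennreal (b / (4 * C * L)))"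
    using small by (intro mult_left_mono) (auto simp: H_def)
  also have "\<dots> = ennreal (b / 4)"
  proof -
    have "C * (L * (b / (4 * C * L))) = b / 4" using C L by (simp add: field_simps)
    then show ?thesis using C L b by (simp add: ennreal_mult[symmetric])
  qed
  finally have "1/2 * b \<le> b / 4" using b by simp
  then show False using b by simp
qed

text \<open>The images of the two maximal continuations are open and dense, hence have a point in common.
  There the continuations agree, and by uniqueness on the half line through this point they agree
  far out, where they were assumed to differ.\<close>

theorem no_two_sheets:
  fixes f :: "'a \<Rightarrow> 'b::euclidean_space"
  assumes p: "p \<ge> 3" and e: "e \<noteq> 0"
    and H: "Hausdorff_space Y" and conn: "connected_space Y"
    and U: "openin Y U" and L: "local_homeo (subtopology Y U) f"
    and infty: "\<And>z R. z \<in> topspace Y - U \<Longrightarrow> \<exists>V. openin Y V \<and> z \<in> V \<and> (\<forall>v\<in>V \<inter> U. R < norm (f v))"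
    and punctured: "\<And>z. z \<in> topspace Y - U \<Longrightarrow>
        \<exists>V. openin Y V \<and> z \<in> V \<and> V - {z} \<subseteq> U \<and> connectedin Y (V - {z})"
    and S: "\<And>i :: bool. is_section (subtopology Y U) f {w. w \<bullet> e < - R} (F0 i)"
    and disj: "\<And>w. w \<bullet> e < - R \<Longrightarrow> F0 True w \<noteq> F0 False w"
    and test: "\<And>i E F \<epsilon>. open E \<Longrightarrow> is_section (subtopology Y U) f E F \<Longrightarrow> {w. w \<bullet> e < - R} \<subseteq> E \<Longrightarrow>
        (\<And>w. w \<bullet> e < - R \<Longrightarrow> F w = F0 i w) \<Longrightarrow> \<epsilon> > 0 \<Longrightarrow>
       \<exists>\<phi> K Du. compactin Y K \<and> (\<forall>w\<in>E. F w \<notin> K \<longrightarrow> \<phi> (F w) = 0) \<and>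
       (\<forall>w. w \<bullet> e < - R \<longrightarrow> 1 \<le> \<phi> (F w)) \<and>
       (\<forall>w\<in>E. ((\<lambda>w. \<phi> (F w)) has_derivative (\<lambda>h. Du w \<bullet> h)) (at w)) \<and>
       (\<integral>\<^sup>+ w. indicator E w * ennreal (norm (Du w) ^ p) \<partial>lborel) < ennreal \<epsilon>"
  shows False
proof -
  let ?X = "subtopology Y U" and ?H = "{w. w \<bullet> e < - R}"
  have HX: "Hausdorff_space ?X" using H Hausdorff_space_subtopology by blast
  have ee: "e \<bullet> e > 0" using e by simp
  have oH: "open ?H" by (rule open_halfspace_lt[of e, unfolded inner_commute[of e]])
  have bH: "backward e ?H"
    unfolding backward_def
  proof (clarsimp simp: inner_diff_left)
    fix w and s :: real assume "w \<bullet> e < - R" "0 \<le> s"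
    moreover have "s * (e \<bullet> e) \<ge> 0" using \<open>0 \<le> s\<close> by simp
    ultimately show "w \<bullet> e - s * (e \<bullet> e) < - R" by linarith
  qed
  have reach: "\<exists>s\<ge>0. w - s *\<^sub>R e \<in> ?H" for w
  proof -
    define s where "s = (\<bar>w \<bullet> e\<bar> + \<bar>R\<bar> + 1) / (e \<bullet> e)"
    have "s \<ge> 0" using ee by (simp add: s_def)
    moreover have "(w - s *\<^sub>R e) \<bullet> e = w \<bullet> e - (\<bar>w \<bullet> e\<bar> + \<bar>R\<bar> + 1)"
      using e by (simp add: s_def inner_diff_left)
    ultimately show ?thesis by (intro exI[of _ s]) auto
  qed
  have "\<exists>E F. open E \<and> backward e E \<and> is_section ?X f E F \<and> ?H \<subseteq> E \<and> (\<forall>w\<in>?H. F w = F0 i w) \<and>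
      Y closure_of (F ` E) = topspace Y" for i
  proof -
    obtain E F where E: "open E" "backward e E" "is_section ?X f E F" "?H \<subseteq> E"
      and F0: "\<And>w. w \<in> ?H \<Longrightarrow> F w = F0 i w"
      and max: "\<And>S G w. open S \<Longrightarrow> backward e S \<Longrightarrow> is_section ?X f S G \<Longrightarrow> ?H \<subseteq> S \<Longrightarrow>
       (\<And>w. w \<in> ?H \<Longrightarrow> G w = F0 i w) \<Longrightarrow> S \<subseteq> E"
      by (rule maximal_backward_section[OF HX L oH bH S[of i] reach]) blast
    have leave: "\<forall>\<^sub>F s in at_right 0. F (w - s *\<^sub>R e) \<notin> K"
      if "w \<notin> E" "\<And>s. s > 0 \<Longrightarrow> w - s *\<^sub>R e \<in> E" "compactin Y K" for w K
    proof (rule maximal_section_leaves_compact[OF H U L _ E(1-3) _ that])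
      show "\<exists>V. openin Y V \<and> z \<in> V \<and> (\<forall>v\<in>V \<inter> U. R < norm (f v))" if "z \<in> topspace Y - U" for z R
        using infty[OF that] .
      show "S' \<subseteq> E" if "open S'" "backward e S'" "is_section ?X f S' G" "E \<subseteq> S'" "\<And>w. w \<in> E \<Longrightarrow> G w = F w" for S' G
        by (rule max[OF that(1-3)]) (use that E(4) F0 in auto)
    qed
    have "Y closure_of (F ` E) = topspace Y"
    proof (rule section_image_dense[OF H conn U L _ e E(4) E(1) E(3)])
      show "\<exists>V. openin Y V \<and> z \<in> V \<and> V - {z} \<subseteq> U \<and> connectedin Y (V - {z})" if "z \<in> topspace Y - U" for z
        using punctured[OF that] .
      show "\<exists>v\<in>ball v0 \<delta>. \<forall>t\<in>{0..L}. \<forall>s\<in>{0..1}. v + t *\<^sub>R e + s *\<^sub>R d \<in> E"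
        if "\<delta> > 0" "\<And>s t. s \<in> {0..1} \<Longrightarrow> t \<in> {0..1} \<Longrightarrow> (v0 + t *\<^sub>R e + s *\<^sub>R d) \<bullet> e < - R" for v0 d L \<delta>
      proof (rule exists_rectangle_in_section_domain[OF p e E(1,2,4) _ _ that, where Y=Y and F=F])
        show "\<exists>\<phi> K Du. compactin Y K \<and> (\<forall>w\<in>E. F w \<notin> K \<longrightarrow> \<phi> (F w) = 0) \<and>
           (\<forall>w. w \<bullet> e < - R \<longrightarrow> 1 \<le> \<phi> (F w)) \<and>
           (\<forall>w\<in>E. ((\<lambda>w. \<phi> (F w)) has_derivative (\<lambda>h. Du w \<bullet> h)) (at w)) \<and>
           (\<integral>\<^sup>+ w. indicator E w * ennreal (norm (Du w) ^ p) \<partial>lborel) < ennreal \<epsilon>" if "\<epsilon> > 0" for \<epsilon>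
          by (rule test[OF E(1,3,4) _ that, of i]) (use F0 in simp)
      qed (use leave in blast)
    qed
    then show ?thesis using E F0 by blast
  qed
  then obtain E F where *: "\<forall>i. open (E i) \<and> backward e (E i) \<and> is_section ?X f (E i) (F i) \<and> ?H \<subseteq> E i \<and>
      (\<forall>w\<in>?H. F i w = F0 i w) \<and> Y closure_of (F i ` E i) = topspace Y"
    by metis
  have EF: "open (E i)" "backward e (E i)" "is_section ?X f (E i) (F i)" "?H \<subseteq> E i"
    "\<And>w. w \<in> ?H \<Longrightarrow> F i w = F0 i w" "Y closure_of (F i ` E i) = topspace Y" for i
    using * by blast+
  have op: "openin Y (F i ` E i)" for i
    using openin_trans_full[OF section_open_image[OF L EF(1,3)] U] .
  have "?H \<noteq> {}" using reach by blast
  then have "F True ` E True \<noteq> {}" using EF(4) by blast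
  then obtain a where a: "a \<in> F True ` E True" by blast
  then have "a \<in> Y closure_of (F False ` E False)" using EF(6) openin_subset[OF op] by blast
  then obtain z where z: "z \<in> F True ` E True" "z \<in> F False ` E False"
    using a op unfolding in_closure_of by blast
  then obtain w1 w2 where w: "w1 \<in> E True" "w2 \<in> E False" "z = F True w1" "z = F False w2" by blast
  have "w1 = w2" using is_sectionD(2)[OF EF(3) w(1)] is_sectionD(2)[OF EF(3) w(2)] w by simp
  obtain s where s: "s \<ge> 0" "w1 - s *\<^sub>R e \<in> ?H" using reach by blast
  have "F True (w1 - s *\<^sub>R e) = F False (w1 - s *\<^sub>R e)"
    by (rule backward_unique[OF HX L EF(2,3) EF(2,3), of _ _ _ 0]) (use w s \<open>w1 = w2\<close> in auto)
  then show False using EF(5)[OF s(2)] disj s(2) by simp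
qed


section \<open>Stereographic projection\<close>

text \<open>Stereographic projection from the pole \<open>N\<close> to the equatorial hyperplane, followed by the isometry
  contained in \<open>T\<close>.\<close>

definition stereo :: "(real^'m \<Rightarrow> real^'n) \<Rightarrow> real^'m \<Rightarrow> real^'m \<Rightarrow> real^'n" where
  "stereo T N p = (1 / (1 - p \<bullet> N)) *\<^sub>R T p"

definition stereo_deriv :: "(real^'m \<Rightarrow> real^'n) \<Rightarrow> real^'m \<Rightarrow> real^'m \<Rightarrow> real^'m \<Rightarrow> real^'n" where
  "stereo_deriv T N p v = (1 / (1 - p \<bullet> N)) *\<^sub>R T v + ((v \<bullet> N) / (1 - p \<bullet> N)\<^sup>2) *\<^sub>R T p"

text \<open>\<open>T\<close> is the orthogonal projection along the unit vector \<open>N\<close> followed by an isometry of the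
  hyperplane onto the target space. The same \<open>T\<close> serves for \<open>N\<close> and \<open>- N\<close>.\<close>

definition equatorial :: "(real^'m \<Rightarrow> real^'n) \<Rightarrow> real^'m \<Rightarrow> bool" where
  "equatorial T N \<longleftrightarrow> norm N = 1 \<and> linear T \<and> (\<forall>v w. T v \<bullet> T w = v \<bullet> w - (v \<bullet> N) * (w \<bullet> N))"

lemma equatorial_exists:
  fixes N :: "real^'m::finite"
  assumes "norm N = 1" "CARD('m) = CARD('n::finite) + 1"
  shows "\<exists>T :: real^'m \<Rightarrow> real^'n. equatorial T N"
proof -
  have N0: "N \<noteq> 0" using assms by auto
  let ?S = "{x. N \<bullet> x = 0}"
  have d: "dim ?S = dim (UNIV :: (real^'n) set)"
    using dim_hyperplane[OF N0] assms(2) by (simp add: dim_UNIV)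
  obtain f :: "real^'m \<Rightarrow> real^'n" where f: "linear f" "\<And>x. x \<in> ?S \<Longrightarrow> norm (f x) = norm x"
    using isometries_subspaces[OF subspace_hyperplane subspace_UNIV d] by metis
  have inner: "f v \<bullet> f w = v \<bullet> w" if "v \<in> ?S" "w \<in> ?S" for v w
  proof -
    have "v + w \<in> ?S" using that by (simp add: inner_add_right)
    then have "norm (f v + f w) = norm (v + w)" using f by (metis linear_add)
    then have "(norm (f v + f w))\<^sup>2 = (norm (v + w))\<^sup>2" by simp
    then show ?thesis using f(2)[OF that(1)] f(2)[OF that(2)]
      by (simp add: dot_norm)
  qed
  define T where "T v = f (v - (v \<bullet> N) *\<^sub>R N)" for v
  have NN: "N \<bullet> N = 1" using assms by (simp add: dot_square_norm)
  have S: "v - (v \<bullet> N) *\<^sub>R N \<in> ?S" for v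
    by (simp add: inner_diff_right NN inner_commute)
  have "linear (\<lambda>v. v - (v \<bullet> N) *\<^sub>R N)"
    by (rule linearI) (simp_all add: inner_add_left algebra_simps)
  then have "linear T" unfolding T_def using linear_compose[OF _ f(1)] by (simp add: o_def)
  moreover have "T v \<bullet> T w = v \<bullet> w - (v \<bullet> N) * (w \<bullet> N)" for v w
    unfolding T_def inner[OF S S]
    by (simp add: inner_diff_left inner_diff_right NN inner_commute algebra_simps)
  ultimately show ?thesis unfolding equatorial_def using assms by blast
qed

lemma equatorial_uminus: "equatorial T N \<Longrightarrow> equatorial T (- N)"
  by (simp add: equatorial_def)

lemma inner_unit_less_one:
  fixes p N :: "'a::real_inner"
  assumes "norm p = 1" "norm N = 1" "p \<noteq> N"
  shows "p \<bullet> N < 1"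
proof -
  have "0 < (p - N) \<bullet> (p - N)" using assms by simp
  also have "(p - N) \<bullet> (p - N) = p \<bullet> p + N \<bullet> N - 2 * (p \<bullet> N)"
    by (simp only: inner_diff_left inner_diff_right inner_commute[of N p])
  also have "\<dots> = 2 - 2 * (p \<bullet> N)"
    using assms by (simp add: dot_square_norm)
  finally show ?thesis by simp
qed

lemma has_derivative_stereo:
  assumes T: "equatorial T N" and p: "p \<bullet> N \<noteq> 1"
  shows "(stereo T N has_derivative stereo_deriv T N p) (at p)"
proof -
  have lT: "bounded_linear T" using T by (simp add: equatorial_def linear_linear)
  show ?thesis unfolding stereo_def[abs_def] stereo_deriv_def[abs_def]
    by (rule has_derivative_eq_rhs, rule derivative_eq_intros bounded_linear.has_derivative[OF lT] refl)+
      (use p in \<open>auto intro!: derivative_eq_intros bounded_linear.has_derivative[OF lT] simp: fun_eq_iff power2_eq_square field_simps\<close>)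
qed

lemma stereo_deriv_conformal:
  assumes T: "equatorial T N" and p: "norm p = 1" "p \<noteq> N" and v: "v \<bullet> p = 0" and w: "w \<bullet> p = 0"
  shows "stereo_deriv T N p v \<bullet> stereo_deriv T N p w = (v \<bullet> w) / (1 - p \<bullet> N)\<^sup>2"
proof -
  define c where "c = p \<bullet> N"
  have c: "1 - c \<noteq> 0" using inner_unit_less_one[OF p(1) _ p(2)] T by (auto simp: equatorial_def c_def)
  have TT: "T x \<bullet> T y = x \<bullet> y - (x \<bullet> N) * (y \<bullet> N)" for x y using T by (simp add: equatorial_def)
  have pp: "p \<bullet> p = 1" using p by (simp add: dot_square_norm)
  define a where "a = 1 - c"
  have ca: "c = 1 - a" by (simp add: a_def)
  have "stereo_deriv T N p v \<bullet> stereo_deriv T N p w =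
     (1/a)\<^sup>2 * (T v \<bullet> T w) + (1/a) * ((w \<bullet> N) / a\<^sup>2) * (T v \<bullet> T p) +
     (1/a) * ((v \<bullet> N) / a\<^sup>2) * (T p \<bullet> T w) + ((v \<bullet> N) / a\<^sup>2) * ((w \<bullet> N) / a\<^sup>2) * (T p \<bullet> T p)"
    unfolding stereo_deriv_def c_def[symmetric] a_def[symmetric]
    by (simp add: inner_add_left inner_add_right power2_eq_square algebra_simps)
  also have "\<dots> = (v \<bullet> w) / a\<^sup>2"
    unfolding TT pp v w inner_commute[of p w] c_def[symmetric] ca using c
    by (simp add: a_def[symmetric] power2_eq_square field_simps)
  finally show ?thesis by (simp add: a_def c_def)
qed

lemma norm_stereo:
  assumes T: "equatorial T N" and p: "norm p = 1" "p \<noteq> N"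
  shows "(norm (stereo T N p))\<^sup>2 = (1 + p \<bullet> N) / (1 - p \<bullet> N)"
proof -
  define c where "c = p \<bullet> N"
  have c: "1 - c \<noteq> 0" using inner_unit_less_one[OF p(1) _ p(2)] T by (auto simp: equatorial_def c_def)
  have pp: "p \<bullet> p = 1" using p by (simp add: dot_square_norm)
  have "(norm (stereo T N p))\<^sup>2 = (1 / (1 - c))\<^sup>2 * (T p \<bullet> T p)"
    by (simp add: stereo_def c_def power_mult_distrib power_divide dot_square_norm)
  also have "T p \<bullet> T p = (1 - c) * (1 + c)" using T pp by (simp add: equatorial_def c_def algebra_simps)
  also have "(1 / (1 - c))\<^sup>2 * ((1 - c) * (1 + c)) = (1 + c) / (1 - c)"
    using c by (simp add: power2_eq_square)
  finally show ?thesis by (simp add: c_def)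
qed

text \<open>On the sphere, the projections from opposite poles differ by inversion in the unit sphere of the
  equatorial hyperplane.\<close>

lemma stereo_inversion:
  assumes T: "equatorial T N" and p: "norm p = 1" "p \<noteq> N" "p \<noteq> - N"
    and eq: "stereo T (- N) p = (1 / (norm w)\<^sup>2) *\<^sub>R w"
  shows "stereo T N p = w"
proof -
  define c where "c = p \<bullet> N"
  have N: "norm N = 1" using T by (simp add: equatorial_def)
  have c: "1 - c > 0" "1 + c > 0"
    using inner_unit_less_one[OF p(1) N p(2)] inner_unit_less_one[OF p(1) _ p(3)] N by (auto simp: c_def)
  have "(norm (stereo T (- N) p))\<^sup>2 = (1 - c) / (1 + c)"
    using norm_stereo[OF equatorial_uminus[OF T] p(1,3)] by (simp add: c_def)
  moreover have "(norm ((1 / (norm w)\<^sup>2) *\<^sub>R w))\<^sup>2 = 1 / (norm w)\<^sup>2"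
    by (cases "w = 0") (simp_all add: power_mult_distrib power_divide power2_eq_square)
  ultimately have w: "1 / (norm w)\<^sup>2 = (1 - c) / (1 + c)" using eq by simp
  have "(1 / (1 + c)) *\<^sub>R T p = ((1 - c) / (1 + c)) *\<^sub>R w"
    using eq unfolding w by (simp add: stereo_def c_def)
  then have "((1 + c) / (1 - c)) *\<^sub>R ((1 / (1 + c)) *\<^sub>R T p) = ((1 + c) / (1 - c)) *\<^sub>R (((1 - c) / (1 + c)) *\<^sub>R w)"
    by simp
  then show ?thesis using c by (simp add: stereo_def c_def)
qed

lemma stereo_at_pole:
  assumes T: "equatorial T N" and p: "norm p = 1" "p \<noteq> N" and near: "p \<bullet> N > 1 - 1 / (\<bar>R\<bar> + 1)\<^sup>2"
  shows "R < norm (stereo T N p)"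
proof -
  define c where "c = p \<bullet> N"
  have c: "1 - c > 0"
    using inner_unit_less_one[OF p(1) _ p(2)] T by (auto simp: c_def equatorial_def)
  have R1: "(\<bar>R\<bar> + 1)\<^sup>2 \<ge> 1" by simp
  then have "1 / (\<bar>R\<bar> + 1)\<^sup>2 \<le> 1" by simp
  then have c0: "c > 0" using near unfolding c_def by linarith
  have "1 - c < 1 / (\<bar>R\<bar> + 1)\<^sup>2" using near by (simp add: c_def)
  then have "(\<bar>R\<bar> + 1)\<^sup>2 < 1 / (1 - c)" using c R1 by (simp add: field_simps)
  also have "\<dots> \<le> (1 + c) / (1 - c)" using c c0 by (intro divide_right_mono) auto
  also have "\<dots> = (norm (stereo T N p))\<^sup>2" using norm_stereo[OF T p] by (simp add: c_def)
  finally have "\<bar>R\<bar> + 1 < norm (stereo T N p)" by (rule power2_less_imp_less) simp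
  then show ?thesis by linarith
qed


section \<open>Charts and conformal coordinates\<close>

lemma smooth_on_imp_C1:
  assumes "smooth_on S f"
  shows "x \<in> S \<Longrightarrow> f differentiable (at x)" "continuous_on S (\<lambda>x. frechet_derivative f (at x) v)"
    "x \<in> S \<Longrightarrow> (f has_derivative frechet_derivative f (at x)) (at x)" "continuous_on S f"
proof -
  have C: "C_diff_on (Suc 0) S f" using assms by (auto simp: smooth_on_def simp del: C_diff_on.simps)
  then show d: "x \<in> S \<Longrightarrow> f differentiable (at x)" for x by simp
  show "continuous_on S (\<lambda>x. frechet_derivative f (at x) v)" using C by simp
  show "x \<in> S \<Longrightarrow> (f has_derivative frechet_derivative f (at x)) (at x)"
    using d frechet_derivative_works by blast
  show "continuous_on S f"
    using d differentiable_imp_continuous_within continuous_at_imp_continuous_on by blast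
qed

lemma
  assumes M: "smooth_manifold M" and c: "c \<in> atlas M"
  shows chart_open: "openin (topo M) (fst c)" "open (snd c ` fst c)"
    and chart_inv_inverse: "z \<in> fst c \<Longrightarrow> chart_inv c (snd c z) = z"
    and chart_inv_into: "y \<in> snd c ` fst c \<Longrightarrow> chart_inv c y \<in> fst c"
    and chart_inv_right: "y \<in> snd c ` fst c \<Longrightarrow> snd c (chart_inv c y) = y"
    and chart_continuous: "continuous_map (subtopology (topo M) (fst c)) euclidean (snd c)"
    and chart_inv_continuous: "continuous_map (top_of_set (snd c ` fst c)) (topo M) (chart_inv c)"
proof -
  have h: "homeomorphic_map (subtopology (topo M) (fst c)) (top_of_set (snd c ` fst c)) (snd c)"
    and o: "openin (topo M) (fst c)" "open (snd c ` fst c)"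
    using M c unfolding smooth_manifold_def by blast+
  then show "openin (topo M) (fst c)" "open (snd c ` fst c)" by auto
  have ts: "topspace (subtopology (topo M) (fst c)) = fst c" using openin_subset[OF o(1)] by auto
  have inj: "inj_on (snd c) (fst c)" using homeomorphic_imp_injective_map[OF h] ts by simp
  show inv: "z \<in> fst c \<Longrightarrow> chart_inv c (snd c z) = z" for z using inj by (simp add: chart_inv_def)
  show into: "y \<in> snd c ` fst c \<Longrightarrow> chart_inv c y \<in> fst c" for y by (simp add: chart_inv_def inv_into_into)
  show right: "y \<in> snd c ` fst c \<Longrightarrow> snd c (chart_inv c y) = y" for y by (simp add: chart_inv_def f_inv_into_f)
  show "continuous_map (subtopology (topo M) (fst c)) euclidean (snd c)"
    using homeomorphic_imp_continuous_map[OF h] by (rule continuous_map_into_fulltopology)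
  obtain g where g: "homeomorphic_maps (subtopology (topo M) (fst c)) (top_of_set (snd c ` fst c)) (snd c) g"
    using h homeomorphic_map_maps by blast
  have "continuous_map (top_of_set (snd c ` fst c)) (subtopology (topo M) (fst c)) g"
    using g by (simp add: homeomorphic_maps_def)
  then have "continuous_map (top_of_set (snd c ` fst c)) (topo M) g"
    by (rule continuous_map_into_fulltopology)
  moreover have "g y = chart_inv c y" if y: "y \<in> topspace (top_of_set (snd c ` fst c))" for y
  proof -
    obtain z where z: "z \<in> fst c" "y = snd c z" using y by auto
    then have "g y = z" using g ts by (auto simp: homeomorphic_maps_def)
    then show ?thesis using inv z by simp
  qed
  ultimately show "continuous_map (top_of_set (snd c ` fst c)) (topo M) (chart_inv c)"
    by (rule continuous_map_eq)
qed

lemma chart_image_open: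
  assumes M: "smooth_manifold M" and c: "c \<in> atlas M" and W: "openin (topo M) W"
  shows "open (snd c ` (fst c \<inter> W))"
proof -
  have "openin (top_of_set (snd c ` fst c)) {y \<in> topspace (top_of_set (snd c ` fst c)). chart_inv c y \<in> W}"
    by (rule openin_continuous_map_preimage[OF chart_inv_continuous[OF M c] W])
  then have "open {y \<in> snd c ` fst c. chart_inv c y \<in> W}"
    using openin_open_trans[OF _ chart_open(2)[OF M c]] by simp
  also have "{y \<in> snd c ` fst c. chart_inv c y \<in> W} = snd c ` (fst c \<inter> W)"
    using chart_inv_inverse[OF M c] by force
  finally show ?thesis .
qed

lemma chart_inv_image_open:
  assumes M: "smooth_manifold M" and c: "c \<in> atlas M" and S: "open S" "S \<subseteq> snd c ` fst c"
  shows "openin (topo M) (chart_inv c ` S)"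
proof -
  have "openin (subtopology (topo M) (fst c)) {z \<in> topspace (subtopology (topo M) (fst c)). snd c z \<in> S}"
    by (rule openin_continuous_map_preimage[OF chart_continuous[OF M c]]) (use S in simp)
  then have "openin (topo M) {z \<in> topspace (subtopology (topo M) (fst c)). snd c z \<in> S}"
    using openin_trans_full chart_open(1)[OF M c] by blast
  also have "{z \<in> topspace (subtopology (topo M) (fst c)). snd c z \<in> S} = chart_inv c ` S"
  proof -
    have "topspace (subtopology (topo M) (fst c)) = fst c" using openin_subset[OF chart_open(1)[OF M c]] by auto
    moreover have "{z \<in> fst c. snd c z \<in> S} = chart_inv c ` S"
    proof (intro equalityI subsetI)
      fix z assume "z \<in> {z \<in> fst c. snd c z \<in> S}"
      then show "z \<in> chart_inv c ` S" using chart_inv_inverse[OF M c, of z] by (metis (mono_tags) imageI mem_Collect_eq)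
    next
      fix z assume "z \<in> chart_inv c ` S"
      then obtain y where y: "y \<in> S" "z = chart_inv c y" by auto
      then have "y \<in> snd c ` fst c" using S by blast
      then show "z \<in> {z \<in> fst c. snd c z \<in> S}" using y chart_inv_into[OF M c] chart_inv_right[OF M c] by simp
    qed
    ultimately show ?thesis by simp
  qed
  finally show ?thesis .
qed

lemma chart_exists:
  assumes M: "smooth_manifold M" and z: "z \<in> pts M"
  shows "chart_at M z \<in> atlas M" "z \<in> fst (chart_at M z)"
proof -
  have "\<exists>c. c \<in> atlas M \<and> z \<in> fst c" using M z unfolding smooth_manifold_def by blast
  then have "chart_at M z \<in> atlas M \<and> z \<in> fst (chart_at M z)"
    unfolding chart_at_def by (rule someI_ex)
  then show "chart_at M z \<in> atlas M" "z \<in> fst (chart_at M z)" by auto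
qed

lemma continuous_map_in_charts:
  fixes g :: "'a \<Rightarrow> 'b::topological_space"
  assumes M: "smooth_manifold M" and U: "openin (topo M) U"
    and cont: "\<And>c. c \<in> atlas M \<Longrightarrow> continuous_on (snd c ` (fst c \<inter> U)) (g \<circ> chart_inv c)"
  shows "continuous_map (subtopology (topo M) U) euclidean g"
  unfolding continuous_map_def
proof (intro conjI allI impI)
  fix V :: "'b set" assume "openin euclidean V"
  then have V: "open V" by simp
  let ?S = "\<lambda>c. {y \<in> snd c ` (fst c \<inter> U). g (chart_inv c y) \<in> V}"
  have tU: "topspace (subtopology (topo M) U) = U" using openin_subset[OF U] by auto
  have op: "openin (topo M) (chart_inv c ` ?S c)" if c: "c \<in> atlas M" for c
  proof (rule chart_inv_image_open[OF M c])
    show "open (?S c)"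
      using continuous_open_preimage[OF cont[OF c] chart_image_open[OF M c U] V]
      by (simp add: vimage_def o_def Int_def conj_commute)
  qed auto
  have "{z \<in> U. g z \<in> V} = (\<Union>c\<in>atlas M. chart_inv c ` ?S c)"
  proof (intro equalityI subsetI)
    fix z assume z: "z \<in> {z \<in> U. g z \<in> V}"
    then have zM: "z \<in> pts M" using openin_subset[OF U] by auto
    let ?c = "chart_at M z"
    have "snd ?c z \<in> ?S ?c" using z chart_exists[OF M zM] chart_inv_inverse[OF M] by auto
    then have "chart_inv ?c (snd ?c z) \<in> chart_inv ?c ` ?S ?c" by blast
    then show "z \<in> (\<Union>c\<in>atlas M. chart_inv c ` ?S c)"
      using chart_exists[OF M zM] chart_inv_inverse[OF M] by auto
  next
    fix z assume "z \<in> (\<Union>c\<in>atlas M. chart_inv c ` ?S c)"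
    then show "z \<in> {z \<in> U. g z \<in> V}" using chart_inv_inverse[OF M] by auto
  qed
  then have "openin (topo M) {z \<in> U. g z \<in> V}" using op by auto
  then show "openin (subtopology (topo M) U) {z \<in> topspace (subtopology (topo M) U). g z \<in> V}"
    unfolding tU by (metis (no_types, lifting) U mem_Collect_eq openin_open_subtopology subsetI)
qed auto

lemma smooth_fun_continuous:
  assumes M: "smooth_manifold M" and g: "smooth_fun M (pts M) g"
  shows "continuous_map (topo M) euclidean g"
proof -
  have "continuous_map (subtopology (topo M) (pts M)) euclidean g"
  proof (rule continuous_map_in_charts[OF M openin_topspace])
    fix c assume "c \<in> atlas M"
    then have "smooth_on (snd c ` (fst c \<inter> pts M)) (g \<circ> chart_inv c)" using g by (simp add: smooth_fun_def)
    then show "continuous_on (snd c ` (fst c \<inter> pts M)) (g \<circ> chart_inv c)" by (rule smooth_on_imp_C1(4))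
  qed
  then show ?thesis by simp
qed

text \<open>\<open>f\<close> pulls the Euclidean metric back to \<open>\<kappa>\<^sup>2\<close> times the metric of \<open>M\<close>. The differentials of \<open>f\<close> in the
  charts are a parameter \<open>B\<close>, so that their continuity can be stated.\<close>

definition conformal_coord ::
    "('a, 'n::finite) riem_data \<Rightarrow> 'a set \<Rightarrow> ('a \<Rightarrow> real^'n) \<Rightarrow> ('a \<Rightarrow> real) \<Rightarrow> (('a,'n) chart \<Rightarrow> real^'n \<Rightarrow> real^'n \<Rightarrow> real^'n) \<Rightarrow> bool" where
  "conformal_coord M U f \<kappa> B \<longleftrightarrow> openin (topo M) U \<and>
     continuous_map (subtopology (topo M) U) euclideanreal \<kappa> \<and> (\<forall>z\<in>U. \<kappa> z > 0) \<and>
     (\<forall>c\<in>atlas M. (\<forall>z\<in>fst c \<inter> U.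
         ((f \<circ> chart_inv c) has_derivative B c (snd c z)) (at (snd c z)) \<and>
         (\<forall>v w. B c (snd c z) v \<bullet> B c (snd c z) w = (\<kappa> z)\<^sup>2 * (v \<bullet> (gram M c z *v w)))) \<and>
         (\<forall>v. continuous_on (snd c ` (fst c \<inter> U)) (\<lambda>y. B c y v)))"

lemma gram_pos:
  assumes "riemannian_manifold M" "c \<in> atlas M" "z \<in> fst c"
  shows "v \<noteq> 0 \<Longrightarrow> v \<bullet> (gram M c z *v v) > 0" "transpose (gram M c z) = gram M c z"
  using assms unfolding riemannian_manifold_def by blast+

lemma gram_invertible:
  assumes "riemannian_manifold M" "c \<in> atlas M" "z \<in> fst c"
  shows "invertible (gram M c z)"
  unfolding invertible_left_inverse matrix_left_invertible_ker
  using gram_pos(1)[OF assms] by (metis inner_zero_right less_irrefl)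

lemma gram_matrix_inv:
  assumes "riemannian_manifold M" "c \<in> atlas M" "z \<in> fst c"
  shows "gram M c z *v (matrix_inv (gram M c z) *v v) = v"
proof -
  let ?G = "gram M c z"
  have "\<exists>A'. ?G ** A' = mat 1 \<and> A' ** ?G = mat 1" using gram_invertible[OF assms] by (simp add: invertible_def)
  then have "?G ** matrix_inv ?G = mat 1 \<and> matrix_inv ?G ** ?G = mat 1"
    unfolding matrix_inv_def by (rule someI_ex)
  then show ?thesis by (simp add: matrix_vector_mul_assoc)
qed

lemma riemannian_smooth: "riemannian_manifold M \<Longrightarrow> smooth_manifold M"
  by (simp add: riemannian_manifold_def)

lemma conformal_coordD:
  assumes "conformal_coord M U f \<kappa> B"
  shows "openin (topo M) U" "continuous_map (subtopology (topo M) U) euclideanreal \<kappa>" "z \<in> U \<Longrightarrow> \<kappa> z > 0"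
    "c \<in> atlas M \<Longrightarrow> z \<in> fst c \<Longrightarrow> z \<in> U \<Longrightarrow> ((f \<circ> chart_inv c) has_derivative B c (snd c z)) (at (snd c z))"
    "c \<in> atlas M \<Longrightarrow> z \<in> fst c \<Longrightarrow> z \<in> U \<Longrightarrow> B c (snd c z) v \<bullet> B c (snd c z) w = (\<kappa> z)\<^sup>2 * (v \<bullet> (gram M c z *v w))"
    "c \<in> atlas M \<Longrightarrow> continuous_on (snd c ` (fst c \<inter> U)) (\<lambda>y. B c y v)"
  using assms unfolding conformal_coord_def by blast+

lemma conformal_coord_inj:
  assumes M: "riemannian_manifold M" and cc: "conformal_coord M U f \<kappa> B"
    and c: "c \<in> atlas M" "z \<in> fst c" "z \<in> U"
  shows "linear (B c (snd c z))" "inj (B c (snd c z))"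
proof -
  show l: "linear (B c (snd c z))"
    using conformal_coordD(4)[OF cc c] has_derivative_linear by blast
  have "v = 0" if "B c (snd c z) v = 0" for v
  proof (rule ccontr)
    assume "v \<noteq> 0"
    then have "0 < (\<kappa> z)\<^sup>2 * (v \<bullet> (gram M c z *v v))"
      using gram_pos(1)[OF M c(1,2)] conformal_coordD(3)[OF cc c(3)] by simp
    then show False using conformal_coordD(5)[OF cc c, of v v] that by (metis inner_zero_left less_irrefl)
  qed
  then show "inj (B c (snd c z))" using linear_injective_0[OF l] by blast
qed

text \<open>The inverse function theorem in a chart: a conformal differential is injective, hence invertible.\<close>

lemma conformal_coord_local_homeo:
  assumes M: "riemannian_manifold M" and cc: "conformal_coord M U f \<kappa> B"
  shows "local_homeo (subtopology (topo M) U) f"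
  unfolding local_homeo_def
proof (intro conjI ballI)
  note SM = riemannian_smooth[OF M]
  note U = conformal_coordD(1)[OF cc]
  have tU: "topspace (subtopology (topo M) U) = U" using openin_subset[OF U] by auto
  show "continuous_map (subtopology (topo M) U) euclidean f"
  proof (rule continuous_map_in_charts[OF SM U])
    fix c assume c: "c \<in> atlas M"
    show "continuous_on (snd c ` (fst c \<inter> U)) (f \<circ> chart_inv c)"
      using conformal_coordD(4)[OF cc c] has_derivative_continuous
      by (intro continuous_at_imp_continuous_on) blast
  qed
  fix z assume "z \<in> topspace (subtopology (topo M) U)"
  then have zU: "z \<in> U" using tU by simp
  then have zM: "z \<in> pts M" using openin_subset[OF U] by auto
  define c where "c = chart_at M z"
  have c: "c \<in> atlas M" "z \<in> fst c" using chart_exists[OF SM zM] by (auto simp: c_def)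
  define W where "W = snd c ` (fst c \<inter> U)"
  have oW: "open W" unfolding W_def by (rule chart_image_open[OF SM c(1) U])
  define fc where "fc = f \<circ> chart_inv c"
  define f' where "f' y = Blinfun (B c y)" for y
  have bl: "bounded_linear (B c y)" if "y \<in> W" for y
    using conformal_coord_inj(1)[OF M cc c(1)] that by (auto simp: W_def linear_linear)
  have f': "blinfun_apply (f' y) = B c y" if "y \<in> W" for y
    unfolding f'_def using bounded_linear_Blinfun_apply[OF bl[OF that]] .
  have der: "(fc has_derivative blinfun_apply (f' y)) (at y)" if "y \<in> W" for y
    unfolding f'[OF that] fc_def using conformal_coordD(4)[OF cc c(1)] that by (auto simp: W_def)
  have cont: "continuous_on W f'"
  proof (rule continuous_on_blinfun_componentwise)
    fix i :: "real^'b"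
    have "continuous_on W (\<lambda>y. B c y i)" unfolding W_def by (rule conformal_coordD(6)[OF cc c(1)])
    then show "continuous_on W (\<lambda>y. blinfun_apply (f' y) i)" by (rule continuous_on_eq) (simp add: f')
  qed
  define y0 where "y0 = snd c z"
  have y0: "y0 \<in> W" using c zU by (auto simp: W_def y0_def)
  have fcy0: "fc y0 = f z" using chart_inv_inverse[OF SM c] by (simp add: fc_def y0_def)
  obtain g' where g': "linear g'" "g' \<circ> B c y0 = id"
    using linear_injective_left_inverse[of "B c y0"] conformal_coord_inj[OF M cc c zU] by (auto simp: y0_def)
  have "Blinfun g' o\<^sub>L f' y0 = id_blinfun"
    by (rule blinfun_eqI) (use g' f'[OF y0] in \<open>simp add: bounded_linear_Blinfun_apply linear_linear[symmetric] pointfree_idE\<close>)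
  then obtain S V g where S: "open S" "S \<subseteq> W" "y0 \<in> S" "open V" "fc y0 \<in> V" "homeomorphism S V fc g"
    using inverse_function_theorem[OF oW der cont y0] by metis
  obtain r where r: "r > 0" "ball (f z) r \<subseteq> V" using S(4,5) fcy0 open_contains_ball by metis
  define G where "G = chart_inv c \<circ> g"
  have gS: "g w \<in> S" "fc (g w) = w" if "w \<in> V" for w using S(6) that by (auto simp: homeomorphism_def)
  have gf: "g (fc y) = y" "fc y \<in> V" if "y \<in> S" for y using S(6) that by (auto simp: homeomorphism_def)
  have Wc: "W \<subseteq> snd c ` fst c" by (auto simp: W_def)
  have WU: "chart_inv c y \<in> U" if "y \<in> W" for y using that chart_inv_inverse[OF SM c(1)] by (auto simp: W_def)
  have sec: "is_section (subtopology (topo M) U) f (ball (f z) r) G"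
    unfolding is_section_def
  proof
    have "continuous_map (top_of_set (ball (f z) r)) (top_of_set (snd c ` fst c)) g"
    proof -
      have "continuous_on (ball (f z) r) g"
        using S(6) r(2) unfolding homeomorphism_def by (meson continuous_on_subset)
      moreover have "g ` ball (f z) r \<subseteq> snd c ` fst c" using r(2) gS(1) S(2) Wc by blast
      ultimately show ?thesis by auto
    qed
    then have "continuous_map (top_of_set (ball (f z) r)) (topo M) G"
      unfolding G_def using chart_inv_continuous[OF SM c(1)] continuous_map_compose by blast
    moreover have "G \<in> ball (f z) r \<rightarrow> U"
    proof
      fix w assume "w \<in> ball (f z) r"
      then have "g w \<in> W" using gS(1) r(2) S(2) by blast
      then show "G w \<in> U" using WU by (simp add: G_def)
    qed
    ultimately show "continuous_map (top_of_set (ball (f z) r)) (subtopology (topo M) U) G"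
      by (simp add: continuous_map_in_subtopology)
    show "\<forall>w\<in>ball (f z) r. f (G w) = w" using gS(2) r(2) by (auto simp: G_def fc_def)
  qed
  define Q where "Q = {y \<in> S. fc y \<in> ball (f z) r}"
  have Qo: "open Q"
  proof -
    have "continuous_on S fc" using S(6) by (simp add: homeomorphism_def)
    then have "open (S \<inter> fc -` ball (f z) r)" using S(1) by (simp add: continuous_open_preimage)
    also have "S \<inter> fc -` ball (f z) r = Q" by (auto simp: Q_def)
    finally show ?thesis .
  qed
  have GQ: "G ` ball (f z) r = chart_inv c ` Q"
  proof (intro equalityI subsetI)
    fix v assume "v \<in> G ` ball (f z) r"
    then obtain w where w: "w \<in> ball (f z) r" "v = chart_inv c (g w)" by (auto simp: G_def)
    then have "g w \<in> Q" using gS r(2) by (auto simp: Q_def)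
    then show "v \<in> chart_inv c ` Q" using w by blast
  next
    fix v assume "v \<in> chart_inv c ` Q"
    then obtain y where y: "y \<in> S" "fc y \<in> ball (f z) r" "v = chart_inv c y" by (auto simp: Q_def)
    then have "v = G (fc y)" using gf by (simp add: G_def)
    then show "v \<in> G ` ball (f z) r" using y by blast
  qed
  have op: "openin (topo M) (G ` ball (f z) r)"
    unfolding GQ by (rule chart_inv_image_open[OF SM c(1) Qo]) (use S(2) Wc in \<open>auto simp: Q_def\<close>)
  have opU: "openin (subtopology (topo M) U) (G ` ball (f z) r)"
    using op is_sectionD(1)[OF sec] tU by (intro subset_openin_subtopology) auto
  have "z = G (f z)" using gf(1)[OF S(3)] fcy0 chart_inv_inverse[OF SM c] by (simp add: G_def y0_def)
  then have zG: "z \<in> G ` ball (f z) r" using r(1) by (metis centre_in_ball imageI)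
  have Gf: "\<forall>v\<in>G ` ball (f z) r. G (f v) = v" using is_sectionD(2)[OF sec] by auto
  show "\<exists>V G. \<exists>r>0. openin (subtopology (topo M) U) V \<and> z \<in> V \<and>
      is_section (subtopology (topo M) U) f (ball (f z) r) G \<and> G ` ball (f z) r = V \<and> (\<forall>v\<in>V. G (f v) = v)"
    using opU zG sec Gf r(1) by blast
qed

text \<open>In a chart, \<open>F\<close> is an inverse of \<open>f\<close>, so its differential is inverse to the conformal differential
  \<open>A\<close> of \<open>f\<close>. Conformality turns the transposed inverse into \<open>A\<close> again: the Euclidean gradient of
  \<open>\<phi> \<circ> F\<close> is \<open>\<kappa>\<^sup>-\<^sup>2\<close> times \<open>A\<close> applied to the Riemannian gradient of \<open>\<phi>\<close>. So its length is the
  Riemannian one divided by \<open>\<kappa>\<close>.\<close>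

lemma section_gradient:
  assumes M: "riemannian_manifold M" and cc: "conformal_coord M U f \<kappa> B"
    and E: "open E" and F: "is_section (subtopology (topo M) U) f E F"
    and \<phi>: "smooth_fun M (pts M) \<phi>"
  shows "\<exists>Du. \<forall>w\<in>E. ((\<lambda>w. \<phi> (F w)) has_derivative (\<lambda>h. Du w \<bullet> h)) (at w) \<and>
       norm (Du w) = grad_norm M \<phi> (F w) / \<kappa> (F w)"
proof -
  note SM = riemannian_smooth[OF M]
  note U = conformal_coordD(1)[OF cc]
  have tU: "topspace (subtopology (topo M) U) = U" using openin_subset[OF U] by auto
  have "\<exists>q. ((\<lambda>w. \<phi> (F w)) has_derivative (\<lambda>h. q \<bullet> h)) (at w) \<and> norm q = grad_norm M \<phi> (F w) / \<kappa> (F w)"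
    if w: "w \<in> E" for w
  proof -
    define z where "z = F w"
    have zU: "z \<in> U" "f z = w" using is_sectionD[OF F w] tU by (auto simp: z_def)
    have zM: "z \<in> pts M" using zU openin_subset[OF U] by auto
    define c where "c = chart_at M z"
    have c: "c \<in> atlas M" "z \<in> fst c" using chart_exists[OF SM zM] by (auto simp: c_def)
    define y where "y = snd c z"
    define A where "A = B c y"
    have A: "linear A" "inj A" using conformal_coord_inj[OF M cc c zU(1)] by (auto simp: A_def y_def)
    then obtain A' where A': "linear A'" "A' \<circ> A = id" using linear_injective_left_inverse by blast
    have "surj A" using A linear_injective_imp_surjective by auto
    then have AA': "A (A' x) = x" for x using A' by (metis pointfree_idE surjD)
    define T where "T = {v\<in>E. F v \<in> fst c \<inter> U}"
    have "openin (subtopology (topo M) U) (fst c \<inter> U)"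
      using chart_open(1)[OF SM c(1)] openin_subtopology by blast
    then have T: "open T" unfolding T_def by (rule is_section_open_vimage[OF F E])
    have wT: "w \<in> T" using w c zU by (auto simp: z_def T_def)
    define \<psi> where "\<psi> = snd c \<circ> F"
    have \<psi>cont: "continuous (at w) \<psi>"
    proof -
      have "continuous_map (top_of_set T) (topo M) F"
        using is_section_subset[OF F, of T] unfolding is_section_def T_def continuous_map_in_subtopology by auto
      then have "continuous_map (top_of_set T) (subtopology (topo M) (fst c)) F"
        by (auto simp: continuous_map_in_subtopology T_def)
      then have "continuous_map (top_of_set T) euclidean \<psi>"
        unfolding \<psi>_def using chart_continuous[OF SM c(1)] continuous_map_compose by blast
      then have "continuous_on T \<psi>" by simp
      then show ?thesis using T wT continuous_on_eq_continuous_at by blast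
    qed
    have inv: "(f \<circ> chart_inv c) (\<psi> v) = v" if "v \<in> T" for v
      using that is_sectionD(2)[OF F] chart_inv_inverse[OF SM c(1)] by (auto simp: T_def \<psi>_def)
    have derf: "((f \<circ> chart_inv c) has_derivative A) (at (\<psi> w))"
      using conformal_coordD(4)[OF cc c zU(1)] by (simp add: A_def y_def \<psi>_def z_def)
    have d\<psi>: "(\<psi> has_derivative A') (at w)"
      by (rule has_derivative_inverse_basic[OF derf _ A'(2) \<psi>cont T wT inv]) (use A'(1) in \<open>simp_all add: linear_linear\<close>)
    define P where "P = frechet_derivative (\<phi> \<circ> chart_inv c) (at y)"
    have dP: "((\<phi> \<circ> chart_inv c) has_derivative P) (at (\<psi> w))"
    proof -
      have "smooth_on (snd c ` (fst c \<inter> pts M)) (\<phi> \<circ> chart_inv c)" using \<phi> c(1) by (simp add: smooth_fun_def)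
      then show ?thesis unfolding P_def \<psi>_def using c zM
        by (simp add: y_def z_def[symmetric] smooth_on_imp_C1(3))
    qed
    have "((\<lambda>w. (\<phi> \<circ> chart_inv c) (\<psi> w)) has_derivative (\<lambda>h. P (A' h))) (at w)"
      by (rule has_derivative_compose[OF d\<psi> dP])
    then have d: "((\<lambda>w. \<phi> (F w)) has_derivative (\<lambda>h. P (A' h))) (at w)"
      by (rule has_derivative_transform_within_open[OF _ T wT])
        (use chart_inv_inverse[OF SM c(1)] in \<open>auto simp: T_def \<psi>_def\<close>)
    let ?G = "gram M c z"
    define gr where "gr = gradient M c \<phi> z"
    define p where "p = (\<chi> i. P (axis i 1))"
    have lP: "linear P" using dP has_derivative_linear by blast
    have Pp: "P v = p \<bullet> v" for v
    proof -
      have "P v = (\<Sum>i\<in>UNIV. v $ i * P (axis i 1))"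
        by (subst basis_expansion[symmetric, of v])
          (simp add: linear_sum[OF lP] linear_cmul[OF lP] scalar_mult_eq_scaleR)
      then show ?thesis by (simp add: inner_vec_def p_def mult.commute)
    qed
    have Ggr: "?G *v gr = p"
      unfolding gr_def gradient_def p_def P_def y_def by (rule gram_matrix_inv[OF M c])
    have conf: "A v \<bullet> A x = (\<kappa> z)\<^sup>2 * (v \<bullet> (?G *v x))" for v x
      using conformal_coordD(5)[OF cc c zU(1)] by (simp add: A_def y_def)
    have k: "\<kappa> z > 0" using conformal_coordD(3)[OF cc zU(1)] .
    define q where "q = (1 / (\<kappa> z)\<^sup>2) *\<^sub>R A gr"
    have "P (A' h) = q \<bullet> h" for h
    proof -
      have "q \<bullet> h = (1 / (\<kappa> z)\<^sup>2) * (A gr \<bullet> A (A' h))" by (simp add: q_def AA')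
      also have "A gr \<bullet> A (A' h) = A (A' h) \<bullet> A gr" by (rule inner_commute)
      also have "\<dots> = (\<kappa> z)\<^sup>2 * P (A' h)" unfolding conf Ggr Pp by (simp add: inner_commute)
      finally show ?thesis using k by simp
    qed
    then have dq: "((\<lambda>w. \<phi> (F w)) has_derivative (\<lambda>h. q \<bullet> h)) (at w)" using d by simp
    have "norm (A gr) = \<kappa> z * metric_norm M c z gr"
      using k by (simp add: norm_eq_sqrt_inner conf metric_norm_def real_sqrt_mult)
    then have "norm q = metric_norm M c z gr / \<kappa> z"
      using k by (simp add: q_def power2_eq_square)
    also have "metric_norm M c z gr = grad_norm M \<phi> z" by (simp add: grad_norm_def gr_def c_def Let_def)
    finally show ?thesis using dq by (auto simp: z_def)
  qed
  then show ?thesis by metis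
qed


section \<open>The Riemannian volume\<close>

definition borel_sets :: "('a, 'n::finite) riem_data \<Rightarrow> 'a measure" where
  "borel_sets M = sigma (pts M) {U. openin (topo M) U}"

lemma space_borel_sets[simp]: "space (borel_sets M) = pts M"
  and sets_borel_sets: "sets (borel_sets M) = sigma_sets (pts M) {U. openin (topo M) U}"
proof -
  have "{U. openin (topo M) U} \<subseteq> Pow (pts M)" using openin_subset by blast
  then show "space (borel_sets M) = pts M" "sets (borel_sets M) = sigma_sets (pts M) {U. openin (topo M) U}"
    unfolding borel_sets_def by (auto simp: space_measure_of_conv sets_measure_of)
qed

lemma openin_borel_sets: "openin (topo M) U \<Longrightarrow> U \<in> sets (borel_sets M)"
  by (auto simp: sets_borel_sets intro: sigma_sets.Basic)

definition vol_density :: "('a, 'n::finite) riem_data \<Rightarrow> ('a,'n) chart \<Rightarrow> real^'n \<Rightarrow> ennreal" where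
  "vol_density M c y = indicator (snd c ` fst c) y * ennreal (sqrt (det (gram M c (chart_inv c y))))"

text \<open>Extended by a point of \<open>M\<close> to a map that is measurable on the whole coordinate space.\<close>

definition chart_inv_total :: "('a, 'n::finite) riem_data \<Rightarrow> ('a,'n) chart \<Rightarrow> real^'n \<Rightarrow> 'a" where
  "chart_inv_total M c y = (if y \<in> snd c ` fst c then chart_inv c y else (SOME z. z \<in> pts M))"

definition chart_volume :: "('a, 'n::finite) riem_data \<Rightarrow> ('a,'n) chart \<Rightarrow> 'a measure" where
  "chart_volume M c = distr (density lborel (vol_density M c)) (borel_sets M) (chart_inv_total M c)"

lemma continuous_on_det:
  fixes A :: "'a::topological_space \<Rightarrow> real^'n::finite^'n"
  assumes "continuous_on S A"
  shows "continuous_on S (\<lambda>y. det (A y))"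
  unfolding det_def by (intro continuous_intros assms)

lemma vol_density_measurable[measurable]:
  assumes M: "riemannian_manifold M" and c: "c \<in> atlas M"
  shows "vol_density M c \<in> borel_measurable borel"
proof -
  have "smooth_on (snd c ` fst c) (gram M c \<circ> chart_inv c)"
    using M c by (simp add: riemannian_manifold_def)
  then have "continuous_on (snd c ` fst c) (\<lambda>y. gram M c (chart_inv c y))"
    using smooth_on_imp_C1(4) by (fastforce simp: o_def)
  then have "continuous_on (snd c ` fst c) (\<lambda>y. sqrt (det (gram M c (chart_inv c y))))"
    by (intro continuous_intros continuous_on_det)
  then have "(\<lambda>y. indicator (snd c ` fst c) y *\<^sub>R sqrt (det (gram M c (chart_inv c y)))) \<in> borel_measurable borel"
    using chart_open(2)[OF riemannian_smooth[OF M] c] by (intro borel_measurable_continuous_on_indicator) auto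
  then have "(\<lambda>y. ennreal (indicator (snd c ` fst c) y *\<^sub>R sqrt (det (gram M c (chart_inv c y))))) \<in> borel_measurable borel"
    by (rule measurable_compose[OF _ measurable_ennreal])
  moreover have "(\<lambda>y. ennreal (indicator (snd c ` fst c) y *\<^sub>R sqrt (det (gram M c (chart_inv c y))))) = vol_density M c"
    by (auto simp: fun_eq_iff vol_density_def indicator_def)
  ultimately show ?thesis by (simp only:)
qed

lemma mem_chart_image_iff:
  assumes M: "smooth_manifold M" and c: "c \<in> atlas M"
  shows "y \<in> snd c ` (W \<inter> fst c) \<longleftrightarrow> y \<in> snd c ` fst c \<and> chart_inv c y \<in> W"
proof
  assume "y \<in> snd c ` (W \<inter> fst c)"
  then obtain z where "z \<in> W" "z \<in> fst c" "y = snd c z" by blast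
  then show "y \<in> snd c ` fst c \<and> chart_inv c y \<in> W" using chart_inv_inverse[OF M c] by simp
next
  assume y: "y \<in> snd c ` fst c \<and> chart_inv c y \<in> W"
  then have "chart_inv c y \<in> W \<inter> fst c" using chart_inv_into[OF M c] by blast
  moreover have "y = snd c (chart_inv c y)" using chart_inv_right[OF M c] y by simp
  ultimately show "y \<in> snd c ` (W \<inter> fst c)" by (rule rev_image_eqI)
qed

lemma chart_inv_total_measurable:
  assumes M: "smooth_manifold M" and c: "c \<in> atlas M" and ne: "pts M \<noteq> {}"
  shows "chart_inv_total M c \<in> borel \<rightarrow>\<^sub>M borel_sets M"
  unfolding borel_sets_def
proof (rule measurable_measure_of)
  let ?k = "chart_inv_total M c" and ?O = "snd c ` fst c"
  show "{U. openin (topo M) U} \<subseteq> Pow (pts M)" using openin_subset by blast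
  have z0: "(SOME z. z \<in> pts M) \<in> pts M" using ne some_in_eq by blast
  have sub: "fst c \<subseteq> pts M" using openin_subset[OF chart_open(1)[OF M c]] .
  show "?k \<in> space borel \<rightarrow> pts M"
  proof
    fix y
    show "?k y \<in> pts M"
      using z0 chart_inv_into[OF M c, of y] subsetD[OF sub] by (simp add: chart_inv_total_def)
  qed
  fix U assume "U \<in> {U. openin (topo M) U}"
  then have U: "openin (topo M) U" by simp
  have "y \<in> ?k -` U \<longleftrightarrow> y \<in> snd c ` (fst c \<inter> U) \<union> (if (SOME z. z \<in> pts M) \<in> U then - ?O else {})" for y
    using mem_chart_image_iff[OF M c, of y U] by (simp add: chart_inv_total_def Int_commute)
  then have "?k -` U = snd c ` (fst c \<inter> U) \<union> (if (SOME z. z \<in> pts M) \<in> U then - ?O else {})"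
    by blast
  moreover have "snd c ` (fst c \<inter> U) \<in> sets borel" using chart_image_open[OF M c U] by simp
  moreover have "- ?O \<in> sets borel" using chart_open(2)[OF M c] by (auto simp: borel_comp)
  ultimately show "?k -` U \<inter> space borel \<in> sets borel" by auto
qed

lemma chart_image_borel:
  assumes M: "smooth_manifold M" and c: "c \<in> atlas M" and E: "E \<in> sets (borel_sets M)"
  shows "snd c ` (E \<inter> fst c) \<in> sets borel"
proof (cases "pts M = {}")
  case True
  then have "E = {}" using sets.sets_into_space[OF E] by simp
  then show ?thesis by simp
next
  case False
  have "chart_inv_total M c -` E \<inter> space borel \<in> sets borel"
    by (rule measurable_sets[OF chart_inv_total_measurable[OF M c False] E])
  then have "(chart_inv_total M c -` E) \<inter> snd c ` fst c \<in> sets borel"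
    using chart_open(2)[OF M c] by auto
  also have "(chart_inv_total M c -` E) \<inter> snd c ` fst c = snd c ` (E \<inter> fst c)"
    using mem_chart_image_iff[OF M c, of _ E] by (auto simp: chart_inv_total_def set_eq_iff)
  finally show ?thesis .
qed

lemma nn_integral_chart_volume:
  assumes M: "riemannian_manifold M" and c: "c \<in> atlas M" and ne: "pts M \<noteq> {}"
    and h: "h \<in> borel_measurable (borel_sets M)"
  shows "(\<integral>\<^sup>+ z. h z \<partial>chart_volume M c) = (\<integral>\<^sup>+ y. vol_density M c y * h (chart_inv c y) \<partial>lborel)"
proof -
  note k = chart_inv_total_measurable[OF riemannian_smooth[OF M] c ne]
  have hk: "(\<lambda>y. h (chart_inv_total M c y)) \<in> borel_measurable borel"
    using measurable_compose[OF k h] .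
  have "(\<integral>\<^sup>+ z. h z \<partial>chart_volume M c) = (\<integral>\<^sup>+ y. h (chart_inv_total M c y) \<partial>density lborel (vol_density M c))"
    unfolding chart_volume_def using k h by (intro nn_integral_distr) auto
  also have "\<dots> = (\<integral>\<^sup>+ y. vol_density M c y * h (chart_inv_total M c y) \<partial>lborel)"
    using vol_density_measurable[OF M c] hk by (intro nn_integral_density) auto
  also have "\<dots> = (\<integral>\<^sup>+ y. vol_density M c y * h (chart_inv c y) \<partial>lborel)"
    by (intro nn_integral_cong) (auto simp: vol_density_def chart_inv_total_def indicator_def)
  finally show ?thesis .
qed

lemma emeasure_chart_volume:
  assumes M: "riemannian_manifold M" and c: "c \<in> atlas M" and E: "E \<in> sets (borel_sets M)"
    and ne: "pts M \<noteq> {}"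
  shows "emeasure (chart_volume M c) E =
    (\<integral>\<^sup>+ y \<in> snd c ` (E \<inter> fst c). ennreal (sqrt (det (gram M c (chart_inv c y)))) \<partial>lborel)"
proof -
  have "emeasure (chart_volume M c) E = (\<integral>\<^sup>+ z. indicator E z \<partial>chart_volume M c)"
    using E by (subst nn_integral_indicator) (auto simp: chart_volume_def)
  also have "\<dots> = (\<integral>\<^sup>+ y. vol_density M c y * indicator E (chart_inv c y) \<partial>lborel)"
    by (rule nn_integral_chart_volume[OF M c ne]) (rule borel_measurable_indicator[OF E])
  also have "\<dots> = (\<integral>\<^sup>+ y \<in> snd c ` (E \<inter> fst c). ennreal (sqrt (det (gram M c (chart_inv c y)))) \<partial>lborel)"
  proof (rule nn_integral_cong)
    fix y
    have "y \<in> snd c ` (E \<inter> fst c) \<longleftrightarrow> y \<in> snd c ` fst c \<and> chart_inv c y \<in> E"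
      by (rule mem_chart_image_iff[OF riemannian_smooth[OF M] c])
    then show "vol_density M c y * indicator E (chart_inv c y) =
      ennreal (sqrt (det (gram M c (chart_inv c y)))) * indicator (snd c ` (E \<inter> fst c)) y"
      by (auto simp: vol_density_def indicator_def)
  qed
  finally show ?thesis .
qed

text \<open>By the tensor law, the density changes by the Jacobian determinant of the transition map, as the
  change of variables formula requires.\<close>

lemma chart_volume_agree:
  assumes M: "riemannian_manifold M" and c: "c \<in> atlas M" and c': "c' \<in> atlas M"
    and E: "E \<in> sets (borel_sets M)" "E \<subseteq> fst c" "E \<subseteq> fst c'"
  shows "(\<integral>\<^sup>+ y \<in> snd c ` E. ennreal (sqrt (det (gram M c (chart_inv c y)))) \<partial>lborel) =
         (\<integral>\<^sup>+ y \<in> snd c' ` E. ennreal (sqrt (det (gram M c' (chart_inv c' y)))) \<partial>lborel)"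
proof -
  note SM = riemannian_smooth[OF M]
  let ?d = "\<lambda>c y. sqrt (det (gram M c (chart_inv c y)))"
  define S where "S = snd c ` E"
  define \<tau> where "\<tau> = snd c' \<circ> chart_inv c"
  (* The embedding into ennreal sends negative numbers to 0, hence the maximum. *)
  define h where "h y = max 0 (?d c' y)" for y
  have SB: "S \<in> sets borel" "snd c' ` E \<in> sets borel"
    using chart_image_borel[OF SM c E(1)] chart_image_borel[OF SM c' E(1)] E by (auto simp: S_def Int_absorb2)
  have \<tau>S: "\<tau> ` S = snd c' ` E" using chart_inv_inverse[OF SM c] E(2) by (force simp: S_def \<tau>_def image_image)
  let ?O = "snd c ` (fst c \<inter> fst c')"
  have sm: "smooth_on ?O \<tau>" using SM c c' by (simp add: smooth_manifold_def \<tau>_def)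
  have SO: "S \<subseteq> ?O" using E by (auto simp: S_def)
  let ?J = "\<lambda>y. frechet_derivative \<tau> (at y)"
  have der: "(\<tau> has_derivative ?J y) (at y within S)" if "y \<in> S" for y
    using smooth_on_imp_C1(3)[OF sm] SO that has_derivative_at_withinI by blast
  have inj: "inj_on \<tau> S"
  proof (rule inj_onI)
    fix x y assume xy: "x \<in> S" "y \<in> S" "\<tau> x = \<tau> y"
    then obtain a b where ab: "a \<in> E" "b \<in> E" "x = snd c a" "y = snd c b" by (auto simp: S_def)
    then have "a \<in> fst c" "b \<in> fst c" using E by auto
    then have "snd c' a = snd c' b" using xy(3) chart_inv_inverse[OF SM c] ab by (simp add: \<tau>_def)
    then have "a = b" using chart_inv_inverse[OF SM c'] ab E by (metis subsetD)
    then show "x = y" using ab by simp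
  qed
  have trans: "\<bar>det (matrix (?J y))\<bar> * h (\<tau> y) = max 0 (?d c y)" if y: "y \<in> S" for y
  proof -
    obtain a where a: "a \<in> E" "y = snd c a" using y by (auto simp: S_def)
    then have a1: "a \<in> fst c" "a \<in> fst c'" using E by blast+
    then have a': "a \<in> fst c" "a \<in> fst c'" "chart_inv c y = a" "chart_inv c' (\<tau> y) = a"
      using a chart_inv_inverse[OF SM c] chart_inv_inverse[OF SM c'] by (simp_all add: \<tau>_def)
    have "let J = jacobian (snd c' \<circ> chart_inv c) (at (snd c a))
        in gram M c a = transpose J ** gram M c' a ** J"
      using M c c' a' unfolding riemannian_manifold_def by blast
    then have "gram M c a = transpose (matrix (?J y)) ** gram M c' a ** matrix (?J y)"
      by (simp add: Let_def jacobian_def \<tau>_def a(2))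
    then have "det (gram M c a) = (det (matrix (?J y)))\<^sup>2 * det (gram M c' a)"
      by (simp add: det_mul det_transpose power2_eq_square)
    then have "?d c y = \<bar>det (matrix (?J y))\<bar> * ?d c' (\<tau> y)"
      by (simp add: a' real_sqrt_mult)
    then show ?thesis by (simp add: h_def max_mult_distrib_left)
  qed
  have hm: "(\<lambda>y. indicator (\<tau> ` S) y * h y) \<in> borel_measurable borel"
    "(\<lambda>y. indicator S y * max 0 (?d c y)) \<in> borel_measurable borel"
  proof -
    have *: "(\<lambda>y. indicator T y * max 0 (?d c y)) \<in> borel_measurable borel"
      if "c \<in> atlas M" "T \<subseteq> snd c ` fst c" "T \<in> sets borel" for c T
    proof -
      have "(\<lambda>y. indicator T y * enn2real (vol_density M c y)) \<in> borel_measurable borel"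
        using vol_density_measurable[OF M that(1)] that(3) by measurable
      moreover have "indicator T y * enn2real (vol_density M c y) = indicator T y * max 0 (?d c y)" for y
        using that(2) by (auto simp: vol_density_def indicator_def max_def ennreal_neg)
      ultimately show ?thesis by simp
    qed
    show "(\<lambda>y. indicator (\<tau> ` S) y * h y) \<in> borel_measurable borel"
      unfolding h_def \<tau>S using *[OF c' _ SB(2)] E by blast
    show "(\<lambda>y. indicator S y * max 0 (?d c y)) \<in> borel_measurable borel"
      using *[OF c _ SB(1)] E by (auto simp: S_def)
  qed
  have eq: "indicator S y * (\<bar>det (matrix (?J y))\<bar> * h (\<tau> y)) = indicator S y * max 0 (?d c y)" for y
    using trans by (auto simp: indicator_def)
  have "(\<integral>\<^sup>+ y. ennreal (indicator (\<tau> ` S) y * h y) \<partial>lborel) =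
         (\<integral>\<^sup>+ x. ennreal (indicator S x * (\<bar>det (matrix (?J x))\<bar> * h (\<tau> x))) \<partial>lborel)"
    by (rule nn_integral_change_of_variables[OF SB(1) der inj _ hm(1)])
      (use hm(2) in \<open>simp_all only: eq\<close>, simp add: h_def)
  then have "(\<integral>\<^sup>+ y. ennreal (indicator (snd c' ` E) y * max 0 (?d c' y)) \<partial>lborel) =
         (\<integral>\<^sup>+ y. ennreal (indicator (snd c ` E) y * max 0 (?d c y)) \<partial>lborel)"
    unfolding eq \<tau>S by (simp add: h_def S_def)
  moreover have "ennreal (indicator T y * max 0 (?d c y)) = ennreal (?d c y) * indicator T y" for c T y
    by (auto simp: indicator_def max_def ennreal_neg)
  ultimately show ?thesis by simp
qed

text \<open>The condition whose definite description is the volume of \<open>M\<close>.\<close>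

definition is_volume :: "('a, 'n::finite) riem_data \<Rightarrow> 'a measure \<Rightarrow> bool" where
  "is_volume M \<mu> \<longleftrightarrow> space \<mu> = pts M \<and>
     sets \<mu> = sigma_sets (pts M) {U. openin (topo M) U} \<and>
     (\<forall>c\<in>atlas M. \<forall>E\<in>sets \<mu>. E \<subseteq> fst c \<longrightarrow>
        emeasure \<mu> E =
          (\<integral>\<^sup>+ y \<in> snd c ` E. ennreal (sqrt (det (gram M c (chart_inv c y)))) \<partial>lborel))"

lemma countable_chart_cover:
  assumes M: "smooth_manifold M" and ne: "pts M \<noteq> {}"
  obtains c :: "nat \<Rightarrow> ('a, 'n::finite) chart" where "\<And>i. c i \<in> atlas M" "(\<Union>i. fst (c i)) = pts M"
proof -
  have "Lindelof_space (topo M)" using M second_countable_imp_Lindelof_space by (auto simp: smooth_manifold_def)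
  moreover have "\<forall>U\<in>fst ` atlas M. openin (topo M) U" "\<Union> (fst ` atlas M) = pts M"
    using M chart_open(1)[OF M] by (auto simp: smooth_manifold_def)
  ultimately obtain \<V> where V: "countable \<V>" "\<V> \<subseteq> fst ` atlas M" "\<Union> \<V> = pts M"
    unfolding Lindelof_space_def by meson
  then have Vne: "\<V> \<noteq> {}" using ne by (metis Union_empty)
  have "\<exists>c. c \<in> atlas M \<and> fst c = from_nat_into \<V> i" for i
  proof -
    have "from_nat_into \<V> i \<in> fst ` atlas M" using from_nat_into[OF Vne, of i] V(2) by blast
    then show ?thesis by (metis imageE)
  qed
  then obtain c where c: "\<And>i. c i \<in> atlas M" "\<And>i. fst (c i) = from_nat_into \<V> i" by metis
  have "(\<Union>i. fst (c i)) = \<Union> (range (from_nat_into \<V>))" using c(2) by auto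
  also have "\<dots> = pts M" using range_from_nat_into[OF Vne V(1)] V(3) by simp
  finally show ?thesis using c(1) that by blast
qed

lemma emeasure_disjointed:
  assumes S: "\<And>i::nat. S i \<in> sets \<mu>" and cover: "(\<Union>i. S i) = space \<mu>" and E: "E \<in> sets \<mu>"
  shows "emeasure \<mu> E = (\<Sum>i. emeasure \<mu> (E \<inter> disjointed S i))"
proof -
  have "range (\<lambda>i. E \<inter> disjointed S i) \<subseteq> sets \<mu>"
    using sets.range_disjointed_sets[of S \<mu>] S E by auto
  moreover have "disjoint_family (\<lambda>i. E \<inter> disjointed S i)"
    using disjoint_family_disjointed[of S] by (auto simp: disjoint_family_on_def)
  ultimately have "(\<Sum>i. emeasure \<mu> (E \<inter> disjointed S i)) = emeasure \<mu> (\<Union>i. E \<inter> disjointed S i)"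
    by (rule suminf_emeasure)
  also have "(\<Union>i. E \<inter> disjointed S i) = E"
    using UN_disjointed_eq[of S] cover sets.sets_into_space[OF E] by auto
  finally show ?thesis by simp
qed

lemma volume_unique:
  assumes M: "smooth_manifold M" and ne: "pts M \<noteq> {}"
    and \<mu>: "is_volume M \<mu>" and \<nu>: "is_volume M \<nu>"
  shows "\<mu> = \<nu>"
proof (rule measure_eqI)
  show s: "sets \<mu> = sets \<nu>" using \<mu> \<nu> by (simp add: is_volume_def)
  fix E assume E: "E \<in> sets \<mu>"
  obtain c :: "nat \<Rightarrow> ('a, 'b) chart" where c: "\<And>i. c i \<in> atlas M" "(\<Union>i. fst (c i)) = pts M"
    using countable_chart_cover[OF M ne] by blast
  let ?S = "\<lambda>i. fst (c i)"
  have S: "?S i \<in> sets \<mu>" "?S i \<in> sets \<nu>" for i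
    using chart_open(1)[OF M c(1)] openin_borel_sets[of M] \<mu> \<nu> by (auto simp: is_volume_def sets_borel_sets)
  have sp: "(\<Union>i. ?S i) = space \<mu>" "(\<Union>i. ?S i) = space \<nu>" using c(2) \<mu> \<nu> by (auto simp: is_volume_def)
  have "emeasure \<mu> (E \<inter> disjointed ?S i) = emeasure \<nu> (E \<inter> disjointed ?S i)" for i
  proof -
    have "E \<inter> disjointed ?S i \<in> sets \<mu>" using E sets.range_disjointed_sets[of ?S \<mu>] S by auto
    moreover have "E \<inter> disjointed ?S i \<subseteq> fst (c i)" using disjointed_subset[of ?S i] by auto
    ultimately show ?thesis using \<mu> \<nu> c(1)[of i] s by (simp add: is_volume_def)
  qed
  then show "emeasure \<mu> E = emeasure \<nu> E"
    using emeasure_disjointed[OF S(1) sp(1) E] emeasure_disjointed[OF S(2) sp(2)] E s by simp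
qed

text \<open>A countable family of chart domains is made disjoint, and the chart measures are restricted to
  the resulting pieces and added up.\<close>

lemma volume_exists:
  assumes M: "riemannian_manifold M" and ne: "pts M \<noteq> {}"
  shows "\<exists>\<mu>. is_volume M \<mu>"
proof -
  note SM = riemannian_smooth[OF M]
  let ?B = "borel_sets M"
  let ?\<nu> = "chart_volume M"
  obtain c :: "nat \<Rightarrow> ('a, 'b) chart" where c: "\<And>i. c i \<in> atlas M" "(\<Union>i. fst (c i)) = pts M"
    using countable_chart_cover[OF SM ne] by blast
  define D where "D = disjointed (\<lambda>i. fst (c i))"
  have D: "D i \<in> sets ?B" "D i \<subseteq> fst (c i)" for i
  proof -
    have "range (\<lambda>i. fst (c i)) \<subseteq> sets ?B" using chart_open(1)[OF SM c(1)] openin_borel_sets by blast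
    then show "D i \<in> sets ?B" using sets.range_disjointed_sets[of "\<lambda>i. fst (c i)" ?B] unfolding D_def by blast
    show "D i \<subseteq> fst (c i)" unfolding D_def by (rule disjointed_subset)
  qed
  define m where "m E = (\<integral>\<^sup>+ i. emeasure (?\<nu> (c i)) (E \<inter> D i) \<partial>count_space UNIV)" for E
  have s\<nu>: "sets (?\<nu> c') = sets ?B" for c' by (simp add: chart_volume_def)
  define \<mu> where "\<mu> = measure_of (space ?B) (sets ?B) m"
  have em: "emeasure \<mu> E = m E" if "E \<in> sets ?B" for E
    unfolding \<mu>_def
  proof (rule emeasure_measure_of_sigma[OF sets.sigma_algebra_axioms _ _ that])
    show "positive (sets ?B) m" by (simp add: positive_def m_def)
    show "countably_additive (sets ?B) m"
      unfolding countably_additive_def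
    proof (intro allI impI)
      fix A :: "nat \<Rightarrow> 'a set" assume A: "range A \<subseteq> sets ?B" "disjoint_family A" "\<Union> (range A) \<in> sets ?B"
      have "(\<Sum>j. m (A j)) = (\<integral>\<^sup>+ i. (\<Sum>j. emeasure (?\<nu> (c i)) (A j \<inter> D i)) \<partial>count_space UNIV)"
        unfolding m_def by (rule nn_integral_suminf[symmetric]) simp
      also have "\<dots> = m (\<Union> (range A))"
        unfolding m_def
      proof (rule nn_integral_cong)
        fix i
        have "range (\<lambda>j. A j \<inter> D i) \<subseteq> sets (?\<nu> (c i))" using A(1) D(1) s\<nu> by blast
        moreover have "disjoint_family (\<lambda>j. A j \<inter> D i)" using A(2) by (auto simp: disjoint_family_on_def)
        ultimately have "(\<Sum>j. emeasure (?\<nu> (c i)) (A j \<inter> D i)) = emeasure (?\<nu> (c i)) (\<Union>j. A j \<inter> D i)"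
          by (rule suminf_emeasure)
        then show "(\<Sum>j. emeasure (?\<nu> (c i)) (A j \<inter> D i)) = emeasure (?\<nu> (c i)) (\<Union> (range A) \<inter> D i)"
          by simp
      qed
      finally show "(\<Sum>j. m (A j)) = m (\<Union> (range A))" .
    qed
  qed
  have s\<mu>: "sets \<mu> = sets ?B" unfolding \<mu>_def by (rule sets.sets_measure_of_eq)
  have sp: "space \<mu> = pts M" unfolding \<mu>_def using sets.space_measure_of_eq[of ?B m] by simp
  have "emeasure \<mu> E = (\<integral>\<^sup>+ y \<in> snd k ` E. ennreal (sqrt (det (gram M k (chart_inv k y)))) \<partial>lborel)"
    if k: "k \<in> atlas M" and E: "E \<in> sets ?B" "E \<subseteq> fst k" for k E
  proof -
    have ED: "E \<inter> D i \<in> sets ?B" for i using E(1) D(1) by blast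
    have "emeasure \<mu> E = (\<Sum>i. emeasure (?\<nu> (c i)) (E \<inter> D i))"
      unfolding em[OF E(1)] m_def by (rule nn_integral_count_space_nat)
    also have "\<dots> = (\<Sum>i. emeasure (?\<nu> k) (E \<inter> D i))"
    proof (rule suminf_cong)
      fix i
      have 1: "E \<inter> D i \<subseteq> fst (c i)" "E \<inter> D i \<subseteq> fst k" using D(2) E(2) by blast+
      then show "emeasure (?\<nu> (c i)) (E \<inter> D i) = emeasure (?\<nu> k) (E \<inter> D i)"
        unfolding emeasure_chart_volume[OF M c(1) ED ne] emeasure_chart_volume[OF M k ED ne]
        using chart_volume_agree[OF M c(1) k ED 1] by (simp add: Int_absorb2)
    qed
    also have "\<dots> = emeasure (?\<nu> k) E"
    proof -
      have "fst (c i) \<in> sets (?\<nu> k)" for i using chart_open(1)[OF SM c(1)] openin_borel_sets s\<nu> by blast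
      moreover have "(\<Union>i. fst (c i)) = space (?\<nu> k)" using c(2) by (simp add: chart_volume_def)
      moreover have "E \<in> sets (?\<nu> k)" using E(1) s\<nu> by blast
      ultimately show ?thesis unfolding D_def by (rule emeasure_disjointed[symmetric])
    qed
    also have "\<dots> = (\<integral>\<^sup>+ y \<in> snd k ` E. ennreal (sqrt (det (gram M k (chart_inv k y)))) \<partial>lborel)"
      using emeasure_chart_volume[OF M k E(1) ne] E(2) by (simp add: Int_absorb2)
    finally show ?thesis .
  qed
  then have "is_volume M \<mu>" unfolding is_volume_def sets_borel_sets[symmetric] using s\<mu> sp by simp
  then show ?thesis by blast
qed

lemma is_volume_volume:
  assumes M: "riemannian_manifold M" and ne: "pts M \<noteq> {}"
  shows "is_volume M (volume M)"
proof -
  have "\<exists>!\<mu>. is_volume M \<mu>"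
    using volume_exists[OF M ne] volume_unique[OF riemannian_smooth[OF M] ne] by blast
  then have "is_volume M (THE \<mu>. is_volume M \<mu>)" by (rule theI')
  then show ?thesis unfolding volume_def is_volume_def .
qed

text \<open>The defining formula for sets says that the volume and the chart measure coincide on the Borel
  subsets of the chart domain; so they have the same integrals there.\<close>

lemma nn_integral_volume_chart:
  assumes M: "riemannian_manifold M" and ne: "pts M \<noteq> {}" and c: "c \<in> atlas M"
    and E: "E \<in> sets (borel_sets M)" "E \<subseteq> fst c" and h: "h \<in> borel_measurable (borel_sets M)"
  shows "(\<integral>\<^sup>+ z. h z * indicator E z \<partial>volume M) =
     (\<integral>\<^sup>+ y. vol_density M c y * (h (chart_inv c y) * indicator E (chart_inv c y)) \<partial>lborel)"
proof -
  note V = is_volume_volume[OF M ne]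
  let ?V = "volume M"
  have sV: "sets ?V = sets (borel_sets M)" "space ?V = pts M" using V by (auto simp: is_volume_def sets_borel_sets)
  have hV: "h \<in> borel_measurable ?V" using h measurable_cong_sets[OF sV(1) refl] by blast
  have EV: "E \<in> sets ?V" using E sV by simp
  have fm: "emeasure ?V T = (\<integral>\<^sup>+ y \<in> snd c ` T. ennreal (sqrt (det (gram M c (chart_inv c y)))) \<partial>lborel)"
    if "T \<in> sets ?V" "T \<subseteq> fst c" for T
    using V c that unfolding is_volume_def by blast
  have "density ?V (indicator E) = density (chart_volume M c) (indicator E)"
  proof (rule measure_eqI)
    show "sets (density ?V (indicator E)) = sets (density (chart_volume M c) (indicator E))"
      using sV by (simp add: chart_volume_def)
    fix A assume "A \<in> sets (density ?V (indicator E))"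
    then have A: "A \<in> sets ?V" by simp
    have A': "A \<in> sets (chart_volume M c)" "E \<in> sets (chart_volume M c)"
      using A E sV by (auto simp: chart_volume_def)
    have EA: "E \<inter> A \<in> sets (borel_sets M)" using E(1) A sV by blast
    have "emeasure (density ?V (indicator E)) A = emeasure ?V (E \<inter> A)"
      using A EV by (simp add: emeasure_density indicator_inter_arith[symmetric])
    also have "\<dots> = (\<integral>\<^sup>+ y \<in> snd c ` (E \<inter> A). ennreal (sqrt (det (gram M c (chart_inv c y)))) \<partial>lborel)"
      by (rule fm) (use EA E(2) sV in blast)+
    also have "\<dots> = emeasure (chart_volume M c) (E \<inter> A)"
      using emeasure_chart_volume[OF M c EA ne] E(2) by (simp add: Int_absorb2 le_infI1)
    also have "\<dots> = emeasure (density (chart_volume M c) (indicator E)) A"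
      using A' by (simp add: emeasure_density indicator_inter_arith[symmetric])
    finally show "emeasure (density ?V (indicator E)) A = emeasure (density (chart_volume M c) (indicator E)) A" .
  qed
  then have "(\<integral>\<^sup>+ z. h z \<partial>density ?V (indicator E)) = (\<integral>\<^sup>+ z. h z \<partial>density (chart_volume M c) (indicator E))"
    by simp
  then have "(\<integral>\<^sup>+ z. indicator E z * h z \<partial>?V) = (\<integral>\<^sup>+ z. indicator E z * h z \<partial>chart_volume M c)"
    using EV E h hV by (simp add: nn_integral_density chart_volume_def)
  also have "\<dots> = (\<integral>\<^sup>+ y. vol_density M c y * (indicator E (chart_inv c y) * h (chart_inv c y)) \<partial>lborel)"
    by (rule nn_integral_chart_volume[OF M c ne]) (use E h in measurable)
  finally show ?thesis by (simp add: mult.commute)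
qed


section \<open>Conformal invariance of the energy\<close>

text \<open>Take determinants in \<open>transpose A ** A = k\<^sup>2 G\<close>.\<close>

lemma conformal_det:
  fixes A :: "real^'n::finite \<Rightarrow> real^'n" and G :: "real^'n^'n"
  assumes A: "linear A" and k: "k > 0" and conf: "\<And>v w. A v \<bullet> A w = k\<^sup>2 * (v \<bullet> (G *v w))"
  shows "\<bar>det (matrix A)\<bar> = k ^ CARD('n) * sqrt (det G)" "det G \<ge> 0"
proof -
  let ?m = "matrix A"
  have "(transpose ?m ** ?m) $ i $ j = (\<chi> i. k\<^sup>2 *s G $ i) $ i $ j" for i j
  proof -
    have "(transpose ?m ** ?m) $ i $ j = A (axis i 1) \<bullet> A (axis j 1)"
      by (simp add: matrix_matrix_mult_def transpose_def matrix_def inner_vec_def)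
    also have "\<dots> = k\<^sup>2 * (G *v axis j 1) $ i" unfolding conf by (simp add: inner_axis' )
    also have "(G *v axis j 1) $ i = G $ i $ j"
      by (simp add: matrix_vector_mul_component inner_axis)
    finally show ?thesis by simp
  qed
  then have eq: "transpose ?m ** ?m = (\<chi> i. k\<^sup>2 *s G $ i)" by (simp add: vec_eq_iff)
  have "(det ?m)\<^sup>2 = det (transpose ?m ** ?m)" by (simp add: det_mul det_transpose power2_eq_square)
  also have "\<dots> = (k\<^sup>2) ^ CARD('n) * det G"
    unfolding eq by (subst det_rows_mul) simp
  finally have d: "(det ?m)\<^sup>2 = (k ^ CARD('n))\<^sup>2 * det G" by (simp add: power_mult[symmetric] mult.commute)
  then have "sqrt ((det ?m)\<^sup>2) = sqrt ((k ^ CARD('n))\<^sup>2 * det G)" by simp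
  then show "\<bar>det ?m\<bar> = k ^ CARD('n) * sqrt (det G)" using k by (simp add: real_sqrt_mult)
  have "0 \<le> (k ^ CARD('n))\<^sup>2 * det G" using d by (metis zero_le_power2)
  moreover have "(k ^ CARD('n))\<^sup>2 > 0" using k by simp
  ultimately show "det G \<ge> 0" using zero_le_mult_iff[of "(k ^ CARD('n))\<^sup>2" "det G"] by linarith
qed

lemma continuous_map_borel_sets:
  fixes k :: "'a \<Rightarrow> 'b::topological_space"
  assumes U: "openin (topo M) U" and k: "continuous_map (subtopology (topo M) U) euclidean k"
  shows "k \<in> borel_measurable (restrict_space (borel_sets M) U)"
proof (rule borel_measurableI)
  fix S :: "'b set" assume S: "open S"
  have UM: "U \<subseteq> pts M" using openin_subset[OF U] .
  have "openin (subtopology (topo M) U) {z \<in> topspace (subtopology (topo M) U). k z \<in> S}"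
    using k S by (intro openin_continuous_map_preimage[of _ euclidean]) auto
  then have "openin (topo M) {z \<in> topspace (subtopology (topo M) U). k z \<in> S}"
    using openin_trans_full U by blast
  moreover have "topspace (subtopology (topo M) U) = U" using UM by auto
  ultimately have "openin (topo M) {z \<in> U. k z \<in> S}" by (simp only:)
  then have "{z \<in> U. k z \<in> S} \<in> sets (borel_sets M)" by (rule openin_borel_sets)
  moreover have "k -` S \<inter> space (restrict_space (borel_sets M) U) = U \<inter> {z \<in> U. k z \<in> S}"
    using UM by (auto simp: space_restrict_space)
  ultimately show "k -` S \<inter> space (restrict_space (borel_sets M) U) \<in> sets (restrict_space (borel_sets M) U)"
    unfolding sets_restrict_space by blast
qed

text \<open>On the image of the section, the integrands match by \<open>section_gradient\<close> and \<open>conformal_det\<close>: the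
  factor \<open>\<kappa>\<close> to the power \<open>n\<close> in the gradient cancels the one in the volume. The image is cut
  into pieces inside single charts, and \<open>f\<close> is used as change of variables on each piece.\<close>

lemma section_energy_le:
  fixes M :: "('a, 'n::finite) riem_data"
  assumes M: "riemannian_manifold M" and cc: "conformal_coord M U f \<kappa> B"
    and E: "open E" and F: "is_section (subtopology (topo M) U) f E F"
    and meas: "(\<lambda>w. indicator E w *\<^sub>R Du w) \<in> borel_measurable borel"
    and Du: "\<And>w. w \<in> E \<Longrightarrow> norm (Du w) = g (F w) / \<kappa> (F w)"
  shows "(\<integral>\<^sup>+ w. indicator E w * ennreal (norm (Du w) ^ CARD('n)) \<partial>lborel)
     \<le> (\<integral>\<^sup>+ z \<in> pts M. ennreal (g z powr real CARD('n)) \<partial>volume M)"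
proof (cases "E = {}")
  case True then show ?thesis by simp
next
  case False
  note SM = riemannian_smooth[OF M]
  note U = conformal_coordD(1)[OF cc]
  let ?n = "CARD('n)" and ?B = "borel_sets M"
  have tU: "topspace (subtopology (topo M) U) = U" and UM: "U \<subseteq> pts M" using openin_subset[OF U] by auto
  have FU: "F w \<in> U" "f (F w) = w" if "w \<in> E" for w using is_sectionD[OF F that] tU by auto
  have ne: "pts M \<noteq> {}" using False FU(1) UM by blast
  have lh: "local_homeo (subtopology (topo M) U) f" by (rule conformal_coord_local_homeo[OF M cc])
  define A where "A = F ` E"
  have A: "openin (topo M) A" "A \<subseteq> U"
    unfolding A_def using openin_trans_full[OF section_open_image[OF lh E F] U] FU by auto
  have \<kappa>: "\<kappa> z > 0" if "z \<in> U" for z using conformal_coordD(3)[OF cc that] .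
  define D where "D w = indicator E w *\<^sub>R Du w" for w
  have Dm[measurable]: "D \<in> borel_measurable borel" using meas by (simp add: D_def[abs_def])
  define h where "h z = ennreal ((\<kappa> z * norm (D (f z))) ^ ?n) * indicator A z" for z
  have hm: "h \<in> borel_measurable ?B"
  proof -
    have [measurable]: "f \<in> borel_measurable (restrict_space ?B A)" "\<kappa> \<in> borel_measurable (restrict_space ?B A)"
      using continuous_map_borel_sets[OF A(1)] continuous_map_from_subtopology_mono[OF _ A(2)]
        local_homeo_continuous[OF lh] conformal_coordD(2)[OF cc] by blast+
    have "(\<lambda>z. ennreal ((\<kappa> z * norm (D (f z))) ^ ?n)) \<in> borel_measurable (restrict_space ?B A)" by measurable
    moreover have "A \<inter> space ?B \<in> sets ?B" using A UM openin_borel_sets[OF A(1)] by (simp add: Int_absorb2)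
    ultimately show ?thesis unfolding h_def
      by (subst (asm) borel_measurable_restrict_space_iff_ennreal) auto
  qed
  have hF: "h (F w) = ennreal ((\<kappa> (F w)) ^ ?n) * ennreal (norm (Du w) ^ ?n)" if "w \<in> E" for w
    using FU[OF that] \<kappa>[OF FU(1)[OF that]] that
    by (simp add: h_def A_def D_def power_mult_distrib ennreal_mult)
  have hle: "h z \<le> ennreal (g z powr real ?n) * indicator (pts M) z" for z
  proof (cases "z \<in> A")
    case True
    then obtain w where w: "w \<in> E" "z = F w" by (auto simp: A_def)
    have kw: "\<kappa> z > 0" using \<kappa> FU(1) w by simp
    have "\<kappa> z * norm (D (f z)) = g z" using Du[OF w(1)] FU[OF w(1)] w kw by (simp add: D_def)
    moreover have "g z \<ge> 0"
    proof -
      have "0 \<le> g z / \<kappa> z" using Du[OF w(1)] w(2) norm_ge_zero[of "Du w"] by simp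
      then show ?thesis using kw by (simp add: zero_le_divide_iff)
    qed
    ultimately have "h z = ennreal (g z ^ ?n)" "g z ^ ?n = g z powr real ?n"
      using True by (auto simp: h_def powr_realpow')
    moreover have "z \<in> pts M" using True A UM by blast
    ultimately show ?thesis by simp
  qed (simp add: h_def)
  obtain c :: "nat \<Rightarrow> ('a, 'n) chart" where c: "\<And>i. c i \<in> atlas M" "(\<Union>i. fst (c i)) = pts M"
    using countable_chart_cover[OF SM ne] by blast
  define P where "P i = A \<inter> disjointed (\<lambda>i. fst (c i)) i" for i
  define Q where "Q = disjointed (\<lambda>i. {w\<in>E. F w \<in> fst (c i)})"
  have PB: "P i \<in> sets ?B" for i
  proof -
    have "range (\<lambda>i. fst (c i)) \<subseteq> sets ?B" using chart_open(1)[OF SM c(1)] openin_borel_sets by blast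
    then have "disjointed (\<lambda>i. fst (c i)) i \<in> sets ?B"
      using sets.range_disjointed_sets[of "\<lambda>i. fst (c i)" ?B] by blast
    then show ?thesis unfolding P_def using openin_borel_sets[OF A(1)] by blast
  qed
  have Pc: "P i \<subseteq> fst (c i)" for i unfolding P_def using disjointed_subset[of "\<lambda>i. fst (c i)" i] by blast
  have Psum: "indicator A z = (\<Sum>i. indicator (P i) z :: ennreal)" for z
  proof -
    have "disjoint_family P" unfolding P_def
      using disjoint_family_disjointed[of "\<lambda>i. fst (c i)"] by (auto simp: disjoint_family_on_def)
    moreover have "(\<Union>i. P i) = A"
      unfolding P_def using UN_disjointed_eq[of "\<lambda>i. fst (c i)"] c(2) A(2) UM by auto
    ultimately show ?thesis using suminf_indicator[of P z] by simp
  qed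
  have oQ: "open {w\<in>E. F w \<in> fst (c i)}" for i
  proof -
    have "openin (subtopology (topo M) U) (fst (c i) \<inter> U)"
      using chart_open(1)[OF SM c(1)] openin_subtopology by blast
    then have "open {w\<in>E. F w \<in> fst (c i) \<inter> U}" by (rule is_section_open_vimage[OF F E])
    also have "{w\<in>E. F w \<in> fst (c i) \<inter> U} = {w\<in>E. F w \<in> fst (c i)}" using FU(1) by auto
    finally show ?thesis .
  qed
  have QB: "Q i \<in> sets borel" for i
  proof -
    have "range (\<lambda>i. {w\<in>E. F w \<in> fst (c i)}) \<subseteq> sets borel" using oQ by auto
    then show ?thesis
      using sets.range_disjointed_sets[of "\<lambda>i. {w\<in>E. F w \<in> fst (c i)}" borel] unfolding Q_def by blast
  qed
  have QP: "w \<in> Q i \<longleftrightarrow> w \<in> E \<and> F w \<in> P i" for w i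
    unfolding Q_def P_def disjointed_def A_def by auto
  have Qsum: "indicator E w = (\<Sum>i. indicator (Q i) w :: ennreal)" for w
  proof -
    have "\<exists>i. F v \<in> fst (c i)" if "v \<in> E" for v using FU(1)[OF that] UM c(2) by blast
    then have "(\<Union>i. Q i) = E" unfolding Q_def UN_disjointed_eq by auto
    moreover have "disjoint_family Q" unfolding Q_def by (rule disjoint_family_disjointed)
    ultimately show ?thesis using suminf_indicator[of Q w] by simp
  qed
  have piece: "(\<integral>\<^sup>+ z. h z * indicator (P i) z \<partial>volume M) =
      (\<integral>\<^sup>+ w. ennreal (norm (D w) ^ ?n) * indicator (Q i) w \<partial>lborel)" for i
  proof -
    let ?c = "c i"
    define S where "S = snd ?c ` P i"
    define fc where "fc = f \<circ> chart_inv ?c"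
    have PU: "P i \<subseteq> U" using A(2) by (auto simp: P_def)
    have SB: "S \<in> sets borel"
      using chart_image_borel[OF SM c(1) PB, of i i] Pc by (simp add: S_def Int_absorb2)
    have Sz: "chart_inv ?c y \<in> P i" "chart_inv ?c y \<in> fst ?c" "snd ?c (chart_inv ?c y) = y" if y: "y \<in> S" for y
    proof -
      obtain z where z: "z \<in> P i" "y = snd ?c z" using y by (auto simp: S_def)
      then have "z \<in> fst ?c" using Pc by blast
      then show "chart_inv ?c y \<in> P i" "chart_inv ?c y \<in> fst ?c" "snd ?c (chart_inv ?c y) = y"
        using z chart_inv_inverse[OF SM c(1)[of i]] by auto
    qed
    have PF: "F (f z) = z" "f z \<in> E" if "z \<in> P i" for z using that FU(2) by (auto simp: P_def A_def)
    have fcS: "fc ` S = Q i"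
    proof (intro equalityI subsetI)
      fix w assume "w \<in> fc ` S"
      then obtain y where y: "y \<in> S" "w = f (chart_inv ?c y)" by (auto simp: fc_def)
      then show "w \<in> Q i" using PF[OF Sz(1)[OF y(1)]] Sz(1)[OF y(1)] QP by simp
    next
      fix w assume w: "w \<in> Q i"
      then have w': "w \<in> E" "F w \<in> P i" using QP by auto
      then have "F w \<in> fst ?c" using Pc by blast
      then have "fc (snd ?c (F w)) = w" using chart_inv_inverse[OF SM c(1)[of i]] FU(2) w' by (simp add: fc_def)
      moreover have "snd ?c (F w) \<in> S" using w' by (simp add: S_def)
      ultimately show "w \<in> fc ` S" by (metis imageI)
    qed
    have der: "(fc has_derivative B ?c y) (at y within S)" if "y \<in> S" for y
    proof -
      have "chart_inv ?c y \<in> U" using Sz(1)[OF that] PU by blast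
      then have "(fc has_derivative B ?c (snd ?c (chart_inv ?c y))) (at (snd ?c (chart_inv ?c y)))"
        unfolding fc_def using conformal_coordD(4)[OF cc c(1) Sz(2)[OF that]] by simp
      then show ?thesis using Sz(3)[OF that] has_derivative_at_withinI by simp
    qed
    (* On the piece, F is a left inverse of f. *)
    have inj: "inj_on fc S"
      by (rule inj_onI) (metis PF(1) Sz(1) Sz(3) comp_apply fc_def)
    let ?r = "\<lambda>y. \<bar>det (matrix (B ?c y))\<bar> * norm (D (fc y)) ^ ?n"
    have dens: "vol_density M ?c y * (h (chart_inv ?c y) * indicator (P i) (chart_inv ?c y)) = ennreal (indicator S y * ?r y)" for y
    proof (cases "y \<in> S")
      case True
      define z where "z = chart_inv ?c y"
      have z: "z \<in> P i" "z \<in> fst ?c" "snd ?c z = y" "z \<in> U" "z \<in> A"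
        using Sz[OF True] PU by (auto simp: z_def P_def)
      have yO: "y \<in> snd ?c ` fst ?c" using z by blast
      have cd: "\<bar>det (matrix (B ?c y))\<bar> = \<kappa> z ^ ?n * sqrt (det (gram M ?c z))" "det (gram M ?c z) \<ge> 0"
        using conformal_det[OF conformal_coord_inj(1)[OF M cc c(1) z(2,4)] \<kappa>[OF z(4)] conformal_coordD(5)[OF cc c(1) z(2,4)]]
        z(3) by auto
      have "vol_density M ?c y * (h z * indicator (P i) z) = ennreal (sqrt (det (gram M ?c z))) * ennreal ((\<kappa> z * norm (D (f z))) ^ ?n)"
        using yO z by (simp add: vol_density_def h_def z_def[symmetric])
      also have "\<dots> = ennreal (sqrt (det (gram M ?c z)) * (\<kappa> z * norm (D (f z))) ^ ?n)"
        using cd(2) \<kappa>[OF z(4)] by (simp add: ennreal_mult)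
      also have "sqrt (det (gram M ?c z)) * (\<kappa> z * norm (D (f z))) ^ ?n = ?r y"
        unfolding cd(1) by (simp add: fc_def z_def power_mult_distrib)
      finally show ?thesis using True by (simp add: z_def)
    next
      case False
      then have "vol_density M ?c y = 0 \<or> chart_inv ?c y \<notin> P i"
        using mem_chart_image_iff[OF SM c(1)[of i], of y "P i"] Pc by (auto simp: vol_density_def S_def Int_absorb2)
      then show ?thesis using False by auto
    qed
    have m2: "(\<lambda>y. indicator S y * ?r y) \<in> borel_measurable borel"
    proof -
      let ?e = "\<lambda>y. vol_density M ?c y * (h (chart_inv_total M ?c y) * indicator (P i) (chart_inv_total M ?c y))"
      note k = chart_inv_total_measurable[OF SM c(1)[of i] ne]
      have "?e \<in> borel_measurable borel"
        using vol_density_measurable[OF M c(1)[of i]] measurable_compose[OF k hm]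
          measurable_compose[OF k borel_measurable_indicator[OF PB]] by measurable
      moreover have "?e y = ennreal (indicator S y * ?r y)" for y
        unfolding dens[symmetric] by (auto simp: vol_density_def chart_inv_total_def)
      ultimately have "(\<lambda>y. ennreal (indicator S y * ?r y)) \<in> borel_measurable borel" by simp
      then have "(\<lambda>y. enn2real (ennreal (indicator S y * ?r y))) \<in> borel_measurable borel" by measurable
      then show ?thesis by simp
    qed
    have m1: "(\<lambda>w. indicator (fc ` S) w * norm (D w) ^ ?n) \<in> borel_measurable borel"
      unfolding fcS using QB[of i] by measurable
    have "(\<integral>\<^sup>+ z. h z * indicator (P i) z \<partial>volume M) = (\<integral>\<^sup>+ y. ennreal (indicator S y * ?r y) \<partial>lborel)"
      unfolding nn_integral_volume_chart[OF M ne c(1) PB Pc hm] dens ..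
    also have "\<dots> = (\<integral>\<^sup>+ w. ennreal (indicator (fc ` S) w * norm (D w) ^ ?n) \<partial>lborel)"
      by (rule nn_integral_change_of_variables[OF SB der inj _ m1 m2, symmetric]) simp_all
    also have "\<dots> = (\<integral>\<^sup>+ w. ennreal (norm (D w) ^ ?n) * indicator (Q i) w \<partial>lborel)"
      unfolding fcS by (intro nn_integral_cong) (auto simp: indicator_def)
    finally show ?thesis .
  qed
  have sV: "sets (volume M) = sets ?B"
    using is_volume_volume[OF M ne] by (auto simp: is_volume_def sets_borel_sets)
  have hV: "h \<in> borel_measurable (volume M)" using hm measurable_cong_sets[OF sV refl] by blast
  have "(\<integral>\<^sup>+ w. indicator E w * ennreal (norm (Du w) ^ ?n) \<partial>lborel) =
      (\<integral>\<^sup>+ w. (\<Sum>i. ennreal (norm (D w) ^ ?n) * indicator (Q i) w) \<partial>lborel)"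
  proof (rule nn_integral_cong)
    fix w
    have "(\<Sum>i. ennreal (norm (D w) ^ ?n) * indicator (Q i) w) = ennreal (norm (D w) ^ ?n) * indicator E w"
      unfolding Qsum by (rule ennreal_suminf_cmult)
    then show "indicator E w * ennreal (norm (Du w) ^ ?n) = (\<Sum>i. ennreal (norm (D w) ^ ?n) * indicator (Q i) w)"
      by (simp add: D_def indicator_def)
  qed
  also have "\<dots> = (\<Sum>i. (\<integral>\<^sup>+ w. ennreal (norm (D w) ^ ?n) * indicator (Q i) w \<partial>lborel))"
  proof (rule nn_integral_suminf)
    fix i
    have [measurable]: "Q i \<in> sets borel" by (rule QB)
    show "(\<lambda>w. ennreal (norm (D w) ^ ?n) * indicator (Q i) w) \<in> borel_measurable lborel" by measurable
  qed
  also have "\<dots> = (\<Sum>i. (\<integral>\<^sup>+ z. h z * indicator (P i) z \<partial>volume M))" by (simp add: piece)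
  also have "\<dots> = (\<integral>\<^sup>+ z. (\<Sum>i. h z * indicator (P i) z) \<partial>volume M)"
  proof (rule nn_integral_suminf[symmetric])
    show "(\<lambda>z. h z * indicator (P i) z) \<in> borel_measurable (volume M)" for i
      using hV PB sV by (intro borel_measurable_times_ennreal borel_measurable_indicator) auto
  qed
  also have "\<dots> = (\<integral>\<^sup>+ z. h z \<partial>volume M)"
  proof (rule nn_integral_cong)
    fix z
    have "(\<Sum>i. h z * indicator (P i) z) = h z * indicator A z" unfolding Psum by (rule ennreal_suminf_cmult)
    then show "(\<Sum>i. h z * indicator (P i) z) = h z" by (simp add: h_def indicator_def)
  qed
  also have "\<dots> \<le> (\<integral>\<^sup>+ z \<in> pts M. ennreal (g z powr real ?n) \<partial>volume M)"
    by (intro nn_integral_mono hle)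
  finally show ?thesis .
qed

text \<open>Stereographic projection is conformal only on vectors tangent to the sphere; the differential of
  \<open>\<Phi>\<close> has such values because \<open>\<Phi> \<bullet> \<Phi>\<close> is constant.\<close>

lemma conformal_coord_stereo:
  fixes M :: "('a, 'n::finite) riem_data" and \<Phi> :: "'a \<Rightarrow> real^'m::finite"
  assumes M: "riemannian_manifold M" and sph: "\<And>z. z \<in> pts M \<Longrightarrow> norm (\<Phi> z) = 1"
    and \<Phi>: "smooth_fun M (pts M) \<Phi>" and u: "smooth_fun M (pts M) u"
    and conf: "\<And>c z v w. c \<in> atlas M \<Longrightarrow> z \<in> fst c \<Longrightarrow>
        chart_differential c \<Phi> z v \<bullet> chart_differential c \<Phi> z w = exp (2 * u z) * (v \<bullet> (gram M c z *v w))"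
    and T: "equatorial T N"
  shows "conformal_coord M {z \<in> pts M. \<Phi> z \<noteq> N} (stereo T N \<circ> \<Phi>) (\<lambda>z. exp (u z) / (1 - \<Phi> z \<bullet> N))
     (\<lambda>c y v. stereo_deriv T N (\<Phi> (chart_inv c y)) (frechet_derivative (\<Phi> \<circ> chart_inv c) (at y) v))"
proof -
  note SM = riemannian_smooth[OF M]
  have N: "norm N = 1" and lT: "linear T" using T by (auto simp: equatorial_def)
  let ?U = "{z \<in> pts M. \<Phi> z \<noteq> N}"
  have U: "openin (topo M) ?U"
  proof -
    have "openin (topo M) {z \<in> pts M. \<Phi> z \<in> - {N}}"
      by (rule openin_continuous_map_preimage[OF smooth_fun_continuous[OF SM \<Phi>]]) (simp add: open_Compl)
    then show ?thesis by simp
  qed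
  have less: "\<Phi> z \<bullet> N < 1" if "z \<in> ?U" for z using inner_unit_less_one[OF sph N] that by auto
  have chartM: "fst c \<subseteq> pts M" if "c \<in> atlas M" for c using openin_subset[OF chart_open(1)[OF SM that]] .
  have sm: "smooth_on (snd c ` fst c) (\<Phi> \<circ> chart_inv c)" "smooth_on (snd c ` fst c) (u \<circ> chart_inv c)" if "c \<in> atlas M" for c
    using \<Phi> u that chartM[OF that] by (auto simp: smooth_fun_def Int_absorb2)
  have cU: "chart_inv c y \<in> ?U" "y \<in> snd c ` fst c" if "c \<in> atlas M" "y \<in> snd c ` (fst c \<inter> ?U)" for c y
    using that chart_inv_inverse[OF SM that(1)] by auto
  have cont: "continuous_on (snd c ` (fst c \<inter> ?U)) (\<lambda>y. \<Phi> (chart_inv c y))"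
     "continuous_on (snd c ` (fst c \<inter> ?U)) (\<lambda>y. u (chart_inv c y))" if c: "c \<in> atlas M" for c
    using smooth_on_imp_C1(4)[OF sm(1)[OF c]] smooth_on_imp_C1(4)[OF sm(2)[OF c]]
    by (auto simp: o_def intro: continuous_on_subset)
  have \<kappa>: "continuous_map (subtopology (topo M) ?U) euclideanreal (\<lambda>z. exp (u z) / (1 - \<Phi> z \<bullet> N))"
  proof (rule continuous_map_in_charts[OF SM U])
    fix c assume c: "c \<in> atlas M"
    have "1 - \<Phi> (chart_inv c y) \<bullet> N \<noteq> 0" if "y \<in> snd c ` (fst c \<inter> ?U)" for y
      using less[OF cU(1)[OF c that]] by simp
    then show "continuous_on (snd c ` (fst c \<inter> ?U)) ((\<lambda>z. exp (u z) / (1 - \<Phi> z \<bullet> N)) \<circ> chart_inv c)"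
      unfolding o_def by (intro continuous_intros cont[OF c]) auto
  qed
  have pos: "exp (u z) / (1 - \<Phi> z \<bullet> N) > 0" if "z \<in> ?U" for z using less[OF that] by simp
  let ?A = "\<lambda>c y. frechet_derivative (\<Phi> \<circ> chart_inv c) (at y)"
  let ?B = "\<lambda>c y v. stereo_deriv T N (\<Phi> (chart_inv c y)) (?A c y v)"
  have dA: "((\<Phi> \<circ> chart_inv c) has_derivative ?A c (snd c z)) (at (snd c z))" if "c \<in> atlas M" "z \<in> fst c" for c z
    by (rule smooth_on_imp_C1(3)[OF sm(1)[OF that(1)]]) (use that in auto)
  have tangent: "?A c (snd c z) v \<bullet> \<Phi> z = 0" if c: "c \<in> atlas M" and z: "z \<in> fst c" for c z v
  proof -
    let ?y = "snd c z"
    have "((\<lambda>y. (\<Phi> \<circ> chart_inv c) y \<bullet> (\<Phi> \<circ> chart_inv c) y) has_derivative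
        (\<lambda>v. (\<Phi> \<circ> chart_inv c) ?y \<bullet> ?A c ?y v + ?A c ?y v \<bullet> (\<Phi> \<circ> chart_inv c) ?y)) (at ?y)"
      by (rule has_derivative_inner[OF dA[OF c z] dA[OF c z]])
    then have 1: "((\<lambda>y. (\<Phi> \<circ> chart_inv c) y \<bullet> (\<Phi> \<circ> chart_inv c) y) has_derivative (\<lambda>v. 2 * (?A c ?y v \<bullet> \<Phi> z))) (at ?y)"
      using chart_inv_inverse[OF SM c z] by (simp add: inner_commute)
    have "((\<lambda>y. 1 :: real) has_derivative (\<lambda>v. 0)) (at ?y)" by simp
    then have 2: "((\<lambda>y. (\<Phi> \<circ> chart_inv c) y \<bullet> (\<Phi> \<circ> chart_inv c) y) has_derivative (\<lambda>v. 0)) (at ?y)"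
    proof (rule has_derivative_transform_within_open[OF _ chart_open(2)[OF SM c]])
      show "?y \<in> snd c ` fst c" using z by blast
      fix y assume "y \<in> snd c ` fst c"
      then have "chart_inv c y \<in> pts M" using chart_inv_into[OF SM c] chartM[OF c] by blast
      then show "1 = (\<Phi> \<circ> chart_inv c) y \<bullet> (\<Phi> \<circ> chart_inv c) y" using sph by (simp add: dot_square_norm)
    qed
    have "(\<lambda>v. 2 * (?A c ?y v \<bullet> \<Phi> z)) = (\<lambda>v. 0)" by (rule has_derivative_unique[OF 1 2])
    then have "2 * (?A c ?y v \<bullet> \<Phi> z) = 0" by (rule fun_cong)
    then show ?thesis by simp
  qed
  have "((stereo T N \<circ> \<Phi> \<circ> chart_inv c) has_derivative ?B c (snd c z)) (at (snd c z))"
    "?B c (snd c z) v \<bullet> ?B c (snd c z) w = (exp (u z) / (1 - \<Phi> z \<bullet> N))\<^sup>2 * (v \<bullet> (gram M c z *v w))"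
    if c: "c \<in> atlas M" and z: "z \<in> fst c" "z \<in> ?U" for c z v w
  proof -
    have inv: "chart_inv c (snd c z) = z" using chart_inv_inverse[OF SM c z(1)] .
    have "\<Phi> z \<bullet> N \<noteq> 1" using less[OF z(2)] by simp
    then have "(stereo T N has_derivative stereo_deriv T N (\<Phi> z)) (at ((\<Phi> \<circ> chart_inv c) (snd c z)))"
      using has_derivative_stereo[OF T] inv by simp
    from has_derivative_compose[OF dA[OF c z(1)] this]
    show "((stereo T N \<circ> \<Phi> \<circ> chart_inv c) has_derivative ?B c (snd c z)) (at (snd c z))"
      by (simp add: o_def inv)
    have "?B c (snd c z) v \<bullet> ?B c (snd c z) w = (?A c (snd c z) v \<bullet> ?A c (snd c z) w) / (1 - \<Phi> z \<bullet> N)\<^sup>2"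
      unfolding inv by (rule stereo_deriv_conformal[OF T]) (use z sph tangent[OF c z(1)] in auto)
    also have "?A c (snd c z) v \<bullet> ?A c (snd c z) w = (exp (u z))\<^sup>2 * (v \<bullet> (gram M c z *v w))"
      using conf[OF c z(1), of v w] by (simp add: chart_differential_def exp_double)
    finally show "?B c (snd c z) v \<bullet> ?B c (snd c z) w = (exp (u z) / (1 - \<Phi> z \<bullet> N))\<^sup>2 * (v \<bullet> (gram M c z *v w))"
      by (simp only: power_divide times_divide_eq_left)
  qed
  moreover have "continuous_on (snd c ` (fst c \<inter> ?U)) (\<lambda>y. ?B c y v)" if c: "c \<in> atlas M" for c v
  proof -
    have bT: "bounded_linear T" using lT by (simp add: linear_linear)
    have "1 - \<Phi> (chart_inv c y) \<bullet> N \<noteq> 0" if "y \<in> snd c ` (fst c \<inter> ?U)" for y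
      using less[OF cU(1)[OF c that]] by simp
    moreover have "continuous_on (snd c ` (fst c \<inter> ?U)) (\<lambda>y. ?A c y v)"
      using smooth_on_imp_C1(2)[OF sm(1)[OF c]] by (rule continuous_on_subset) auto
    ultimately show ?thesis
      unfolding stereo_deriv_def
      by (intro continuous_intros cont[OF c] bounded_linear.continuous_on[OF bT]) auto
  qed
  ultimately show ?thesis
    unfolding conformal_coord_def using U \<kappa> pos by simp
qed


section \<open>Piecewise continuously differentiable curves\<close>

text \<open>The condition of \<open>piecewise_C1_differentiable_on\<close> on the open interval, with the end points
  counted among the exceptional ones. In this form it is stable under gluing and substitution.\<close>

definition piecewise_C1 :: "(real \<Rightarrow> 'b::euclidean_space) \<Rightarrow> real \<Rightarrow> real \<Rightarrow> bool" where
  "piecewise_C1 f a b \<longleftrightarrow> (\<exists>S. finite S \<and> (\<forall>t\<in>{a<..<b} - S. f differentiable at t) \<and>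
     continuous_on ({a<..<b} - S) (\<lambda>t. vector_derivative f (at t)))"

lemma piecewise_C1_iff:
  "f piecewise_C1_differentiable_on {a..b} \<longleftrightarrow> continuous_on {a..b} f \<and> piecewise_C1 f a b"
proof
  assume "f piecewise_C1_differentiable_on {a..b}"
  then obtain S where S: "continuous_on {a..b} f" "finite S" "f C1_differentiable_on {a..b} - S"
    unfolding piecewise_C1_differentiable_on_def by auto
  have sub: "{a<..<b} - S \<subseteq> {a..b} - S" by auto
  have "piecewise_C1 f a b"
    unfolding piecewise_C1_def
  proof (intro exI[of _ S] conjI ballI)
    show "f differentiable at t" if "t \<in> {a<..<b} - S" for t
      using S(3) sub that unfolding C1_differentiable_on_eq by blast
    show "continuous_on ({a<..<b} - S) (\<lambda>t. vector_derivative f (at t))"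
      using S(3) sub unfolding C1_differentiable_on_eq by (blast intro: continuous_on_subset)
  qed (rule S)
  then show "continuous_on {a..b} f \<and> piecewise_C1 f a b" using S by simp
next
  assume *: "continuous_on {a..b} f \<and> piecewise_C1 f a b"
  then obtain S where S: "finite S" "\<And>t. t \<in> {a<..<b} - S \<Longrightarrow> f differentiable at t"
     "continuous_on ({a<..<b} - S) (\<lambda>t. vector_derivative f (at t))"
    unfolding piecewise_C1_def by blast
  have "{a..b} - insert a (insert b S) = {a<..<b} - S - {a, b}" by auto
  also have "\<dots> = {a<..<b} - S" by auto
  finally have "f C1_differentiable_on {a..b} - insert a (insert b S)"
    unfolding C1_differentiable_on_eq using S by simp
  then show "f piecewise_C1_differentiable_on {a..b}"
    unfolding piecewise_C1_differentiable_on_def using * S(1)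
    by (intro conjI exI[of _ "insert a (insert b S)"]) auto
qed

lemma piecewise_C1_subinterval:
  assumes "piecewise_C1 f a b" "a \<le> a'" "b' \<le> b"
  shows "piecewise_C1 f a' b'"
proof -
  obtain S where S: "finite S" "\<And>t. t \<in> {a<..<b} - S \<Longrightarrow> f differentiable at t"
     "continuous_on ({a<..<b} - S) (\<lambda>t. vector_derivative f (at t))"
    using assms(1) unfolding piecewise_C1_def by blast
  have sub: "{a'<..<b'} - S \<subseteq> {a<..<b} - S" using assms by auto
  show ?thesis unfolding piecewise_C1_def
    using S(1) S(2)[OF subsetD[OF sub]] continuous_on_subset[OF S(3) sub] by blast
qed

lemma piecewise_C1_combine:
  assumes "piecewise_C1 f a b" "piecewise_C1 f b c"
  shows "piecewise_C1 f a c"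
proof -
  obtain S where S: "finite S" "\<And>t. t \<in> {a<..<b} - S \<Longrightarrow> f differentiable at t"
     "continuous_on ({a<..<b} - S) (\<lambda>t. vector_derivative f (at t))"
    using assms(1) unfolding piecewise_C1_def by blast
  obtain T where T: "finite T" "\<And>t. t \<in> {b<..<c} - T \<Longrightarrow> f differentiable at t"
     "continuous_on ({b<..<c} - T) (\<lambda>t. vector_derivative f (at t))"
    using assms(2) unfolding piecewise_C1_def by blast
  let ?R = "insert b (S \<union> T)"
  have sub: "{a<..<c} - ?R \<subseteq> ({a<..<b} - S) \<union> ({b<..<c} - T)" by auto
  have "open ({a<..<b} - S)" "open ({b<..<c} - T)"
    using S(1) T(1) by (auto intro: open_Diff finite_imp_closed)
  then have "continuous_on (({a<..<b} - S) \<union> ({b<..<c} - T)) (\<lambda>t. vector_derivative f (at t))"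
    using S(3) T(3) by (intro continuous_on_open_Un) auto
  then have "continuous_on ({a<..<c} - ?R) (\<lambda>t. vector_derivative f (at t))"
    using sub continuous_on_subset by blast
  moreover have "f differentiable at t" if "t \<in> {a<..<c} - ?R" for t
    using subsetD[OF sub that] S(2) T(2) by blast
  ultimately show ?thesis unfolding piecewise_C1_def using S(1) T(1) by (intro exI[of _ ?R]) auto
qed

lemma piecewise_C1_I:
  assumes "finite S" "\<And>t. t \<in> {a<..<b} - S \<Longrightarrow> (f has_vector_derivative D t) (at t)"
    "continuous_on ({a<..<b} - S) D"
  shows "piecewise_C1 f a b"
  unfolding piecewise_C1_def
proof (intro exI[of _ S] conjI ballI)
  show "f differentiable at t" if "t \<in> {a<..<b} - S" for t
    using assms(2)[OF that] differentiableI_vector by blast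
  show "continuous_on ({a<..<b} - S) (\<lambda>t. vector_derivative f (at t))"
    using assms(3) by (rule continuous_on_eq) (use assms(2) vector_derivative_at in \<open>metis\<close>)
qed (rule assms)

lemma piecewise_C1_D:
  assumes "piecewise_C1 f a b"
  obtains S where "finite S" "\<And>t. t \<in> {a<..<b} - S \<Longrightarrow> (f has_vector_derivative vector_derivative f (at t)) (at t)"
    "continuous_on ({a<..<b} - S) (\<lambda>t. vector_derivative f (at t))"
  using assms unfolding piecewise_C1_def vector_derivative_works by blast

lemma piecewise_C1_affine:
  assumes f: "piecewise_C1 f a' b'" and m: "m \<noteq> 0"
    and eq: "\<And>t. t \<in> {a<..<b} \<Longrightarrow> g t = f (m * t + c)"
    and into: "\<And>t. t \<in> {a<..<b} \<Longrightarrow> m * t + c \<in> {a'<..<b'}"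
  shows "piecewise_C1 g a b"
proof -
  obtain S where S: "finite S" "\<And>t. t \<in> {a'<..<b'} - S \<Longrightarrow> (f has_vector_derivative vector_derivative f (at t)) (at t)"
    "continuous_on ({a'<..<b'} - S) (\<lambda>t. vector_derivative f (at t))"
    by (rule piecewise_C1_D[OF f]) blast
  let ?\<sigma> = "\<lambda>t. m * t + c"
  let ?S = "?\<sigma> -` S"
  have inj: "inj ?\<sigma>" using m by (auto simp: inj_def)
  show ?thesis
  proof (rule piecewise_C1_I[where S="?S" and D="\<lambda>t. m *\<^sub>R vector_derivative f (at (m * t + c))"])
    show "finite ?S" using S(1) inj by (rule finite_vimageI)
    show "(g has_vector_derivative m *\<^sub>R vector_derivative f (at (m * t + c))) (at t)"
      if t: "t \<in> {a<..<b} - ?S" for t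
    proof -
      have "(?\<sigma> has_vector_derivative m) (at t)"
        by (auto intro!: derivative_eq_intros simp: has_vector_derivative_def)
      moreover have "(f has_vector_derivative vector_derivative f (at (m * t + c))) (at (m * t + c))"
        using S(2) into t by blast
      ultimately have "((f \<circ> ?\<sigma>) has_vector_derivative m *\<^sub>R vector_derivative f (at (m * t + c))) (at t)"
        by (rule vector_diff_chain_at)
      then show ?thesis
        by (rule has_vector_derivative_transform_within_open[OF _ open_greaterThanLessThan[of a b]])
          (use t eq in auto)
    qed
    have "continuous_on ({a<..<b} - ?S) (\<lambda>t. vector_derivative f (at (m * t + c)))"
      by (rule continuous_on_compose2[OF S(3)]) (use into in \<open>auto intro!: continuous_intros\<close>)
    then show "continuous_on ({a<..<b} - ?S) (\<lambda>t. m *\<^sub>R vector_derivative f (at (m * t + c)))"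
      by (intro continuous_intros)
  qed
qed

lemma frechet_derivative_expand:
  fixes g :: "'b::euclidean_space \<Rightarrow> 'c::euclidean_space"
  assumes "smooth_on T g" "y \<in> T"
  shows "frechet_derivative g (at y) v = (\<Sum>i\<in>Basis. (v \<bullet> i) *\<^sub>R frechet_derivative g (at y) i)"
proof -
  have l: "linear (frechet_derivative g (at y))"
    using smooth_on_imp_C1(3)[OF assms] has_derivative_linear by blast
  have "frechet_derivative g (at y) v = frechet_derivative g (at y) (\<Sum>i\<in>Basis. (v \<bullet> i) *\<^sub>R i)"
    by (simp add: euclidean_representation)
  also have "\<dots> = (\<Sum>i\<in>Basis. (v \<bullet> i) *\<^sub>R frechet_derivative g (at y) i)"
    by (simp add: linear_sum[OF l] linear_cmul[OF l])
  finally show ?thesis .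
qed

lemma continuous_on_frechet_derivative:
  fixes g :: "'b::euclidean_space \<Rightarrow> 'c::euclidean_space"
  assumes g: "smooth_on T g" and f: "continuous_on S f" "f ` S \<subseteq> T" and v: "continuous_on S v"
  shows "continuous_on S (\<lambda>t. frechet_derivative g (at (f t)) (v t))"
proof -
  have "continuous_on S (\<lambda>t. frechet_derivative g (at (f t)) i)" for i
    by (rule continuous_on_compose2[OF smooth_on_imp_C1(2)[OF g] f])
  then have "continuous_on S (\<lambda>t. \<Sum>i\<in>Basis. (v t \<bullet> i) *\<^sub>R frechet_derivative g (at (f t)) i)"
    by (intro continuous_intros v)
  then show ?thesis
  proof (rule continuous_on_eq)
    fix t assume "t \<in> S"
    then have "f t \<in> T" using f(2) by blast
    then show "(\<Sum>i\<in>Basis. (v t \<bullet> i) *\<^sub>R frechet_derivative g (at (f t)) i) = frechet_derivative g (at (f t)) (v t)"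
      by (rule frechet_derivative_expand[OF g, symmetric])
  qed
qed

lemma vector_derivative_smooth_compose:
  assumes g: "smooth_on T g" and t: "f t \<in> T" and f: "(f has_vector_derivative v) (at t)"
  shows "((g \<circ> f) has_vector_derivative frechet_derivative g (at (f t)) v) (at t)"
proof -
  have d: "(g has_derivative frechet_derivative g (at (f t))) (at (f t))" by (rule smooth_on_imp_C1(3)[OF g t])
  have "((\<lambda>x. g (f x)) has_derivative (\<lambda>h. frechet_derivative g (at (f t)) (h *\<^sub>R v))) (at t)"
    by (rule has_derivative_compose[OF f[unfolded has_vector_derivative_def] d])
  moreover have "frechet_derivative g (at (f t)) (h *\<^sub>R v) = h *\<^sub>R frechet_derivative g (at (f t)) v" for h
    using d has_derivative_linear linear_cmul by blast
  ultimately show ?thesis by (simp add: has_vector_derivative_def o_def)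
qed

lemma piecewise_C1_smooth_compose:
  assumes g: "smooth_on T g" and f: "piecewise_C1 f a b" "continuous_on {a<..<b} f" "f ` {a<..<b} \<subseteq> T"
    and eq: "\<And>t. t \<in> {a<..<b} \<Longrightarrow> h t = g (f t)"
  shows "piecewise_C1 h a b"
proof -
  obtain S where S: "finite S" "\<And>t. t \<in> {a<..<b} - S \<Longrightarrow> (f has_vector_derivative vector_derivative f (at t)) (at t)"
    "continuous_on ({a<..<b} - S) (\<lambda>t. vector_derivative f (at t))"
    by (rule piecewise_C1_D[OF f(1)]) blast
  show ?thesis
  proof (rule piecewise_C1_I[OF S(1), where D="\<lambda>t. frechet_derivative g (at (f t)) (vector_derivative f (at t))"])
    show "(h has_vector_derivative frechet_derivative g (at (f t)) (vector_derivative f (at t))) (at t)"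
      if t: "t \<in> {a<..<b} - S" for t
    proof -
      have "((g \<circ> f) has_vector_derivative frechet_derivative g (at (f t)) (vector_derivative f (at t))) (at t)"
        by (rule vector_derivative_smooth_compose[OF g _ S(2)[OF t]]) (use f(3) t in auto)
      then show ?thesis
        by (rule has_vector_derivative_transform_within_open[OF _ open_greaterThanLessThan[of a b]])
          (use t eq in auto)
    qed
    show "continuous_on ({a<..<b} - S) (\<lambda>t. frechet_derivative g (at (f t)) (vector_derivative f (at t)))"
      by (rule continuous_on_frechet_derivative[OF g _ _ S(3)])
        (use f in \<open>auto intro: continuous_on_subset\<close>)
  qed
qed

text \<open>Outside the exceptional points the derivative is continuous, hence measurable; if the length is
  finite, the increment is the integral of the derivative.\<close>

lemma increment_le_length:
  fixes h :: "real \<Rightarrow> 'b::euclidean_space"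
  assumes h: "piecewise_C1 h 0 b" "continuous_on {0..b} h" and b: "0 \<le> b"
  shows "ennreal (norm (h b - h 0)) \<le>
    (\<integral>\<^sup>+ t. indicator {0<..<b} t * ennreal (norm (vector_derivative h (at t))) \<partial>lborel)"
    (is "_ \<le> ?I")
proof -
  obtain S where S: "finite S" "\<And>t. t \<in> {0<..<b} - S \<Longrightarrow> (h has_vector_derivative vector_derivative h (at t)) (at t)"
    "continuous_on ({0<..<b} - S) (\<lambda>t. vector_derivative h (at t))"
    by (rule piecewise_C1_D[OF h(1)]) blast
  define k where "k t = indicator ({0<..<b} - S) t *\<^sub>R vector_derivative h (at t)" for t
  have km: "k \<in> borel_measurable borel"
    unfolding k_def using S(1,3)
    by (intro borel_measurable_continuous_on_indicator) (auto intro!: borel_open open_Diff finite_imp_closed)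
  have kI: "(\<integral>\<^sup>+ t. ennreal (norm (k t)) \<partial>lborel) \<le> ?I"
    by (intro nn_integral_mono) (auto simp: k_def indicator_def)
  show ?thesis
  proof (cases "?I = \<infinity>")
    case False
    then have int: "integrable lborel k"
      using km kI by (intro integrableI_bounded) (auto simp: less_top[symmetric] top_unique)
    have "(k has_integral (h b - h 0)) {0..b}"
      by (rule fundamental_theorem_of_calculus_interior_strong[OF S(1) b _ h(2)])
        (use S(2) in \<open>auto simp: k_def\<close>)
    then have "((\<lambda>t. if t \<in> {0..b} then k t else 0) has_integral (h b - h 0)) UNIV"
      by (simp only: has_integral_restrict_UNIV)
    moreover have "(\<lambda>t. if t \<in> {0..b} then k t else 0) = k" by (auto simp: k_def fun_eq_iff)
    ultimately have "(k has_integral (h b - h 0)) UNIV" by simp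
    moreover have "(k has_integral integral\<^sup>L lborel k) UNIV" using has_integral_integral_lborel[OF int] .
    ultimately have "h b - h 0 = integral\<^sup>L lborel k" by (rule has_integral_unique)
    then have "ennreal (norm (h b - h 0)) \<le> (\<integral>\<^sup>+ t. ennreal (norm (k t)) \<partial>lborel)"
      using integral_norm_bound_ennreal[OF int] by simp
    then show ?thesis using kI by simp
  qed simp
qed


section \<open>Lengths of curves\<close>

text \<open>A conformal immersion into the round sphere, with \<open>exp (2 * u)\<close> as conformal factor.\<close>

locale conformally_immersed =
  fixes M :: "('a, 'n::finite) riem_data" and \<Phi> :: "'a \<Rightarrow> real^'m::finite" and u :: "'a \<Rightarrow> real"
  assumes M: "riemannian_manifold M" and sph: "\<And>z. z \<in> pts M \<Longrightarrow> norm (\<Phi> z) = 1"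
    and \<Phi>: "smooth_fun M (pts M) \<Phi>" and u: "smooth_fun M (pts M) u"
    and conf: "\<And>c z v w. c \<in> atlas M \<Longrightarrow> z \<in> fst c \<Longrightarrow>
        chart_differential c \<Phi> z v \<bullet> chart_differential c \<Phi> z w = exp (2 * u z) * (v \<bullet> (gram M c z *v w))"
    and dim: "CARD('m) = CARD('n) + 1"
begin

lemmas SM = riemannian_smooth[OF M]

lemma chart_subset: "c \<in> atlas M \<Longrightarrow> fst c \<subseteq> pts M"
  using openin_subset[OF chart_open(1)[OF SM]] .

lemma smooth_in_chart:
  assumes "c \<in> atlas M"
  shows "smooth_on (snd c ` fst c) (\<Phi> \<circ> chart_inv c)" "smooth_on (snd c ` fst c) (u \<circ> chart_inv c)"
  using \<Phi> u assms chart_subset[OF assms] by (auto simp: smooth_fun_def Int_absorb2)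

text \<open>The Riemannian speed of a curve, measured in the ambient space of the sphere. It involves no
  chart, which makes lengths easy to compare.\<close>

definition speed :: "(real \<Rightarrow> 'a) \<Rightarrow> real \<Rightarrow> real" where
  "speed \<gamma> t = exp (- u (\<gamma> t)) * norm (vector_derivative (\<Phi> \<circ> \<gamma>) (at t))"

abbreviation curve :: "(real \<Rightarrow> 'a) \<Rightarrow> bool" where
  "curve \<gamma> \<equiv> continuous_map (top_of_set {0..1}) (topo M) \<gamma>"

definition differentiable_curve_at :: "(real \<Rightarrow> 'a) \<Rightarrow> real \<Rightarrow> bool" where
  "differentiable_curve_at \<gamma> t \<longleftrightarrow> (\<exists>c\<in>atlas M. \<gamma> t \<in> fst c \<and> (snd c \<circ> \<gamma>) differentiable (at t))"

lemma curve_in_pts: "curve \<gamma> \<Longrightarrow> t \<in> {0..1} \<Longrightarrow> \<gamma> t \<in> pts M"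
  by (auto simp: continuous_map_def)

lemma curve_near:
  assumes \<gamma>: "curve \<gamma>" and W: "openin (topo M) W" and t: "t \<in> {0..1}" "\<gamma> t \<in> W"
  obtains T where "open T" "t \<in> T" "\<gamma> ` (T \<inter> {0..1}) \<subseteq> W"
proof -
  have "openin (top_of_set {0..1}) {s \<in> topspace (top_of_set {0..1}). \<gamma> s \<in> W}"
    by (rule openin_continuous_map_preimage[OF \<gamma> W])
  then obtain T where T: "open T" "{s \<in> {0..1}. \<gamma> s \<in> W} = {0..1} \<inter> T"
    by (auto simp: openin_open)
  then have "\<gamma> ` (T \<inter> {0..1}) \<subseteq> W" "t \<in> T" using t by blast+
  then show ?thesis using that T(1) by blast
qed

lemma curve_continuous:
  fixes g :: "'a \<Rightarrow> 'c::topological_space"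
  assumes "curve \<gamma>" "continuous_map (topo M) euclidean g"
  shows "continuous_on {0..1} (\<lambda>t. g (\<gamma> t))"
  using continuous_map_compose[OF assms] by (simp add: o_def)

text \<open>By the chain rule the derivative of \<open>\<Phi> \<circ> \<gamma>\<close> is the differential of \<open>\<Phi>\<close> in \<open>c'\<close> applied to
  the derivative of \<open>\<gamma>\<close> in \<open>c'\<close>, and the former is conformal.\<close>

lemma chart_speed:
  assumes \<gamma>: "curve \<gamma>" and t: "t \<in> {0<..<1}" and d: "differentiable_curve_at \<gamma> t"
  shows "(\<Phi> \<circ> \<gamma>) differentiable (at t)"
    and "c' \<in> atlas M \<Longrightarrow> \<gamma> t \<in> fst c' \<Longrightarrow>
      metric_norm M c' (\<gamma> t) (vector_derivative (snd c' \<circ> \<gamma>) (at t)) = speed \<gamma> t"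
proof -
  obtain c where c: "c \<in> atlas M" "\<gamma> t \<in> fst c" "(snd c \<circ> \<gamma>) differentiable (at t)"
    using d by (auto simp: differentiable_curve_at_def)
  have main: "\<exists>v. (snd c' \<circ> \<gamma> has_vector_derivative v) (at t) \<and>
      (\<Phi> \<circ> \<gamma> has_vector_derivative chart_differential c' \<Phi> (\<gamma> t) v) (at t)"
    if c': "c' \<in> atlas M" "\<gamma> t \<in> fst c'" for c'
  proof -
    have "openin (topo M) (fst c \<inter> fst c')" using chart_open(1)[OF SM] c(1) c'(1) by blast
    then obtain T0 where T0: "open T0" "t \<in> T0" "\<gamma> ` (T0 \<inter> {0..1}) \<subseteq> fst c \<inter> fst c'"
      using curve_near[OF \<gamma>, of "fst c \<inter> fst c'" t] t c(2) c'(2) by auto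
    define T where "T = T0 \<inter> {0<..<1}"
    have T: "open T" "t \<in> T" "\<And>s. s \<in> T \<Longrightarrow> \<gamma> s \<in> fst c \<and> \<gamma> s \<in> fst c'"
      using T0 t by (auto simp: T_def)
    obtain v0 where v0: "(snd c \<circ> \<gamma> has_vector_derivative v0) (at t)"
      using c(3) vector_derivative_works by blast
    let ?\<tau> = "snd c' \<circ> chart_inv c"
    have sm: "smooth_on (snd c ` (fst c \<inter> fst c')) ?\<tau>" using SM c(1) c'(1) by (simp add: smooth_manifold_def)
    define v where "v = frechet_derivative ?\<tau> (at ((snd c \<circ> \<gamma>) t)) v0"
    have "(?\<tau> \<circ> (snd c \<circ> \<gamma>) has_vector_derivative v) (at t)"
      unfolding v_def by (rule vector_derivative_smooth_compose[OF sm _ v0]) (use c(2) c'(2) in auto)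
    then have v: "(snd c' \<circ> \<gamma> has_vector_derivative v) (at t)"
      by (rule has_vector_derivative_transform_within_open[OF _ T(1,2)])
        (use T(3) chart_inv_inverse[OF SM c(1)] in auto)
    have "((\<Phi> \<circ> chart_inv c') \<circ> (snd c' \<circ> \<gamma>) has_vector_derivative
        frechet_derivative (\<Phi> \<circ> chart_inv c') (at ((snd c' \<circ> \<gamma>) t)) v) (at t)"
      by (rule vector_derivative_smooth_compose[OF smooth_in_chart(1)[OF c'(1)] _ v]) (use c'(2) in auto)
    then have "(\<Phi> \<circ> \<gamma> has_vector_derivative
        frechet_derivative (\<Phi> \<circ> chart_inv c') (at ((snd c' \<circ> \<gamma>) t)) v) (at t)"
      by (rule has_vector_derivative_transform_within_open[OF _ T(1,2)])
        (use T(3) chart_inv_inverse[OF SM c'(1)] in auto)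
    then show ?thesis using v by (auto simp: chart_differential_def)
  qed
  show "(\<Phi> \<circ> \<gamma>) differentiable (at t)" using main[OF c(1,2)] differentiableI_vector by blast
  show "metric_norm M c' (\<gamma> t) (vector_derivative (snd c' \<circ> \<gamma>) (at t)) = speed \<gamma> t"
    if c': "c' \<in> atlas M" "\<gamma> t \<in> fst c'"
  proof -
    obtain v where v: "(snd c' \<circ> \<gamma> has_vector_derivative v) (at t)"
      "(\<Phi> \<circ> \<gamma> has_vector_derivative chart_differential c' \<Phi> (\<gamma> t) v) (at t)"
      using main[OF c'] by blast
    let ?w = "chart_differential c' \<Phi> (\<gamma> t) v"
    have "norm ?w = sqrt (exp (2 * u (\<gamma> t)) * (v \<bullet> (gram M c' (\<gamma> t) *v v)))"
      using conf[OF c', of v v] by (simp add: norm_eq_sqrt_inner)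
    also have "\<dots> = exp (u (\<gamma> t)) * metric_norm M c' (\<gamma> t) v"
      by (simp add: real_sqrt_mult exp_double metric_norm_def)
    finally have "exp (- u (\<gamma> t)) * norm ?w = metric_norm M c' (\<gamma> t) v"
      by (simp add: exp_minus field_simps)
    then show ?thesis
      using vector_derivative_at[OF v(1)] vector_derivative_at[OF v(2)] by (simp add: speed_def)
  qed
qed

text \<open>By compactness a curve decomposes into finitely many pieces inside single charts.\<close>

lemma curve_regular:
  assumes \<gamma>: "piecewise_C1_curve M \<gamma>"
  shows "piecewise_C1 (\<Phi> \<circ> \<gamma>) 0 1"
    and "\<exists>S. finite S \<and> (\<forall>t\<in>{0<..<1} - S. differentiable_curve_at \<gamma> t)"
proof -
  have cont: "curve \<gamma>" using \<gamma> by (simp add: piecewise_C1_curve_def)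
  define P where "P a b \<longleftrightarrow> (0 \<le> a \<and> b \<le> 1 \<longrightarrow> piecewise_C1 (\<Phi> \<circ> \<gamma>) a b \<and>
     (\<exists>S. finite S \<and> (\<forall>t\<in>{a<..<b} - S. differentiable_curve_at \<gamma> t)))" for a b
  have "0 \<le> (1::real)" by simp
  then have "P 0 1"
  proof (induction rule: Bolzano)
    case (trans a b c)
    show ?case
      unfolding P_def
    proof (intro impI conjI)
      assume ac: "0 \<le> a \<and> c \<le> 1"
      then have Pab: "piecewise_C1 (\<Phi> \<circ> \<gamma>) a b" "\<exists>S. finite S \<and> (\<forall>t\<in>{a<..<b} - S. differentiable_curve_at \<gamma> t)"
        and Pbc: "piecewise_C1 (\<Phi> \<circ> \<gamma>) b c" "\<exists>S. finite S \<and> (\<forall>t\<in>{b<..<c} - S. differentiable_curve_at \<gamma> t)"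
        using trans by (auto simp: P_def)
      show "piecewise_C1 (\<Phi> \<circ> \<gamma>) a c" using piecewise_C1_combine[OF Pab(1) Pbc(1)] .
      obtain S T where S: "finite S" "\<forall>t\<in>{a<..<b} - S. differentiable_curve_at \<gamma> t"
        and T: "finite T" "\<forall>t\<in>{b<..<c} - T. differentiable_curve_at \<gamma> t"
        using Pab(2) Pbc(2) by blast
      have "differentiable_curve_at \<gamma> t" if "t \<in> {a<..<c} - insert b (S \<union> T)" for t
        using that S(2) T(2) by (cases "t < b") auto
      then show "\<exists>S. finite S \<and> (\<forall>t\<in>{a<..<c} - S. differentiable_curve_at \<gamma> t)"
        using S(1) T(1) by (intro exI[of _ "insert b (S \<union> T)"]) auto
    qed
  next
    case (local x)
    then have x: "x \<in> {0..1}" by simp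
    let ?c = "chart_at M (\<gamma> x)"
    have c: "?c \<in> atlas M" "\<gamma> x \<in> fst ?c" using chart_exists[OF SM curve_in_pts[OF cont x]] by auto
    obtain T where T: "open T" "x \<in> T" "\<gamma> ` (T \<inter> {0..1}) \<subseteq> fst ?c"
      using curve_near[OF cont chart_open(1)[OF SM c(1)] x c(2)] by blast
    obtain d where d: "d > 0" "ball x d \<subseteq> T" using T(1,2) open_contains_ball by metis
    have "P a b" if ab: "a \<le> x \<and> x \<le> b \<and> b - a < d" for a b
      unfolding P_def
    proof
      assume ab': "0 \<le> a \<and> b \<le> 1"
      have "{a..b} \<subseteq> T \<inter> {0..1}" using ab ab' d(2) by (auto simp: dist_real_def subset_eq)
      then have in_c: "\<gamma> ` {a..b} \<subseteq> fst ?c" using T(3) by blast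
      then have "(snd ?c \<circ> \<gamma>) piecewise_C1_differentiable_on {a..b}"
        using \<gamma> c(1) ab ab' unfolding piecewise_C1_curve_def by auto
      then have pc: "continuous_on {a..b} (snd ?c \<circ> \<gamma>)" "piecewise_C1 (snd ?c \<circ> \<gamma>) a b"
        by (auto simp: piecewise_C1_iff)
      have "piecewise_C1 (\<Phi> \<circ> \<gamma>) a b"
      proof (rule piecewise_C1_smooth_compose[OF smooth_in_chart(1)[OF c(1)] pc(2)])
        show "continuous_on {a<..<b} (snd ?c \<circ> \<gamma>)" using pc(1) by (rule continuous_on_subset) auto
        show "(snd ?c \<circ> \<gamma>) ` {a<..<b} \<subseteq> snd ?c ` fst ?c" using in_c by (auto intro!: imageI)
        show "(\<Phi> \<circ> \<gamma>) t = (\<Phi> \<circ> chart_inv ?c) ((snd ?c \<circ> \<gamma>) t)" if "t \<in> {a<..<b}" for t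
        proof -
          have "\<gamma> t \<in> fst ?c" using that in_c by (auto simp: subset_eq)
          then show ?thesis using chart_inv_inverse[OF SM c(1)] by simp
        qed
      qed
      moreover have "\<exists>S. finite S \<and> (\<forall>t\<in>{a<..<b} - S. differentiable_curve_at \<gamma> t)"
      proof -
        obtain S where S: "finite S" "\<forall>t\<in>{a<..<b} - S. (snd ?c \<circ> \<gamma>) differentiable at t"
          using pc(2) unfolding piecewise_C1_def by blast
        have "differentiable_curve_at \<gamma> t" if "t \<in> {a<..<b} - S" for t
          unfolding differentiable_curve_at_def using S(2) that c(1) in_c by (intro bexI[of _ ?c]) (auto simp: subset_eq)
        then show ?thesis using S(1) by blast
      qed
      ultimately show "piecewise_C1 (\<Phi> \<circ> \<gamma>) a b \<and> (\<exists>S. finite S \<and> (\<forall>t\<in>{a<..<b} - S. differentiable_curve_at \<gamma> t))" ..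
    qed
    then show ?case using d(1) by blast
  qed
  then show "piecewise_C1 (\<Phi> \<circ> \<gamma>) 0 1" "\<exists>S. finite S \<and> (\<forall>t\<in>{0<..<1} - S. differentiable_curve_at \<gamma> t)"
    by (auto simp: P_def)
qed

lemma AE_not_in_finite: "finite S \<Longrightarrow> AE t in lborel. t \<notin> (S :: real set)"
  using AE_not_in[OF finite_imp_null_set_lborel] by blast

lemma curve_length_eq:
  assumes \<gamma>: "piecewise_C1_curve M \<gamma>"
  shows "curve_length M \<gamma> = (\<integral>\<^sup>+ t. indicator {0<..<1} t * ennreal (speed \<gamma> t) \<partial>lborel)"
proof -
  have cont: "curve \<gamma>" using \<gamma> by (simp add: piecewise_C1_curve_def)
  obtain S where S: "finite S" "\<forall>t\<in>{0<..<1} - S. differentiable_curve_at \<gamma> t"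
    using curve_regular(2)[OF \<gamma>] by blast
  have "AE t in lborel. t \<notin> S \<union> {0, 1}" using S(1) by (intro AE_not_in_finite) auto
  then show ?thesis
    unfolding curve_length_def
  proof (intro nn_integral_cong_AE, eventually_elim)
    fix t assume t: "t \<notin> S \<union> {0, 1}"
    show "(let c = chart_at M (\<gamma> t) in ennreal (metric_norm M c (\<gamma> t) (vector_derivative (snd c \<circ> \<gamma>) (at t)))) * indicator {0..1} t
       = indicator {0<..<1} t * ennreal (speed \<gamma> t)"
    proof (cases "t \<in> {0<..<1}")
      case True
      then have "\<gamma> t \<in> pts M" by (intro curve_in_pts[OF cont]) auto
      then show ?thesis
        using chart_speed(2)[OF cont True _ chart_exists[OF SM]] S(2) t True by (simp add: Let_def)
    next
      case False
      then have "t \<notin> {0..1}" using t by auto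
      then show ?thesis using False by simp
    qed
  qed
qed

lemma speed_measurable:
  assumes \<gamma>: "piecewise_C1_curve M \<gamma>"
  obtains S where "finite S" "(\<lambda>t. indicator ({0<..<1} - S) t * speed \<gamma> t) \<in> borel_measurable borel"
    "\<And>t. t \<in> {0<..<1} - S \<Longrightarrow> (\<Phi> \<circ> \<gamma> has_vector_derivative vector_derivative (\<Phi> \<circ> \<gamma>) (at t)) (at t)"
proof -
  have cont: "curve \<gamma>" using \<gamma> by (simp add: piecewise_C1_curve_def)
  obtain S where S: "finite S"
    "\<And>t. t \<in> {0<..<1} - S \<Longrightarrow> (\<Phi> \<circ> \<gamma> has_vector_derivative vector_derivative (\<Phi> \<circ> \<gamma>) (at t)) (at t)"
    "continuous_on ({0<..<1} - S) (\<lambda>t. vector_derivative (\<Phi> \<circ> \<gamma>) (at t))"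
    by (rule piecewise_C1_D[OF curve_regular(1)[OF \<gamma>]]) blast
  have "continuous_on {0..1} (\<lambda>t. u (\<gamma> t))" by (rule curve_continuous[OF cont smooth_fun_continuous[OF SM u]])
  then have "continuous_on ({0<..<1} - S) (\<lambda>t. u (\<gamma> t))" by (rule continuous_on_subset) auto
  then have "continuous_on ({0<..<1} - S) (speed \<gamma>)"
    unfolding speed_def[abs_def] by (intro continuous_intros S(3))
  then have "(\<lambda>t. indicator ({0<..<1} - S) t *\<^sub>R speed \<gamma> t) \<in> borel_measurable borel"
    using S(1) by (intro borel_measurable_continuous_on_indicator) (auto intro!: borel_open open_Diff finite_imp_closed)
  then show ?thesis using that S(1,2) by simp
qed

text \<open>One substitution for both reversal and concatenation of curves.\<close>

lemma length_affine:
  assumes \<gamma>: "piecewise_C1_curve M \<gamma>" and m: "m \<noteq> 0"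
    and eq: "\<And>t. t \<in> {a<..<b} \<Longrightarrow> \<eta> t = \<gamma> (m * t + c)"
    and dom: "\<And>t. m * t + c \<in> {0<..<1} \<longleftrightarrow> t \<in> {a<..<b}"
  shows "(\<integral>\<^sup>+ t. indicator {a<..<b} t * ennreal (speed \<eta> t) \<partial>lborel) = curve_length M \<gamma>"
proof -
  obtain S where S: "finite S" "(\<lambda>t. indicator ({0<..<1} - S) t * speed \<gamma> t) \<in> borel_measurable borel"
    "\<And>t. t \<in> {0<..<1} - S \<Longrightarrow> (\<Phi> \<circ> \<gamma> has_vector_derivative vector_derivative (\<Phi> \<circ> \<gamma>) (at t)) (at t)"
    by (rule speed_measurable[OF \<gamma>]) blast
  let ?h = "\<lambda>t. ennreal (indicator ({0<..<1} - S) t * speed \<gamma> t)"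
  have hm: "?h \<in> borel_measurable borel" using S(2) by (rule measurable_compose[OF _ measurable_ennreal])
  have "curve_length M \<gamma> = (\<integral>\<^sup>+ t. ?h t \<partial>lborel)"
    unfolding curve_length_eq[OF \<gamma>]
    using AE_not_in_finite[OF S(1)]
    by (intro nn_integral_cong_AE, eventually_elim) (auto simp: indicator_def)
  also have "\<dots> = ennreal \<bar>m\<bar> * (\<integral>\<^sup>+ t. ?h (c + m * t) \<partial>lborel)"
    by (rule nn_integral_real_affine[OF hm m])
  also have "\<dots> = (\<integral>\<^sup>+ t. ennreal \<bar>m\<bar> * ?h (c + m * t) \<partial>lborel)"
    by (rule nn_integral_cmult[symmetric]) (use measurable_compose[OF _ hm, of "\<lambda>t. c + m * t" lborel] in simp)
  also have "\<dots> = (\<integral>\<^sup>+ t. indicator {a<..<b} t * ennreal (speed \<eta> t) \<partial>lborel)"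
  proof (rule nn_integral_cong_AE)
    have "finite ((\<lambda>t. m * t + c) -` S)" by (rule finite_vimageI[OF S(1)]) (use m in \<open>auto simp: inj_def\<close>)
    from AE_not_in_finite[OF this]
    show "AE t in lborel. ennreal \<bar>m\<bar> * ?h (c + m * t) = indicator {a<..<b} t * ennreal (speed \<eta> t)"
    proof eventually_elim
      fix t assume t: "t \<notin> (\<lambda>t. m * t + c) -` S"
      show "ennreal \<bar>m\<bar> * ?h (c + m * t) = indicator {a<..<b} t * ennreal (speed \<eta> t)"
      proof (cases "t \<in> {a<..<b}")
        case True
        then have in1: "m * t + c \<in> {0<..<1} - S" using t dom by auto
        have "((\<lambda>t. m * t + c) has_vector_derivative m) (at t)"
          by (auto intro!: derivative_eq_intros simp: has_vector_derivative_def)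
        from vector_diff_chain_at[OF this S(3)[OF in1]]
        have "((\<Phi> \<circ> \<gamma>) \<circ> (\<lambda>t. m * t + c) has_vector_derivative m *\<^sub>R vector_derivative (\<Phi> \<circ> \<gamma>) (at (m * t + c))) (at t)" .
        then have "(\<Phi> \<circ> \<eta> has_vector_derivative m *\<^sub>R vector_derivative (\<Phi> \<circ> \<gamma>) (at (m * t + c))) (at t)"
          by (rule has_vector_derivative_transform_within_open[OF _ open_greaterThanLessThan True]) (use eq in auto)
        then have "speed \<eta> t = \<bar>m\<bar> * speed \<gamma> (m * t + c)"
          using eq[OF True] by (simp add: speed_def vector_derivative_at)
        then show ?thesis using True in1 by (simp add: ennreal_mult add.commute speed_def)
      next
        case False
        then have "m * t + c \<notin> {0<..<1} - S" using dom by blast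
        then have "indicator ({0<..<1} - S) (c + m * t) = (0::real)" by (simp add: add.commute)
        then show ?thesis using False by simp
      qed
    qed
  qed
  finally show ?thesis by simp
qed

lemma piecewise_C1_curveI:
  assumes \<gamma>: "curve \<gamma>"
    and pc: "\<And>c a b. c \<in> atlas M \<Longrightarrow> 0 \<le> a \<Longrightarrow> a \<le> b \<Longrightarrow> b \<le> 1 \<Longrightarrow> \<gamma> ` {a..b} \<subseteq> fst c \<Longrightarrow>
       piecewise_C1 (snd c \<circ> \<gamma>) a b"
  shows "piecewise_C1_curve M \<gamma>"
  unfolding piecewise_C1_curve_def
proof (intro conjI ballI allI impI \<gamma>)
  fix c a b assume c: "c \<in> atlas M" and ab: "0 \<le> a \<and> a \<le> b \<and> b \<le> 1 \<and> \<gamma> ` {a..b} \<subseteq> fst c"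
  have "continuous_map (top_of_set {a..b}) (topo M) \<gamma>"
    using \<gamma> ab by (auto intro: continuous_map_from_subtopology_mono)
  then have "continuous_map (top_of_set {a..b}) (subtopology (topo M) (fst c)) \<gamma>"
    using ab by (auto simp: continuous_map_in_subtopology)
  then have "continuous_map (top_of_set {a..b}) euclidean (snd c \<circ> \<gamma>)"
    using chart_continuous[OF SM c] by (rule continuous_map_compose)
  then have "continuous_on {a..b} (snd c \<circ> \<gamma>)" by simp
  then show "(snd c \<circ> \<gamma>) piecewise_C1_differentiable_on {a..b}"
    using pc[OF c] ab by (simp add: piecewise_C1_iff)
qed

lemma piecewise_C1_curveD:
  assumes "piecewise_C1_curve M \<gamma>"
  shows "curve \<gamma>"
    and "c \<in> atlas M \<Longrightarrow> 0 \<le> a \<Longrightarrow> a \<le> b \<Longrightarrow> b \<le> 1 \<Longrightarrow> \<gamma> ` {a..b} \<subseteq> fst c \<Longrightarrow>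
       piecewise_C1 (snd c \<circ> \<gamma>) a b"
  using assms by (auto simp: piecewise_C1_curve_def piecewise_C1_iff)

lemma reverse_curve:
  assumes \<gamma>: "piecewise_C1_curve M \<gamma>"
  shows "piecewise_C1_curve M (\<lambda>t. \<gamma> (1 - t))" "curve_length M (\<lambda>t. \<gamma> (1 - t)) = curve_length M \<gamma>"
proof -
  note g = piecewise_C1_curveD[OF \<gamma>]
  show rev: "piecewise_C1_curve M (\<lambda>t. \<gamma> (1 - t))"
  proof (rule piecewise_C1_curveI)
    have "continuous_map (top_of_set {0..1}) (top_of_set {0..1}) (\<lambda>t::real. 1 - t)"
      by (auto intro!: continuous_intros)
    from continuous_map_compose[OF this g(1)] show "curve (\<lambda>t. \<gamma> (1 - t))" by (simp only: o_def)
    fix c a b assume c: "c \<in> atlas M" and ab: "0 \<le> a" "a \<le> b" "b \<le> 1" and sub: "(\<lambda>t. \<gamma> (1 - t)) ` {a..b} \<subseteq> fst c"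
    have "\<gamma> s \<in> fst c" if "s \<in> {1 - b..1 - a}" for s
    proof -
      have "\<gamma> (1 - (1 - s)) \<in> fst c" by (rule subsetD[OF sub imageI]) (use that in auto)
      then show ?thesis by simp
    qed
    then have "piecewise_C1 (snd c \<circ> \<gamma>) (1 - b) (1 - a)" using ab by (intro g(2)[OF c]) auto
    then show "piecewise_C1 (snd c \<circ> (\<lambda>t. \<gamma> (1 - t))) a b"
      by (rule piecewise_C1_affine[where m="-1" and c=1]) auto
  qed
  show "curve_length M (\<lambda>t. \<gamma> (1 - t)) = curve_length M \<gamma>"
    unfolding curve_length_eq[OF rev]
    by (rule length_affine[OF \<gamma>, where m="-1" and c=1]) auto
qed

lemma join_curve:
  assumes \<gamma>: "piecewise_C1_curve M \<gamma>" and \<eta>: "piecewise_C1_curve M \<eta>" and eq: "\<gamma> 1 = \<eta> 0"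
  defines "\<zeta> \<equiv> (\<lambda>t. if t \<le> 1/2 then \<gamma> (2 * t) else \<eta> (2 * t - 1))"
  shows "piecewise_C1_curve M \<zeta>" "curve_length M \<zeta> = curve_length M \<gamma> + curve_length M \<eta>"
proof -
  note g = piecewise_C1_curveD[OF \<gamma>] and h = piecewise_C1_curveD[OF \<eta>]
  show join: "piecewise_C1_curve M \<zeta>"
  proof (rule piecewise_C1_curveI)
    have 1: "continuous_map (top_of_set {0..1/2}) (topo M) (\<lambda>t. \<gamma> (2 * t))"
    proof -
      have "continuous_map (top_of_set {0..1/2}) (top_of_set {0..1}) (\<lambda>t::real. 2 * t)"
        by (auto intro!: continuous_intros)
      from continuous_map_compose[OF this g(1)] show ?thesis by (simp only: o_def)
    qed
    have 2: "continuous_map (top_of_set {1/2..1}) (topo M) (\<lambda>t. \<eta> (2 * t - 1))"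
    proof -
      have "continuous_map (top_of_set {1/2..1}) (top_of_set {0..1}) (\<lambda>t::real. 2 * t - 1)"
        by (auto intro!: continuous_intros)
      from continuous_map_compose[OF this h(1)] show ?thesis by (simp only: o_def)
    qed
    have s1: "subtopology (top_of_set {0..1}) {x \<in> topspace (top_of_set {0..1}). x \<le> 1/2} = top_of_set {0..1/2::real}"
    proof -
      have "{0..1} \<inter> {x \<in> {0..1}. x \<le> 1/2} = {0..1/2::real}" by auto
      then show ?thesis by (simp add: subtopology_subtopology)
    qed
    have s2: "subtopology (top_of_set {0..1}) {x \<in> topspace (top_of_set {0..1}). 1/2 \<le> x} = top_of_set {1/2..1::real}"
    proof -
      have "{0..1} \<inter> {x \<in> {0..1}. 1/2 \<le> x} = {1/2..1::real}" by auto
      then show ?thesis by (simp add: subtopology_subtopology)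
    qed
    show "curve \<zeta>" unfolding \<zeta>_def
    proof (rule continuous_map_cases_le)
      show "continuous_map (subtopology (top_of_set {0..1}) {x \<in> topspace (top_of_set {0..1}). x \<le> 1/2}) (topo M) (\<lambda>t. \<gamma> (2 * t))"
        unfolding s1 by (rule 1)
      show "continuous_map (subtopology (top_of_set {0..1}) {x \<in> topspace (top_of_set {0..1}). 1/2 \<le> x}) (topo M) (\<lambda>t. \<eta> (2 * t - 1))"
        unfolding s2 by (rule 2)
      show "\<gamma> (2 * x) = \<eta> (2 * x - 1)" if "x \<in> topspace (top_of_set {0..1})" "x = 1/2" for x
        unfolding that(2) using eq by simp
    qed auto
    fix c a b assume c: "c \<in> atlas M" and ab: "0 \<le> a" "a \<le> b" "b \<le> 1" and sub: "\<zeta> ` {a..b} \<subseteq> fst c"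
    have left: "piecewise_C1 (snd c \<circ> \<zeta>) a b'" if b': "a \<le> b'" "b' \<le> b" "b' \<le> 1/2" for b'
    proof -
      have "\<gamma> s \<in> fst c" if s: "s \<in> {2 * a..2 * b'}" for s
      proof -
        have "\<zeta> (s / 2) \<in> fst c" by (rule subsetD[OF sub imageI]) (use s b' in auto)
        then show ?thesis using s b' by (simp add: \<zeta>_def)
      qed
      then have "piecewise_C1 (snd c \<circ> \<gamma>) (2 * a) (2 * b')" using ab b' by (intro g(2)[OF c]) auto
      then show ?thesis
        by (rule piecewise_C1_affine[where m=2 and c=0]) (use b' in \<open>auto simp: \<zeta>_def\<close>)
    qed
    have right: "piecewise_C1 (snd c \<circ> \<zeta>) a' b" if a': "a \<le> a'" "a' \<le> b" "1/2 \<le> a'" for a'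
    proof -
      have "\<eta> s \<in> fst c" if s: "s \<in> {2 * a' - 1..2 * b - 1}" for s
      proof -
        have "\<zeta> ((s + 1) / 2) \<in> fst c" by (rule subsetD[OF sub imageI]) (use s a' in auto)
        moreover have "\<zeta> ((s + 1) / 2) = \<eta> s"
        proof (cases "s = 0")
          case True then show ?thesis using eq by (simp add: \<zeta>_def)
        next
          case False
          then have "s > 0" using s a' by auto
          then have "\<not> (s + 1) / 2 \<le> 1 / 2" by simp
          moreover have "2 * ((s + 1) / 2) - 1 = s" by (simp add: field_simps)
          ultimately show ?thesis unfolding \<zeta>_def by (simp only: if_False)
        qed
        ultimately show ?thesis by simp
      qed
      then have "piecewise_C1 (snd c \<circ> \<eta>) (2 * a' - 1) (2 * b - 1)" using ab a' by (intro h(2)[OF c]) auto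
      then show ?thesis
        by (rule piecewise_C1_affine[where m=2 and c="-1"]) (use a' in \<open>auto simp: \<zeta>_def\<close>)
    qed
    show "piecewise_C1 (snd c \<circ> \<zeta>) a b"
    proof (cases "b \<le> 1/2 \<or> 1/2 \<le> a")
      case True then show ?thesis using left[of b] right[of a] ab by auto
    next
      case False
      then have "piecewise_C1 (snd c \<circ> \<zeta>) a (1/2)" "piecewise_C1 (snd c \<circ> \<zeta>) (1/2) b"
        using left[of "1/2"] right[of "1/2"] by auto
      then show ?thesis by (rule piecewise_C1_combine)
    qed
  qed
  obtain S where S: "finite S" "(\<lambda>t. indicator ({0<..<1} - S) t * speed \<zeta> t) \<in> borel_measurable borel"
    by (rule speed_measurable[OF join]) blast
  let ?f = "\<lambda>a b t. indicator {a<..<b} t * ennreal (speed \<zeta> t) :: ennreal"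
  let ?h = "\<lambda>t. ennreal (indicator ({0<..<1} - S) t * speed \<zeta> t)"
  have hm[measurable]: "?h \<in> borel_measurable borel" using S(2) by (rule measurable_compose[OF _ measurable_ennreal])
  have "finite (insert (1/2) S)" using S(1) by simp
  note ae = AE_not_in_finite[OF this]
  have "curve_length M \<zeta> = (\<integral>\<^sup>+ t. indicator {0<..<1/2} t * ?h t + indicator {1/2<..<1} t * ?h t \<partial>lborel)"
    unfolding curve_length_eq[OF join] using ae
    by (intro nn_integral_cong_AE, eventually_elim) (auto simp: indicator_def)
  also have "\<dots> = (\<integral>\<^sup>+ t. indicator {0<..<1/2} t * ?h t \<partial>lborel) + (\<integral>\<^sup>+ t. indicator {1/2<..<1} t * ?h t \<partial>lborel)"
    by (rule nn_integral_add) measurable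
  also have "(\<integral>\<^sup>+ t. indicator {0<..<1/2} t * ?h t \<partial>lborel) = (\<integral>\<^sup>+ t. ?f 0 (1/2) t \<partial>lborel)"
    using ae by (intro nn_integral_cong_AE, eventually_elim) (auto simp: indicator_def)
  also have "\<dots> = curve_length M \<gamma>"
    by (rule length_affine[OF \<gamma>, where m=2 and c=0]) (auto simp: \<zeta>_def)
  also have "(\<integral>\<^sup>+ t. indicator {1/2<..<1} t * ?h t \<partial>lborel) = (\<integral>\<^sup>+ t. ?f (1/2) 1 t \<partial>lborel)"
    using ae by (intro nn_integral_cong_AE, eventually_elim) (auto simp: indicator_def)
  also have "\<dots> = curve_length M \<eta>"
    by (rule length_affine[OF \<eta>, where m=2 and c="-1"]) (auto simp: \<zeta>_def)
  finally show "curve_length M \<zeta> = curve_length M \<gamma> + curve_length M \<eta>" .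
qed

text \<open>A straight segment in a chart has speed at most \<open>K\<close> times its Euclidean speed.\<close>

lemma chart_segment_curve:
  assumes c: "c \<in> atlas M" and seg: "closed_segment y0 y1 \<subseteq> snd c ` fst c"
    and K: "\<And>y. y \<in> closed_segment y0 y1 \<Longrightarrow>
      exp (- u (chart_inv c y)) * (\<Sum>i\<in>Basis. norm (frechet_derivative (\<Phi> \<circ> chart_inv c) (at y) i)) \<le> K"
  defines "\<gamma> \<equiv> (\<lambda>t. chart_inv c (y0 + t *\<^sub>R (y1 - y0)))"
  shows "piecewise_C1_curve M \<gamma>" "curve_length M \<gamma> \<le> ennreal (K * norm (y1 - y0))"
proof -
  let ?l = "\<lambda>t. y0 + t *\<^sub>R (y1 - y0)"
  have l: "?l t \<in> closed_segment y0 y1" if "t \<in> {0..1}" for t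
    using that by (auto simp: in_segment algebra_simps intro!: exI[of _ t])
  have lc: "continuous_on S ?l" for S by (intro continuous_intros)
  have ld: "(?l has_vector_derivative (y1 - y0)) (at t)" for t
    by (auto intro!: derivative_eq_intros simp: has_vector_derivative_def)
  have lp: "piecewise_C1 ?l a b" for a b
    by (rule piecewise_C1_I[where S="{}"]) (use ld in auto)
  show pc: "piecewise_C1_curve M \<gamma>"
  proof (rule piecewise_C1_curveI)
    have "continuous_map (top_of_set {0..1}) (top_of_set (snd c ` fst c)) ?l"
      using l seg lc by auto
    from continuous_map_compose[OF this chart_inv_continuous[OF SM c]]
    show "curve \<gamma>" unfolding \<gamma>_def by (simp only: o_def)
    fix c' a b assume c': "c' \<in> atlas M" and ab: "0 \<le> a" "a \<le> b" "b \<le> (1::real)" and sub: "\<gamma> ` {a..b} \<subseteq> fst c'"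
    have sm: "smooth_on (snd c ` (fst c \<inter> fst c')) (snd c' \<circ> chart_inv c)"
      using SM c c' by (simp add: smooth_manifold_def)
    show "piecewise_C1 (snd c' \<circ> \<gamma>) a b"
    proof (rule piecewise_C1_smooth_compose[OF sm lp lc])
      show "?l ` {a<..<b} \<subseteq> snd c ` (fst c \<inter> fst c')"
      proof
        fix y assume "y \<in> ?l ` {a<..<b}"
        then obtain t where t: "t \<in> {a<..<b}" "y = ?l t" by auto
        then have "y \<in> snd c ` fst c" using l[of t] seg ab by auto
        moreover have "chart_inv c y \<in> fst c'"
          using subsetD[OF sub imageI, of t] t by (simp add: \<gamma>_def)
        ultimately show "y \<in> snd c ` (fst c \<inter> fst c')"
          using mem_chart_image_iff[OF SM c, of y "fst c'"] by (simp add: Int_commute)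
      qed
    qed (simp add: \<gamma>_def)
  qed
  have K0: "K \<ge> 0"
  proof -
    have "0 \<le> exp (- u (chart_inv c y0)) * (\<Sum>i\<in>Basis. norm (frechet_derivative (\<Phi> \<circ> chart_inv c) (at y0) i))"
      by (intro mult_nonneg_nonneg sum_nonneg) auto
    also have "\<dots> \<le> K" by (rule K) simp
    finally show ?thesis .
  qed
  have sp: "speed \<gamma> t \<le> K * norm (y1 - y0)" if t: "t \<in> {0<..<1}" for t
  proof -
    let ?A = "frechet_derivative (\<Phi> \<circ> chart_inv c) (at (?l t))"
    have lt: "?l t \<in> closed_segment y0 y1" using l[of t] t by simp
    then have in_c: "?l t \<in> snd c ` fst c" using seg by blast
    have "((\<Phi> \<circ> chart_inv c) \<circ> ?l has_vector_derivative ?A (y1 - y0)) (at t)"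
      by (rule vector_derivative_smooth_compose[OF smooth_in_chart(1)[OF c] in_c ld])
    then have "vector_derivative (\<Phi> \<circ> \<gamma>) (at t) = ?A (y1 - y0)"
      by (intro vector_derivative_at) (simp add: \<gamma>_def o_def)
    also have "\<dots> = (\<Sum>i\<in>Basis. ((y1 - y0) \<bullet> i) *\<^sub>R ?A i)"
      by (rule frechet_derivative_expand[OF smooth_in_chart(1)[OF c] in_c])
    finally have vd: "vector_derivative (\<Phi> \<circ> \<gamma>) (at t) = (\<Sum>i\<in>Basis. ((y1 - y0) \<bullet> i) *\<^sub>R ?A i)" .
    have "norm (vector_derivative (\<Phi> \<circ> \<gamma>) (at t)) \<le> (\<Sum>i\<in>Basis. norm (((y1 - y0) \<bullet> i) *\<^sub>R ?A i))"
      unfolding vd by (rule norm_sum)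
    also have "\<dots> \<le> (\<Sum>i\<in>Basis. norm (y1 - y0) * norm (?A i))"
      by (intro sum_mono) (simp add: mult_right_mono Basis_le_norm)
    also have "\<dots> = norm (y1 - y0) * (\<Sum>i\<in>Basis. norm (?A i))" by (simp add: sum_distrib_left)
    finally have "speed \<gamma> t \<le> exp (- u (\<gamma> t)) * (norm (y1 - y0) * (\<Sum>i\<in>Basis. norm (?A i)))"
      unfolding speed_def by (rule mult_left_mono) simp
    also have "\<dots> = (exp (- u (\<gamma> t)) * (\<Sum>i\<in>Basis. norm (?A i))) * norm (y1 - y0)" by simp
    also have "\<dots> \<le> K * norm (y1 - y0)" using K[OF lt] unfolding \<gamma>_def by (intro mult_right_mono) auto
    finally show ?thesis .
  qed
  have "curve_length M \<gamma> \<le> (\<integral>\<^sup>+ t. ennreal (K * norm (y1 - y0)) * indicator {0<..<1::real} t \<partial>lborel)"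
    unfolding curve_length_eq[OF pc]
    by (intro nn_integral_mono) (use sp in \<open>auto simp: indicator_def intro: ennreal_leI\<close>)
  also have "\<dots> = ennreal (K * norm (y1 - y0))" by (simp add: nn_integral_cmult_indicator)
  finally show "curve_length M \<gamma> \<le> ennreal (K * norm (y1 - y0))" .
qed

text \<open>Compactness of a closed ball in a chart gives one constant for all segments in it, and for the
  conformal factor.\<close>

lemma chart_ball:
  assumes z: "z \<in> pts M" and W: "openin (topo M) W" "z \<in> W"
  obtains c r K where "c \<in> atlas M" "z \<in> fst c" "r > 0" "cball (snd c z) r \<subseteq> snd c ` (fst c \<inter> W)"
    "\<And>y0 y1. y0 \<in> cball (snd c z) r \<Longrightarrow> y1 \<in> cball (snd c z) r \<Longrightarrow>
       \<exists>\<gamma>. piecewise_C1_curve M \<gamma> \<and> \<gamma> 0 = chart_inv c y0 \<and> \<gamma> 1 = chart_inv c y1 \<and>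
         curve_length M \<gamma> \<le> ennreal (K * norm (y1 - y0))"
    "\<And>y. y \<in> cball (snd c z) r \<Longrightarrow> \<bar>u (chart_inv c y)\<bar> \<le> K"
proof -
  let ?c = "chart_at M z"
  have c: "?c \<in> atlas M" "z \<in> fst ?c" using chart_exists[OF SM z] by auto
  have "open (snd ?c ` (fst ?c \<inter> W))" by (rule chart_image_open[OF SM c(1) W(1)])
  moreover have "snd ?c z \<in> snd ?c ` (fst ?c \<inter> W)" using c W by blast
  ultimately obtain r where r: "r > 0" "cball (snd ?c z) r \<subseteq> snd ?c ` (fst ?c \<inter> W)"
    using open_contains_cball by metis
  let ?B = "cball (snd ?c z) r"
  have Bc: "?B \<subseteq> snd ?c ` fst ?c" using r(2) by auto
  let ?g = "\<lambda>y. exp (- u (chart_inv ?c y)) * (\<Sum>i\<in>Basis. norm (frechet_derivative (\<Phi> \<circ> chart_inv ?c) (at y) i))"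
  have cu: "continuous_on ?B (\<lambda>y. u (chart_inv ?c y))"
    using smooth_on_imp_C1(4)[OF smooth_in_chart(2)[OF c(1)]] Bc by (auto simp: o_def intro: continuous_on_subset)
  have cA: "continuous_on ?B (\<lambda>y. frechet_derivative (\<Phi> \<circ> chart_inv ?c) (at y) i)" for i
    using smooth_on_imp_C1(2)[OF smooth_in_chart(1)[OF c(1)]] Bc by (rule continuous_on_subset)
  have "continuous_on ?B ?g" by (intro continuous_intros cu cA)
  then have "compact (?g ` ?B)" by (rule compact_continuous_image) simp
  then obtain K1 where K1: "\<forall>x\<in>?g ` ?B. norm x \<le> K1"
    using compact_imp_bounded bounded_iff by blast
  have "compact ((\<lambda>y. u (chart_inv ?c y)) ` ?B)" by (rule compact_continuous_image[OF cu]) simp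
  then obtain K2 where K2: "\<forall>x\<in>(\<lambda>y. u (chart_inv ?c y)) ` ?B. norm x \<le> K2"
    using compact_imp_bounded bounded_iff by blast
  define K where "K = max K1 K2"
  have "\<exists>\<gamma>. piecewise_C1_curve M \<gamma> \<and> \<gamma> 0 = chart_inv ?c y0 \<and> \<gamma> 1 = chart_inv ?c y1 \<and>
         curve_length M \<gamma> \<le> ennreal (K * norm (y1 - y0))" if y: "y0 \<in> ?B" "y1 \<in> ?B" for y0 y1
  proof -
    have seg: "closed_segment y0 y1 \<subseteq> ?B" using y by (intro closed_segment_subset) auto
    have "?g y' \<le> K" if "y' \<in> closed_segment y0 y1" for y'
    proof -
      have "norm (?g y') \<le> K1" using K1 subsetD[OF seg that] by blast
      then have "\<bar>?g y'\<bar> \<le> K1" by (simp only: real_norm_def)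
      then show ?thesis unfolding K_def by linarith
    qed
    from chart_segment_curve[OF c(1) order_trans[OF seg Bc] this]
    show ?thesis by (intro exI[of _ "\<lambda>t. chart_inv ?c (y0 + t *\<^sub>R (y1 - y0))"]) auto
  qed
  moreover have "\<bar>u (chart_inv ?c y)\<bar> \<le> K" if "y \<in> ?B" for y 
  proof -
    have "norm (u (chart_inv ?c y)) \<le> K2" using K2 that by blast
    then show ?thesis by (simp add: K_def)
  qed
  ultimately show ?thesis using that[OF c r] by blast
qed

end


section \<open>The Riemannian distance\<close>

context conformally_immersed
begin

definition curves_between :: "'a \<Rightarrow> 'a \<Rightarrow> (real \<Rightarrow> 'a) set" where
  "curves_between x y = {\<gamma>. piecewise_C1_curve M \<gamma> \<and> \<gamma> 0 = x \<and> \<gamma> 1 = y}"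

lemma riem_dist_eq: "riem_dist M x y = enn2real (INF \<gamma>\<in>curves_between x y. curve_length M \<gamma>)"
  by (simp add: riem_dist_def curves_between_def)

lemma curves_between_reverse:
  assumes "\<gamma> \<in> curves_between x y"
  shows "\<exists>\<eta>\<in>curves_between y x. curve_length M \<eta> = curve_length M \<gamma>"
  using assms reverse_curve[of \<gamma>] unfolding curves_between_def
  by (intro bexI[of _ "\<lambda>t. \<gamma> (1 - t)"]) auto

lemma curves_between_join:
  assumes "\<gamma> \<in> curves_between x y" "\<eta> \<in> curves_between y z"
  shows "\<exists>\<zeta>\<in>curves_between x z. curve_length M \<zeta> = curve_length M \<gamma> + curve_length M \<eta>"
  using assms join_curve[of \<gamma> \<eta>] unfolding curves_between_def
  by (intro bexI[of _ "\<lambda>t. if t \<le> 1/2 then \<gamma> (2 * t) else \<eta> (2 * t - 1)"]) auto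

lemma curves_between_const:
  assumes "x \<in> pts M"
  shows "\<exists>\<gamma>\<in>curves_between x x. curve_length M \<gamma> = 0"
proof -
  obtain c r K where c: "c \<in> atlas M" "x \<in> fst c" "r > (0::real)"
    and K: "\<And>y0 y1. y0 \<in> cball (snd c x) r \<Longrightarrow> y1 \<in> cball (snd c x) r \<Longrightarrow>
       \<exists>\<gamma>. piecewise_C1_curve M \<gamma> \<and> \<gamma> 0 = chart_inv c y0 \<and> \<gamma> 1 = chart_inv c y1 \<and>
         curve_length M \<gamma> \<le> ennreal (K * norm (y1 - y0))"
    by (rule chart_ball[OF assms openin_topspace assms]) blast
  from K[of "snd c x" "snd c x"] show ?thesis
    using c chart_inv_inverse[OF SM c(1,2)] by (auto simp: curves_between_def)
qed

text \<open>The points that can be reached by curves of finite length form an open set, and so do the others.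
  So the infimum of the lengths is finite, and its conversion to a real number, which sends
  \<infinity> to 0, does not identify distant points.\<close>

lemma finite_length_curve_exists:
  assumes x: "x \<in> pts M" and y: "y \<in> pts M"
  shows "\<exists>\<gamma>\<in>curves_between x y. curve_length M \<gamma> < \<infinity>"
proof -
  define reach where "reach x y \<longleftrightarrow> (\<exists>\<gamma>\<in>curves_between x y. curve_length M \<gamma> < \<infinity>)" for x y
  have sym: "reach b a" if "reach a b" for a b
    using that curves_between_reverse unfolding reach_def by metis
  have trans: "reach a c" if ab: "reach a b" and bc: "reach b c" for a b c
  proof -
    obtain \<gamma> \<eta> where \<gamma>: "\<gamma> \<in> curves_between a b" "curve_length M \<gamma> < \<infinity>"
      and \<eta>: "\<eta> \<in> curves_between b c" "curve_length M \<eta> < \<infinity>"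
      using ab bc unfolding reach_def by blast
    then obtain \<zeta> where "\<zeta> \<in> curves_between a c" "curve_length M \<zeta> = curve_length M \<gamma> + curve_length M \<eta>"
      using curves_between_join by blast
    then show ?thesis unfolding reach_def using \<gamma>(2) \<eta>(2) by (intro bexI[of _ \<zeta>]) auto
  qed
  have loc: "\<exists>V. openin (topo M) V \<and> z \<in> V \<and> (\<forall>w\<in>V. reach z w)" if z: "z \<in> pts M" for z
  proof -
    obtain c r K where c: "c \<in> atlas M" "z \<in> fst c" and r: "r > (0::real)" "cball (snd c z) r \<subseteq> snd c ` (fst c \<inter> pts M)"
      and K: "\<And>y0 y1. y0 \<in> cball (snd c z) r \<Longrightarrow> y1 \<in> cball (snd c z) r \<Longrightarrow>
         \<exists>\<gamma>. piecewise_C1_curve M \<gamma> \<and> \<gamma> 0 = chart_inv c y0 \<and> \<gamma> 1 = chart_inv c y1 \<and>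
           curve_length M \<gamma> \<le> ennreal (K * norm (y1 - y0))"
      by (rule chart_ball[OF z openin_topspace z]) blast
    let ?V = "chart_inv c ` ball (snd c z) r"
    have inv: "chart_inv c (snd c z) = z" using chart_inv_inverse[OF SM c] .
    have rb: "ball (snd c z) r \<subseteq> snd c ` fst c" using r(2) ball_subset_cball[of "snd c z" r] by blast
    have "openin (topo M) ?V" by (rule chart_inv_image_open[OF SM c(1) _ rb]) simp
    moreover have "z \<in> ?V" using inv r(1) by (metis centre_in_ball imageI)
    moreover have "reach z w" if w: "w \<in> ?V" for w
    proof -
      obtain y1 where y1: "y1 \<in> ball (snd c z) r" "w = chart_inv c y1" using w by blast
      obtain \<gamma> where \<gamma>: "piecewise_C1_curve M \<gamma>" "\<gamma> 0 = z" "\<gamma> 1 = w"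
        "curve_length M \<gamma> \<le> ennreal (K * norm (y1 - snd c z))"
        using K[of "snd c z" y1] y1 r(1) inv by auto
      have "curve_length M \<gamma> < \<infinity>" by (rule le_less_trans[OF \<gamma>(4)]) simp
      then show ?thesis unfolding reach_def curves_between_def using \<gamma> by blast
    qed
    ultimately show ?thesis by blast
  qed
  let ?R = "{w \<in> pts M. reach x w}"
  have "openin (topo M) ?R"
  proof (subst openin_subopen, intro ballI)
    fix z assume z: "z \<in> ?R"
    then obtain V where V: "openin (topo M) V" "z \<in> V" "\<forall>w\<in>V. reach z w" using loc by blast
    then have "V \<subseteq> ?R" using z trans openin_subset[OF V(1)] by blast
    then show "\<exists>T. openin (topo M) T \<and> z \<in> T \<and> T \<subseteq> ?R" using V by blast
  qed
  moreover have "openin (topo M) (pts M - ?R)"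
  proof (subst openin_subopen, intro ballI)
    fix z assume z: "z \<in> pts M - ?R"
    then obtain V where V: "openin (topo M) V" "z \<in> V" "\<forall>w\<in>V. reach z w" using loc by blast
    then have "V \<subseteq> pts M - ?R" using z trans sym openin_subset[OF V(1)] by blast
    then show "\<exists>T. openin (topo M) T \<and> z \<in> T \<and> T \<subseteq> pts M - ?R" using V by blast
  qed
  moreover have "connected_space (topo M)" using SM by (simp add: smooth_manifold_def)
  ultimately have "?R = {} \<or> ?R = pts M"
    unfolding connected_space_clopen_in closedin_def by blast
  moreover have "x \<in> ?R"
  proof -
    obtain \<gamma> where "\<gamma> \<in> curves_between x x" "curve_length M \<gamma> = 0" using curves_between_const[OF x] by blast
    then show ?thesis using x by (auto simp: reach_def intro!: bexI[of _ \<gamma>])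
  qed
  ultimately show ?thesis using y by (auto simp: reach_def)
qed

text \<open>Projection from the antipode of \<open>\<Phi> x\<close> makes \<open>\<Phi>\<close> a local homeomorphism at \<open>x\<close>.\<close>

lemma locally_injective:
  assumes x: "x \<in> pts M"
  shows "\<exists>V. openin (topo M) V \<and> x \<in> V \<and> inj_on \<Phi> V"
proof -
  have n: "norm (- \<Phi> x) = 1" using sph[OF x] by simp
  obtain T :: "real^'m \<Rightarrow> real^'n" where T: "equatorial T (- \<Phi> x)"
    using equatorial_exists[OF n dim] by blast
  let ?U = "{z \<in> pts M. \<Phi> z \<noteq> - \<Phi> x}"
  have cc: "conformal_coord M ?U (stereo T (- \<Phi> x) \<circ> \<Phi>) (\<lambda>z. exp (u z) / (1 - \<Phi> z \<bullet> (- \<Phi> x)))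
     (\<lambda>c y v. stereo_deriv T (- \<Phi> x) (\<Phi> (chart_inv c y)) (frechet_derivative (\<Phi> \<circ> chart_inv c) (at y) v))"
    by (rule conformal_coord_stereo[OF M sph \<Phi> u conf T])
  have L: "local_homeo (subtopology (topo M) ?U) (stereo T (- \<Phi> x) \<circ> \<Phi>)"
    by (rule conformal_coord_local_homeo[OF M cc])
  have U: "openin (topo M) ?U" by (rule conformal_coordD(1)[OF cc])
  have "\<Phi> x \<noteq> - \<Phi> x"
  proof
    assume "\<Phi> x = - \<Phi> x"
    then have "2 *\<^sub>R \<Phi> x = 0" by (metis add.right_inverse scaleR_2)
    then show False using n by simp
  qed
  then have xU: "x \<in> topspace (subtopology (topo M) ?U)" using x by simp
  obtain V G r where V: "openin (subtopology (topo M) ?U) V" "x \<in> V"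
      "\<And>v. v \<in> V \<Longrightarrow> G ((stereo T (- \<Phi> x) \<circ> \<Phi>) v) = v"
    by (rule local_homeoE[OF L xU]) blast
  have "inj_on \<Phi> V"
  proof (rule inj_onI)
    fix a b assume ab: "a \<in> V" "b \<in> V" "\<Phi> a = \<Phi> b"
    then show "a = b" using V(3)[OF ab(1)] V(3)[OF ab(2)] by simp
  qed
  then show ?thesis using V(1,2) openin_trans_full[OF V(1) U] by blast
qed

text \<open>A curve from \<open>x\<close> to \<open>y\<close> must cross the boundary of a small chart ball around \<open>x\<close>. There \<open>\<Phi>\<close> keeps a
  distance \<open>\<eta>\<close> from \<open>\<Phi> x\<close>, because it is injective near \<open>x\<close>; and up to a bounded conformal factor the
  length of the curve is that of its image under \<open>\<Phi>\<close>.\<close>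

lemma length_lower_bound:
  assumes x: "x \<in> pts M" and xy: "x \<noteq> y"
  shows "\<exists>\<epsilon>>0. \<forall>\<gamma>\<in>curves_between x y. ennreal \<epsilon> \<le> curve_length M \<gamma>"
proof -
  have H: "Hausdorff_space (topo M)" using SM by (simp add: smooth_manifold_def)
  obtain V where V: "openin (topo M) V" "x \<in> V" "inj_on \<Phi> V" using locally_injective[OF x] by blast
  have W: "openin (topo M) (V - {y})"
  proof (cases "y \<in> pts M")
    case True
    then have "closedin (topo M) {y}" using H by (simp add: closedin_Hausdorff_singleton)
    then show ?thesis using V(1) by (simp add: openin_diff)
  next
    case False
    then have "V - {y} = V" using openin_subset[OF V(1)] by blast
    then show ?thesis using V(1) by simp
  qed
  have xW: "x \<in> V - {y}" using V(2) xy by simp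
  obtain c r K where c: "c \<in> atlas M" "x \<in> fst c" and r: "r > (0::real)" "cball (snd c x) r \<subseteq> snd c ` (fst c \<inter> (V - {y}))"
    and K: "\<And>y'. y' \<in> cball (snd c x) r \<Longrightarrow> \<bar>u (chart_inv c y')\<bar> \<le> K"
    by (rule chart_ball[OF x W xW]) blast
  have rc: "cball (snd c x) r \<subseteq> snd c ` fst c" using r(2) by auto
  have inW: "chart_inv c y' \<in> V - {y}" if "y' \<in> cball (snd c x) r" for y'
    using subsetD[OF r(2) that] chart_inv_inverse[OF SM c(1)] by auto
  have inv: "chart_inv c (snd c x) = x" using chart_inv_inverse[OF SM c] .
  let ?S = "(\<Phi> \<circ> chart_inv c) ` sphere (snd c x) r"
  have "continuous_on (sphere (snd c x) r) (\<Phi> \<circ> chart_inv c)"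
    using smooth_on_imp_C1(4)[OF smooth_in_chart(1)[OF c(1)]] by (rule continuous_on_subset) (use rc in auto)
  then have "closed ?S" by (intro compact_imp_closed compact_continuous_image) auto
  moreover have "\<Phi> x \<notin> ?S"
  proof
    assume "\<Phi> x \<in> ?S"
    then obtain y' where y': "y' \<in> sphere (snd c x) r" "\<Phi> x = \<Phi> (chart_inv c y')" by auto
    then have yc: "y' \<in> cball (snd c x) r" by simp
    then have "chart_inv c y' = x" using V(3) inW y'(2) V(2) by (auto simp: inj_on_def)
    moreover have "snd c (chart_inv c y') = y'" using chart_inv_right[OF SM c(1)] yc rc by blast
    ultimately have "y' = snd c x" by simp
    then show False using y'(1) r(1) by simp
  qed
  ultimately have "\<exists>d>0. \<forall>q\<in>?S. d \<le> dist (\<Phi> x) q" by (rule separate_point_closed)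
  then obtain \<eta> where \<eta>: "\<eta> > 0" "\<forall>q\<in>?S. \<eta> \<le> dist (\<Phi> x) q" by blast
  have "ennreal (exp (- K) * \<eta>) \<le> curve_length M \<gamma>" if \<gamma>xy: "\<gamma> \<in> curves_between x y" for \<gamma>
  proof -
    have \<gamma>: "piecewise_C1_curve M \<gamma>" "\<gamma> 0 = x" "\<gamma> 1 = y" using \<gamma>xy by (auto simp: curves_between_def)
    have cont: "curve \<gamma>" using piecewise_C1_curveD(1)[OF \<gamma>(1)] .
    let ?B = "chart_inv c ` ball (snd c x) r" and ?C = "chart_inv c ` cball (snd c x) r"
    have rb: "ball (snd c x) r \<subseteq> snd c ` fst c" using rc ball_subset_cball[of "snd c x" r] by blast
    have B: "openin (topo M) ?B" by (rule chart_inv_image_open[OF SM c(1) _ rb]) simp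
    have C: "closedin (topo M) ?C"
    proof -
      have "compactin (top_of_set (snd c ` fst c)) (cball (snd c x) r)"
        using rc by (simp add: compactin_subtopology)
      then have "compactin (topo M) ?C"
        by (rule image_compactin) (rule chart_inv_continuous[OF SM c(1)])
      then show ?thesis using H compactin_imp_closedin by blast
    qed
    define Z where "Z = {t \<in> {0..1}. \<gamma> t \<notin> ?B}"
    have "openin (top_of_set {0..1}) {t \<in> topspace (top_of_set {0..1}). \<gamma> t \<in> ?B}"
      by (rule openin_continuous_map_preimage[OF cont B])
    then have "closedin (top_of_set {0..1}) ({0..1} - {t \<in> {0..1}. \<gamma> t \<in> ?B})"
      by (simp add: closedin_diff)
    moreover have "{0..1} - {t \<in> {0..1}. \<gamma> t \<in> ?B} = Z" by (auto simp: Z_def)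
    ultimately have "closedin (top_of_set {0..1}) Z" by simp
    then have "compact Z" using closedin_compact by blast
    moreover have "1 \<in> Z"
    proof -
      have "y \<notin> ?C" using inW by blast
      then have "y \<notin> ?B" using ball_subset_cball[of "snd c x" r] by blast
      then show ?thesis by (simp add: Z_def \<gamma>(3))
    qed
    (* t1 is the time of first exit from the chart ball. *)
    ultimately obtain t1 where t1: "t1 \<in> Z" "\<And>t. t \<in> Z \<Longrightarrow> t1 \<le> t"
      using compact_attains_inf[of Z] by auto
    have "x \<in> ?B" using inv r(1) by (metis centre_in_ball imageI)
    then have "t1 \<noteq> 0" using t1(1) \<gamma>(2) by (auto simp: Z_def)
    then have t01: "0 < t1" "t1 \<le> 1" using t1(1) by (auto simp: Z_def)
    have inB: "\<gamma> t \<in> ?B" if "0 \<le> t" "t < t1" for t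
    proof (rule ccontr)
      assume "\<gamma> t \<notin> ?B"
      then have "t \<in> Z" using that t01 by (simp add: Z_def)
      then show False using t1(2) that by fastforce
    qed
    have "closedin (top_of_set {0..1}) {t \<in> topspace (top_of_set {0..1}). \<gamma> t \<in> ?C}"
      by (rule closedin_continuous_map_preimage[OF cont C])
    then have "closedin (top_of_set {0..1}) {t \<in> {0..1}. \<gamma> t \<in> ?C}" by simp
    then have "closed {t \<in> {0..1}. \<gamma> t \<in> ?C}" by (rule closedin_closed_trans) simp
    moreover have "{0..<t1} \<subseteq> {t \<in> {0..1}. \<gamma> t \<in> ?C}"
    proof
      fix t assume t: "t \<in> {0..<t1}"
      then have "\<gamma> t \<in> ?B" using inB by simp
      then have "\<gamma> t \<in> ?C" using ball_subset_cball[of "snd c x" r] by blast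
      then show "t \<in> {t \<in> {0..1}. \<gamma> t \<in> ?C}" using t t01 by simp
    qed
    ultimately have "closure {0..<t1} \<subseteq> {t \<in> {0..1}. \<gamma> t \<in> ?C}" by (rule closure_minimal[rotated])
    moreover have "t1 \<in> closure {0..<t1}" using t01 by (simp add: closure_atLeastLessThan)
    ultimately have "\<gamma> t1 \<in> ?C" by blast
    then obtain y' where y': "y' \<in> cball (snd c x) r" "\<gamma> t1 = chart_inv c y'" by blast
    have "y' \<notin> ball (snd c x) r" using t1(1) y'(2) by (auto simp: Z_def)
    then have "y' \<in> sphere (snd c x) r" using y'(1) by auto
    then have "\<eta> \<le> dist (\<Phi> x) ((\<Phi> \<circ> chart_inv c) y')" using \<eta>(2) by blast
    then have far: "\<eta> \<le> norm ((\<Phi> \<circ> \<gamma>) t1 - (\<Phi> \<circ> \<gamma>) 0)"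
      by (simp add: \<gamma>(2) y'(2) dist_norm norm_minus_commute)
    obtain S where S: "finite S" "(\<lambda>t. indicator ({0<..<1} - S) t * speed \<gamma> t) \<in> borel_measurable borel"
      by (rule speed_measurable[OF \<gamma>(1)]) blast
    let ?h = "\<lambda>t. ennreal (indicator ({0<..<1} - S) t * speed \<gamma> t)"
    have hm: "?h \<in> borel_measurable lborel" using S(2) measurable_compose[OF _ measurable_ennreal] by simp
    have "ennreal \<eta> \<le> ennreal (norm ((\<Phi> \<circ> \<gamma>) t1 - (\<Phi> \<circ> \<gamma>) 0))" using far by (rule ennreal_leI)
    also have "\<dots> \<le> (\<integral>\<^sup>+ t. indicator {0<..<t1} t * ennreal (norm (vector_derivative (\<Phi> \<circ> \<gamma>) (at t))) \<partial>lborel)"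
    proof (rule increment_le_length)
      show "piecewise_C1 (\<Phi> \<circ> \<gamma>) 0 t1"
        by (rule piecewise_C1_subinterval[OF curve_regular(1)[OF \<gamma>(1)]]) (use t01 in auto)
      have "continuous_on {0..1} (\<lambda>t. \<Phi> (\<gamma> t))" by (rule curve_continuous[OF cont smooth_fun_continuous[OF SM \<Phi>]])
      then have "continuous_on {0..1} (\<Phi> \<circ> \<gamma>)" by (simp only: o_def)
      then show "continuous_on {0..t1} (\<Phi> \<circ> \<gamma>)" by (rule continuous_on_subset) (use t01 in auto)
    qed (use t01 in simp)
    also have "\<dots> \<le> (\<integral>\<^sup>+ t. ennreal (exp K) * ?h t \<partial>lborel)"
    proof (intro nn_integral_mono_AE)
      show "AE t in lborel. indicator {0<..<t1} t * ennreal (norm (vector_derivative (\<Phi> \<circ> \<gamma>) (at t))) \<le> ennreal (exp K) * ?h t"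
        using AE_not_in_finite[OF S(1)]
      proof eventually_elim
        fix t assume tS: "t \<notin> S"
        show "indicator {0<..<t1} t * ennreal (norm (vector_derivative (\<Phi> \<circ> \<gamma>) (at t))) \<le> ennreal (exp K) * ?h t"
        proof (cases "t \<in> {0<..<t1}")
          case True
          then have "\<gamma> t \<in> ?B" using inB by simp
          then obtain y' where "y' \<in> ball (snd c x) r" "\<gamma> t = chart_inv c y'" by blast
          then have uK: "u (\<gamma> t) \<le> K" using K[of y'] by simp
          have "exp K * speed \<gamma> t = exp (K - u (\<gamma> t)) * norm (vector_derivative (\<Phi> \<circ> \<gamma>) (at t))"
            by (simp add: speed_def exp_diff exp_minus field_simps)
          moreover have "exp (K - u (\<gamma> t)) \<ge> 1" using uK by simp
          ultimately have "norm (vector_derivative (\<Phi> \<circ> \<gamma>) (at t)) \<le> exp K * speed \<gamma> t"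
            using mult_right_mono[of 1 "exp (K - u (\<gamma> t))" "norm (vector_derivative (\<Phi> \<circ> \<gamma>) (at t))"] by simp
          then have "ennreal (norm (vector_derivative (\<Phi> \<circ> \<gamma>) (at t))) \<le> ennreal (exp K) * ennreal (speed \<gamma> t)"
            by (metis ennreal_leI ennreal_mult' exp_ge_zero)
          then show ?thesis using True tS t01 by simp
        qed simp
      qed
    qed
    also have "\<dots> = ennreal (exp K) * (\<integral>\<^sup>+ t. ?h t \<partial>lborel)" by (rule nn_integral_cmult[OF hm])
    also have "(\<integral>\<^sup>+ t. ?h t \<partial>lborel) = curve_length M \<gamma>"
      unfolding curve_length_eq[OF \<gamma>(1)]
      using AE_not_in_finite[OF S(1)]
      by (intro nn_integral_cong_AE, eventually_elim) (auto simp: indicator_def)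
    finally have le: "ennreal \<eta> \<le> ennreal (exp K) * curve_length M \<gamma>" .
    have "ennreal (exp (- K) * \<eta>) = ennreal (exp (- K)) * ennreal \<eta>" using \<eta>(1) by (intro ennreal_mult) auto
    also have "\<dots> \<le> ennreal (exp (- K)) * (ennreal (exp K) * curve_length M \<gamma>)"
      using le by (rule mult_left_mono) simp
    also have "\<dots> = ennreal (exp (- K) * exp K) * curve_length M \<gamma>"
      by (simp add: ennreal_mult mult.assoc)
    also have "\<dots> = curve_length M \<gamma>" by (simp add: exp_minus)
    finally show ?thesis .
  qed
  then show ?thesis using \<eta>(1) by (intro exI[of _ "exp (- K) * \<eta>"]) auto
qed

lemma riem_dist_metric: "Metric_space (pts M) (riem_dist M)"
proof
  let ?I = "\<lambda>x y. (INF \<gamma>\<in>curves_between x y. curve_length M \<gamma>)"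
  show "0 \<le> riem_dist M x y" for x y by (simp add: riem_dist_eq)
  have le: "?I x y \<le> ?I y x" for x y
    by (rule INF_greatest) (metis INF_lower curves_between_reverse)
  then have "?I x y = ?I y x" for x y by (rule antisym) (rule le)
  then show "riem_dist M x y = riem_dist M y x" for x y by (simp add: riem_dist_eq)
  have fin: "?I x y < \<infinity>" if "x \<in> pts M" "y \<in> pts M" for x y
    using finite_length_curve_exists[OF that] by (auto simp: INF_less_iff)
  show "riem_dist M x y = 0 \<longleftrightarrow> x = y" if xy: "x \<in> pts M" "y \<in> pts M" for x y
  proof
    assume z: "riem_dist M x y = 0"
    show "x = y"
    proof (rule ccontr)
      assume "x \<noteq> y"
      then obtain \<epsilon> where \<epsilon>: "\<epsilon> > 0" "\<forall>\<gamma>\<in>curves_between x y. ennreal \<epsilon> \<le> curve_length M \<gamma>"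
        using length_lower_bound[OF xy(1)] by blast
      have "ennreal \<epsilon> \<le> ?I x y" by (rule INF_greatest) (use \<epsilon> in blast)
      then have "enn2real (ennreal \<epsilon>) \<le> enn2real (?I x y)" using fin[OF xy] by (intro enn2real_mono) auto
      then show False using z \<epsilon>(1) by (simp add: riem_dist_eq)
    qed
  next
    assume "x = y"
    then obtain \<gamma> where "\<gamma> \<in> curves_between x y" "curve_length M \<gamma> = 0" using curves_between_const[OF xy(1)] by blast
    then have "?I x y \<le> 0" by (metis INF_lower)
    then show "riem_dist M x y = 0" by (simp add: riem_dist_eq)
  qed
  show "riem_dist M x z \<le> riem_dist M x y + riem_dist M y z"
    if xyz: "x \<in> pts M" "y \<in> pts M" "z \<in> pts M" for x y z
  proof -
    have "?I x z \<le> ?I x y + ?I y z"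
    proof (rule ennreal_le_epsilon)
      fix e :: real assume e: "0 < e"
      have lt: "a < a + ennreal (e / 2)" if "a < \<infinity>" for a :: ennreal
        using that e by (simp add: ennreal_less_top)
      obtain \<gamma> where \<gamma>: "\<gamma> \<in> curves_between x y" "curve_length M \<gamma> < ?I x y + ennreal (e / 2)"
        using lt[OF fin[OF xyz(1,2)]] unfolding INF_less_iff by blast
      obtain \<eta> where \<eta>: "\<eta> \<in> curves_between y z" "curve_length M \<eta> < ?I y z + ennreal (e / 2)"
        using lt[OF fin[OF xyz(2,3)]] unfolding INF_less_iff by blast
      obtain \<zeta> where \<zeta>: "\<zeta> \<in> curves_between x z" "curve_length M \<zeta> = curve_length M \<gamma> + curve_length M \<eta>"
        using curves_between_join[OF \<gamma>(1) \<eta>(1)] by blast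
      have "?I x z \<le> curve_length M \<gamma> + curve_length M \<eta>" using \<zeta> by (metis INF_lower)
      also have "\<dots> \<le> (?I x y + ennreal (e / 2)) + (?I y z + ennreal (e / 2))"
        using \<gamma>(2) \<eta>(2) by (intro add_mono) auto
      also have "\<dots> = ?I x y + ?I y z + (ennreal (e / 2) + ennreal (e / 2))" by (simp add: ac_simps)
      also have "ennreal (e / 2) + ennreal (e / 2) = ennreal e" using e by (subst ennreal_plus[symmetric]) auto
      finally show "?I x z \<le> ?I x y + ?I y z + ennreal e" .
    qed
    then have "enn2real (?I x z) \<le> enn2real (?I x y + ?I y z)"
      using fin xyz by (intro enn2real_mono) auto
    also have "\<dots> = enn2real (?I x y) + enn2real (?I y z)" using fin xyz by (intro enn2real_plus) auto
    finally show ?thesis by (simp add: riem_dist_eq)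
  qed
qed

lemma bounded_domain_exists:
  assumes z: "z \<in> pts M" and W: "openin (topo M) W" "z \<in> W"
  shows "\<exists>U. domain_in M U \<and> bounded_in M U \<and> z \<in> U \<and> U \<subseteq> W"
proof -
  obtain c r K where c: "c \<in> atlas M" "z \<in> fst c" and r: "r > (0::real)" "cball (snd c z) r \<subseteq> snd c ` (fst c \<inter> W)"
    and K: "\<And>y0 y1. y0 \<in> cball (snd c z) r \<Longrightarrow> y1 \<in> cball (snd c z) r \<Longrightarrow>
       \<exists>\<gamma>. piecewise_C1_curve M \<gamma> \<and> \<gamma> 0 = chart_inv c y0 \<and> \<gamma> 1 = chart_inv c y1 \<and>
         curve_length M \<gamma> \<le> ennreal (K * norm (y1 - y0))"
    and uK: "\<And>y. y \<in> cball (snd c z) r \<Longrightarrow> \<bar>u (chart_inv c y)\<bar> \<le> K"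
    by (rule chart_ball[OF z W]) blast
  have K0: "K \<ge> 0" using uK[of "snd c z"] r(1) by auto
  have rc: "ball (snd c z) r \<subseteq> snd c ` fst c" using r(2) ball_subset_cball[of "snd c z" r] by blast
  have inv: "chart_inv c (snd c z) = z" using chart_inv_inverse[OF SM c] .
  let ?U = "chart_inv c ` ball (snd c z) r"
  have zU: "z \<in> ?U" using inv r(1) by (metis centre_in_ball imageI)
  have "openin (topo M) ?U" by (rule chart_inv_image_open[OF SM c(1) _ rc]) simp
  moreover have "connectedin (topo M) ?U"
    by (rule connectedin_continuous_map_image[OF chart_inv_continuous[OF SM c(1)]])
      (use rc in \<open>simp add: connectedin_subtopology\<close>)
  ultimately have dom: "domain_in M ?U" unfolding domain_in_def using zU by blast
  have UM: "?U \<subseteq> pts M" using openin_subset[OF \<open>openin (topo M) ?U\<close>] .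
  interpret Metric_space "pts M" "riem_dist M" by (rule riem_dist_metric)
  have "riem_dist M z w \<le> K * r" if w: "w \<in> ?U" for w
  proof -
    obtain y1 where y1: "y1 \<in> ball (snd c z) r" "w = chart_inv c y1" using w by blast
    obtain \<gamma> where \<gamma>: "piecewise_C1_curve M \<gamma>" "\<gamma> 0 = z" "\<gamma> 1 = w"
      "curve_length M \<gamma> \<le> ennreal (K * norm (y1 - snd c z))"
      using K[of "snd c z" y1] y1 r(1) inv by auto
    have "(INF \<gamma>\<in>curves_between z w. curve_length M \<gamma>) \<le> curve_length M \<gamma>"
      by (rule INF_lower) (use \<gamma> in \<open>simp add: curves_between_def\<close>)
    also have "\<dots> \<le> ennreal (K * norm (y1 - snd c z))" by (rule \<gamma>(4))
    also have "\<dots> \<le> ennreal (K * r)"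
      using y1(1) K0 by (intro ennreal_leI mult_left_mono) (auto simp: dist_norm norm_minus_commute)
    finally have "enn2real (INF \<gamma>\<in>curves_between z w. curve_length M \<gamma>) \<le> K * r"
      using K0 r(1) by (intro enn2real_leI) auto
    then show ?thesis by (simp add: riem_dist_eq)
  qed
  then have "?U \<subseteq> mcball z (K * r)" using z UM by (auto simp: mcball_def subset_eq)
  then have "bounded_in M ?U" unfolding bounded_in_def mbounded_def by blast
  moreover have "?U \<subseteq> W"
  proof
    fix w assume "w \<in> ?U"
    then obtain y1 where y1: "y1 \<in> cball (snd c z) r" "w = chart_inv c y1"
      using ball_subset_cball[of "snd c z" r] by blast
    then obtain v where "v \<in> fst c" "v \<in> W" "y1 = snd c v" using r(2) by blast
    then show "w \<in> W" using y1(2) chart_inv_inverse[OF SM c(1)] by simp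
  qed
  ultimately show ?thesis using dom zU by blast
qed

end


section \<open>Injectivity\<close>

lemma parabolic_test_function:
  assumes P: "parabolic M p" and U: "domain_in M U" "bounded_in M U" and \<epsilon>: "\<epsilon> > 0"
  shows "\<exists>\<phi>. test_fun M (pts M) \<phi> \<and> (\<forall>z\<in>U. 1 \<le> \<phi> z) \<and>
     (\<integral>\<^sup>+ z \<in> pts M. ennreal (grad_norm M \<phi> z powr p) \<partial>volume M) < ennreal \<epsilon>"
proof -
  have "capacity M p (topo M closure_of U) (pts M) < ennreal \<epsilon>"
    using P U \<epsilon> by (simp add: parabolic_def)
  then obtain \<phi> where \<phi>: "test_fun M (pts M) \<phi>" "\<forall>z\<in>topo M closure_of U. 1 \<le> \<phi> z"
      "(\<integral>\<^sup>+ z \<in> pts M. ennreal (grad_norm M \<phi> z powr p) \<partial>volume M) < ennreal \<epsilon>"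
    unfolding capacity_def INF_less_iff by auto
  have "U \<subseteq> topo M closure_of U"
    by (rule closure_of_subset) (use U(1) openin_subset in \<open>auto simp: domain_in_def\<close>)
  then show ?thesis using \<phi> by blast
qed

context conformally_immersed
begin

text \<open>The compactly supported functions provided by parabolicity, transported to the Euclidean domain of
  a section. This is the hypothesis \<open>test\<close> of \<open>no_two_sheets\<close>.\<close>

lemma parabolic_section_test:
  assumes P: "parabolic M (real CARD('n))" and n: "CARD('n) \<ge> 3"
    and cc: "conformal_coord M U f \<kappa> B" and D: "domain_in M D" "bounded_in M D"
    and E: "open E" and F: "is_section (subtopology (topo M) U) f E F"
    and H: "\<And>w. w \<in> H \<Longrightarrow> F w \<in> D" and \<epsilon>: "\<epsilon> > 0"
  shows "\<exists>\<phi> K Du. compactin (topo M) K \<and> (\<forall>w\<in>E. F w \<notin> K \<longrightarrow> \<phi> (F w) = 0) \<and>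
       (\<forall>w\<in>H. 1 \<le> \<phi> (F w)) \<and>
       (\<forall>w\<in>E. ((\<lambda>w. \<phi> (F w)) has_derivative (\<lambda>h. Du w \<bullet> h)) (at w)) \<and>
       (\<integral>\<^sup>+ w. indicator E w * ennreal (norm (Du w) ^ CARD('n)) \<partial>lborel) < ennreal \<epsilon>"
proof -
  obtain \<phi> where \<phi>: "test_fun M (pts M) \<phi>" "\<forall>z\<in>D. 1 \<le> \<phi> z"
      "(\<integral>\<^sup>+ z \<in> pts M. ennreal (grad_norm M \<phi> z powr real CARD('n)) \<partial>volume M) < ennreal \<epsilon>"
    using parabolic_test_function[OF P D \<epsilon>] by blast
  define K where "K = topo M closure_of {z \<in> pts M. \<phi> z \<noteq> 0}"
  have K: "compactin (topo M) K" and sm: "smooth_fun M (pts M) \<phi>"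
    using \<phi>(1) by (auto simp: test_fun_def K_def Let_def)
  have KS: "{z \<in> pts M. \<phi> z \<noteq> 0} \<subseteq> K" unfolding K_def by (rule closure_of_subset) auto
  obtain Du where Du: "\<And>w. w \<in> E \<Longrightarrow> ((\<lambda>w. \<phi> (F w)) has_derivative (\<lambda>h. Du w \<bullet> h)) (at w)"
      "\<And>w. w \<in> E \<Longrightarrow> norm (Du w) = grad_norm M \<phi> (F w) / \<kappa> (F w)"
    using section_gradient[OF M cc E F sm] by blast
  have "(\<integral>\<^sup>+ w. indicator E w * ennreal (norm (Du w) ^ CARD('n)) \<partial>lborel)
     \<le> (\<integral>\<^sup>+ z \<in> pts M. ennreal (grad_norm M \<phi> z powr real CARD('n)) \<partial>volume M)"
    by (rule section_energy_le[OF M cc E F borel_measurable_gradient[OF E Du(1)] Du(2)])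
  also have "\<dots> < ennreal \<epsilon>" by (rule \<phi>(3))
  finally have en: "(\<integral>\<^sup>+ w. indicator E w * ennreal (norm (Du w) ^ CARD('n)) \<partial>lborel) < ennreal \<epsilon>" .
  have zero: "\<phi> (F w) = 0" if "w \<in> E" "F w \<notin> K" for w
  proof -
    have "F w \<in> pts M" using is_sectionD(1)[OF F that(1)] by simp
    then show ?thesis using KS that(2) by blast
  qed
  have one: "1 \<le> \<phi> (F w)" if "w \<in> H" for w using \<phi>(2) H[OF that] by blast
  show ?thesis
    by (intro exI[of _ \<phi>] exI[of _ K] exI[of _ Du] conjI K) (use zero one Du(1) en in auto)
qed

text \<open>In the projection from \<open>- N\<close>, the point \<open>z\<close> lies over the origin, where \<open>\<Phi>\<close> has a local inverse \<open>G\<close>.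
  The projection from \<open>N\<close> differs from it by an inversion, so \<open>G\<close> after inversion is a section near
  infinity, and the image of a punctured ball under \<open>G\<close> is a punctured neighbourhood.\<close>

lemma section_near_pole:
  fixes T :: "real^'m \<Rightarrow> real^'n"
  assumes z: "z \<in> pts M" "\<Phi> z = N" and T: "equatorial T N" and W: "openin (topo M) W" "z \<in> W"
  shows "\<exists>\<rho>>0. \<exists>F. is_section (subtopology (topo M) {z \<in> pts M. \<Phi> z \<noteq> N}) (stereo T N \<circ> \<Phi>) {w. \<rho> < norm w} F \<and>
     (\<forall>w. \<rho> < norm w \<longrightarrow> F w \<in> W)"
    and "\<exists>V. openin (topo M) V \<and> z \<in> V \<and> V - {z} \<subseteq> {z \<in> pts M. \<Phi> z \<noteq> N} \<and>
      (CARD('n) \<ge> 2 \<longrightarrow> connectedin (topo M) (V - {z}))"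
proof -
  have N: "norm N = 1" using T by (simp add: equatorial_def)
  have T': "equatorial T (- N)" by (rule equatorial_uminus[OF T])
  let ?U = "{z \<in> pts M. \<Phi> z \<noteq> - N}" and ?q = "stereo T (- N) \<circ> \<Phi>"
  have cc: "conformal_coord M ?U ?q (\<lambda>z. exp (u z) / (1 - \<Phi> z \<bullet> (- N)))
     (\<lambda>c y v. stereo_deriv T (- N) (\<Phi> (chart_inv c y)) (frechet_derivative (\<Phi> \<circ> chart_inv c) (at y) v))"
    by (rule conformal_coord_stereo[OF M sph \<Phi> u conf T'])
  have L: "local_homeo (subtopology (topo M) ?U) ?q" by (rule conformal_coord_local_homeo[OF M cc])
  have U: "openin (topo M) ?U" by (rule conformal_coordD(1)[OF cc])
  have NN: "N \<noteq> - N"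
  proof
    assume "N = - N"
    then have "2 *\<^sub>R N = 0" by (metis add.right_inverse scaleR_2)
    then show False using N by simp
  qed
  have "T N \<bullet> T N = N \<bullet> N - (N \<bullet> N) * (N \<bullet> N)" using T unfolding equatorial_def by blast
  moreover have "N \<bullet> N = 1" using N by (simp add: dot_square_norm)
  ultimately have TN: "T N = 0" by simp
  then have pole: "?q v = 0" if "\<Phi> v = N" for v using that by (simp add: stereo_def)
  have zU: "z \<in> topspace (subtopology (topo M) ?U)" using z NN by simp
  obtain V G r where V: "r > 0" "openin (subtopology (topo M) ?U) V" "z \<in> V"
      "is_section (subtopology (topo M) ?U) ?q (ball (?q z) r) G" "G ` ball (?q z) r = V" "\<And>v. v \<in> V \<Longrightarrow> G (?q v) = v"
    by (rule local_homeoE[OF L zU]) blast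
  have qz: "?q z = 0" using pole z(2) by blast
  note G = V(4)[unfolded qz]
  have GU: "G w \<in> pts M" "\<Phi> (G w) \<noteq> - N" if "w \<in> ball 0 r" for w
    using is_sectionD(1)[OF G that] by auto
  have GN: "\<Phi> (G w) \<noteq> N" if "w \<in> ball 0 r" "w \<noteq> 0" for w
    using pole[of "G w"] is_sectionD(2)[OF G that(1)] that(2) by auto
  have G0: "G 0 = z" using V(6)[OF V(3)] qz by simp
  have contG: "continuous_map (top_of_set (ball 0 r)) (topo M) G"
    using G unfolding is_section_def continuous_map_in_subtopology by blast
  have "openin (subtopology (topo M) ?U) (W \<inter> ?U)" using W(1) openin_subtopology by blast
  then have "open {w \<in> ball 0 r. G w \<in> W \<inter> ?U}" by (rule is_section_open_vimage[OF G open_ball])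
  moreover have "0 \<in> {w \<in> ball 0 r. G w \<in> W \<inter> ?U}" using V(1) G0 W(2) z NN by simp
  ultimately obtain \<delta> where \<delta>: "\<delta> > 0" "ball 0 \<delta> \<subseteq> {w \<in> ball 0 r. G w \<in> W \<inter> ?U}"
    by (rule openE)
  let ?inv = "\<lambda>w :: real^'n. (1 / (norm w)\<^sup>2) *\<^sub>R w"
  define F where "F w = G (?inv w)" for w
  let ?S = "{w :: real^'n. 1 / \<delta> < norm w}"
  have small: "?inv w \<in> ball 0 \<delta>" "?inv w \<noteq> 0" if w: "w \<in> ?S" for w
  proof -
    have "0 < 1 / \<delta>" using \<delta>(1) by simp
    also have "\<dots> < norm w" using w by simp
    finally have wn: "norm w > 0" .
    have "norm (?inv w) = 1 / norm w" using wn by (simp add: power2_eq_square)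
    also have "\<dots> < \<delta>" using w wn \<delta>(1) by (simp add: field_simps)
    finally show "?inv w \<in> ball 0 \<delta>" by simp
    show "?inv w \<noteq> 0" using wn by simp
  qed
  have smallr: "?inv w \<in> ball 0 r" if "w \<in> ?S" for w using small(1)[OF that] \<delta>(2) by blast
  have FW: "F w \<in> W" if "w \<in> ?S" for w using small(1)[OF that] \<delta>(2) unfolding F_def by blast
  have "is_section (subtopology (topo M) {z \<in> pts M. \<Phi> z \<noteq> N}) (stereo T N \<circ> \<Phi>) ?S F"
    unfolding is_section_def
  proof
    have "continuous_on ?S ?inv"
      using small(2) by (intro continuous_intros) auto
    then have "continuous_map (top_of_set ?S) (top_of_set (ball 0 r)) ?inv"
      using smallr by auto
    from continuous_map_compose[OF this contG]
    have "continuous_map (top_of_set ?S) (topo M) F" by (simp only: F_def[abs_def] o_def)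
    moreover have "F w \<in> {z \<in> pts M. \<Phi> z \<noteq> N}" if "w \<in> ?S" for w
      using GU(1)[OF smallr[OF that]] GN[OF smallr[OF that] small(2)[OF that]] by (simp add: F_def)
    ultimately show "continuous_map (top_of_set ?S) (subtopology (topo M) {z \<in> pts M. \<Phi> z \<noteq> N}) F"
      by (auto simp: continuous_map_in_subtopology)
    show "\<forall>w\<in>?S. (stereo T N \<circ> \<Phi>) (F w) = w"
    proof
      fix w assume w: "w \<in> ?S"
      have "stereo T (- N) (\<Phi> (F w)) = ?inv w" using is_sectionD(2)[OF G smallr[OF w]] by (simp add: F_def)
      then have "stereo T N (\<Phi> (F w)) = w"
        using stereo_inversion[OF T sph[OF GU(1)[OF smallr[OF w]]] GN[OF smallr[OF w] small(2)[OF w]] GU(2)[OF smallr[OF w]]]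
        by (simp add: F_def)
      then show "(stereo T N \<circ> \<Phi>) (F w) = w" by simp
    qed
  qed
  moreover have "1 / \<delta> > 0" using \<delta>(1) by simp
  ultimately show "\<exists>\<rho>>0. \<exists>F. is_section (subtopology (topo M) {z \<in> pts M. \<Phi> z \<noteq> N}) (stereo T N \<circ> \<Phi>) {w. \<rho> < norm w} F \<and>
     (\<forall>w. \<rho> < norm w \<longrightarrow> F w \<in> W)"
    using FW by blast
  have inj: "inj_on G (ball 0 r)" by (rule inj_on_inverseI[where g="?q"]) (rule is_sectionD(2)[OF G])
  have Vz: "V - {z} = G ` (ball 0 r - {0})"
  proof -
    have "G ` (ball 0 r - {0}) = G ` ball 0 r - G ` {0}"
      by (rule inj_on_image_set_diff[OF inj]) (use V(1) in auto)
    then show ?thesis using V(5) G0 unfolding qz by simp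
  qed
  have "V - {z} \<subseteq> {z \<in> pts M. \<Phi> z \<noteq> N}" unfolding Vz using GU(1) GN by blast
  moreover have "connectedin (topo M) (V - {z})" if "CARD('n) \<ge> 2"
    unfolding Vz
  proof (rule connectedin_continuous_map_image[OF contG])
    have "connected (ball (0::real^'n) r - {0})"
      by (rule connected_punctured_ball) (use that in simp)
    then show "connectedin (top_of_set (ball 0 r)) (ball (0::real^'n) r - {0})"
      by (simp add: connectedin_subtopology)
  qed
  ultimately show "\<exists>V. openin (topo M) V \<and> z \<in> V \<and> V - {z} \<subseteq> {z \<in> pts M. \<Phi> z \<noteq> N} \<and>
      (CARD('n) \<ge> 2 \<longrightarrow> connectedin (topo M) (V - {z}))"
    using openin_trans_full[OF V(2) U] V(3) by blast
qed

lemma norm_large_near_pole: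
  fixes T :: "real^'m \<Rightarrow> real^'n"
  assumes z: "z \<in> pts M" "\<Phi> z = N" and T: "equatorial T N"
  shows "\<exists>V. openin (topo M) V \<and> z \<in> V \<and>
     (\<forall>v\<in>V \<inter> {z \<in> pts M. \<Phi> z \<noteq> N}. R < norm ((stereo T N \<circ> \<Phi>) v))"
proof -
  let ?O = "{p. p \<bullet> N > 1 - 1 / (\<bar>R\<bar> + 1)\<^sup>2}"
  have "open ?O" by (intro open_Collect_less continuous_intros)
  then have "openin (topo M) {v \<in> pts M. \<Phi> v \<in> ?O}"
    by (intro openin_continuous_map_preimage[OF smooth_fun_continuous[OF SM \<Phi>]]) simp
  moreover have "z \<in> {v \<in> pts M. \<Phi> v \<in> ?O}"
  proof -
    have "N \<bullet> N = 1" using T by (simp add: equatorial_def dot_square_norm)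
    moreover have "1 / (\<bar>R\<bar> + 1)\<^sup>2 > 0" by (intro divide_pos_pos zero_less_power) auto
    ultimately show ?thesis using z by simp
  qed
  moreover have "R < norm ((stereo T N \<circ> \<Phi>) v)" if "v \<in> {v \<in> pts M. \<Phi> v \<in> ?O} \<inter> {z \<in> pts M. \<Phi> z \<noteq> N}" for v
    using that stereo_at_pole[OF T sph, of v R] by auto
  ultimately show ?thesis by blast
qed

theorem injective_if_parabolic:
  assumes n: "CARD('n) \<ge> 3" and P: "parabolic M (real CARD('n))"
  shows "inj_on \<Phi> (pts M)"
proof (rule inj_onI, rule ccontr)
  fix x y assume xy: "x \<in> pts M" "y \<in> pts M" "\<Phi> x = \<Phi> y" "x \<noteq> y"
  define N where "N = \<Phi> x"
  have N: "norm N = 1" using sph[OF xy(1)] by (simp add: N_def)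
  obtain T :: "real^'m \<Rightarrow> real^'n" where T: "equatorial T N" using equatorial_exists[OF N dim] by blast
  let ?U = "{z \<in> pts M. \<Phi> z \<noteq> N}" and ?f = "stereo T N \<circ> \<Phi>"
  have cc: "conformal_coord M ?U ?f (\<lambda>z. exp (u z) / (1 - \<Phi> z \<bullet> N))
     (\<lambda>c y v. stereo_deriv T N (\<Phi> (chart_inv c y)) (frechet_derivative (\<Phi> \<circ> chart_inv c) (at y) v))"
    by (rule conformal_coord_stereo[OF M sph \<Phi> u conf T])
  have H: "Hausdorff_space (topo M)" and conn: "connected_space (topo M)"
    using SM by (auto simp: smooth_manifold_def)
  obtain Wx Wy where W: "openin (topo M) Wx" "openin (topo M) Wy" "x \<in> Wx" "y \<in> Wy" "disjnt Wx Wy"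
    using H xy unfolding Hausdorff_space_def by blast
  obtain Dx where Dx: "domain_in M Dx" "bounded_in M Dx" "x \<in> Dx" "Dx \<subseteq> Wx"
    using bounded_domain_exists[OF xy(1) W(1,3)] by blast
  obtain Dy where Dy: "domain_in M Dy" "bounded_in M Dy" "y \<in> Dy" "Dy \<subseteq> Wy"
    using bounded_domain_exists[OF xy(2) W(2,4)] by blast
  define D where "D i = (if i then Dx else Dy)" for i :: bool
  have D: "domain_in M (D i)" "bounded_in M (D i)" for i using Dx Dy by (auto simp: D_def)
  have Do: "openin (topo M) Dx" "openin (topo M) Dy" using Dx Dy by (auto simp: domain_in_def)
  obtain \<rho>x Fx where Fx: "\<rho>x > 0" "is_section (subtopology (topo M) ?U) ?f {w. \<rho>x < norm w} Fx"
      "\<And>w. \<rho>x < norm w \<Longrightarrow> Fx w \<in> Dx"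
    using section_near_pole(1)[OF xy(1) N_def[symmetric] T Do(1) Dx(3)] by blast
  have yN: "\<Phi> y = N" using xy by (simp add: N_def)
  obtain \<rho>y Fy where Fy: "\<rho>y > 0" "is_section (subtopology (topo M) ?U) ?f {w. \<rho>y < norm w} Fy"
      "\<And>w. \<rho>y < norm w \<Longrightarrow> Fy w \<in> Dy"
    using section_near_pole(1)[OF xy(2) yN T Do(2) Dy(3)] by blast
  define F where "F i = (if i then Fx else Fy)" for i :: bool
  define R where "R = max \<rho>x \<rho>y"
  (* Any unit vector serves as direction of continuation. *)
  define e :: "real^'n" where "e = axis undefined 1"
  have e: "e \<noteq> 0" "norm e = 1" by (auto simp: e_def axis_eq_0_iff)
  have large: "R < norm w" if "w \<bullet> e < - R" for w
  proof -
    have "\<bar>w \<bullet> e\<bar> \<le> norm w" using Cauchy_Schwarz_ineq2[of w e] e by simp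
    then show ?thesis using that by linarith
  qed
  have FD: "F i w \<in> D i" if "w \<bullet> e < - R" for i w
    using Fx(3) Fy(3) large[OF that] by (auto simp: F_def D_def R_def)
  show False
  proof (rule no_two_sheets[OF n e(1) H conn conformal_coordD(1)[OF cc] conformal_coord_local_homeo[OF M cc]])
    show "\<exists>V. openin (topo M) V \<and> z \<in> V \<and> (\<forall>v\<in>V \<inter> ?U. R < norm (?f v))" if "z \<in> pts M - ?U" for z R
      using norm_large_near_pole[OF _ _ T] that by blast
    show "\<exists>V. openin (topo M) V \<and> z \<in> V \<and> V - {z} \<subseteq> ?U \<and> connectedin (topo M) (V - {z})" if "z \<in> pts M - ?U" for z
    proof -
      have z: "z \<in> pts M" "\<Phi> z = N" using that by auto
      show ?thesis using section_near_pole(2)[OF z T openin_topspace z(1)] n by auto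
    qed
    show "is_section (subtopology (topo M) ?U) ?f {w. w \<bullet> e < - R} (F i)" for i
    proof (cases i)
      case True
      have "is_section (subtopology (topo M) ?U) ?f {w. w \<bullet> e < - R} Fx"
        by (rule is_section_subset[OF Fx(2)]) (use large in \<open>auto simp: R_def\<close>)
      then show ?thesis using True by (simp add: F_def)
    next
      case False
      have "is_section (subtopology (topo M) ?U) ?f {w. w \<bullet> e < - R} Fy"
        by (rule is_section_subset[OF Fy(2)]) (use large in \<open>auto simp: R_def\<close>)
      then show ?thesis using False by (simp add: F_def)
    qed
    show "F True w \<noteq> F False w" if "w \<bullet> e < - R" for w
    proof -
      have "F True w \<in> Wx" "F False w \<in> Wy"
        using FD[OF that, of True] FD[OF that, of False] Dx(4) Dy(4) by (auto simp: D_def)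
      then show ?thesis using W(5) by (auto simp: disjnt_def)
    qed
    show "\<exists>\<phi> K Du. compactin (topo M) K \<and> (\<forall>w\<in>E. G w \<notin> K \<longrightarrow> \<phi> (G w) = 0) \<and>
         (\<forall>w. w \<bullet> e < - R \<longrightarrow> 1 \<le> \<phi> (G w)) \<and>
         (\<forall>w\<in>E. ((\<lambda>w. \<phi> (G w)) has_derivative (\<lambda>h. Du w \<bullet> h)) (at w)) \<and>
         (\<integral>\<^sup>+ w. indicator E w * ennreal (norm (Du w) ^ CARD('n)) \<partial>lborel) < ennreal \<epsilon>"
      if "open E" "is_section (subtopology (topo M) ?U) ?f E G" "{w. w \<bullet> e < - R} \<subseteq> E"
        "\<And>w. w \<bullet> e < - R \<Longrightarrow> G w = F i w" "\<epsilon> > 0" for i E G \<epsilon>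
    proof -
      have GD: "G w \<in> D i" if "w \<in> {w. w \<bullet> e < - R}" for w
        using that FD \<open>\<And>w. w \<bullet> e < - R \<Longrightarrow> G w = F i w\<close> by simp
      have "\<exists>\<phi> K Du. compactin (topo M) K \<and> (\<forall>w\<in>E. G w \<notin> K \<longrightarrow> \<phi> (G w) = 0) \<and>
         (\<forall>w\<in>{w. w \<bullet> e < - R}. 1 \<le> \<phi> (G w)) \<and>
         (\<forall>w\<in>E. ((\<lambda>w. \<phi> (G w)) has_derivative (\<lambda>h. Du w \<bullet> h)) (at w)) \<and>
         (\<integral>\<^sup>+ w. indicator E w * ennreal (norm (Du w) ^ CARD('n)) \<partial>lborel) < ennreal \<epsilon>"
        by (rule parabolic_section_test[OF P n cc D that(1,2) GD that(5)])
      then show ?thesis by simp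
    qed
  qed
qed

end

theorem theorem1p3:
  fixes M :: "('a, 'n::finite) riem_data"
    and \<Phi> :: "'a \<Rightarrow> real ^ 'm::finite"
  assumes "CARD('n) \<ge> 3"
    and "CARD('m) = CARD('n) + 1"
    and "riemannian_manifold M"
    and "complete_manifold M"
    and "\<not> compact_space (topo M)"
    and "conformal_sphere_immersion M \<Phi>"
    and "parabolic M (real CARD('n))"
  shows "inj_on \<Phi> (pts M)"
proof -
  have imm: "\<Phi> ` pts M \<subseteq> sphere 0 1" "smooth_fun M (pts M) \<Phi>"
    using assms(6) unfolding conformal_sphere_immersion_def smooth_sphere_immersion_def by blast+
  obtain u where u: "smooth_fun M (pts M) u" "\<forall>c\<in>atlas M. \<forall>x\<in>fst c. \<forall>v w.
      chart_differential c \<Phi> x v \<bullet> chart_differential c \<Phi> x w = exp (2 * u x) * (v \<bullet> (gram M c x *v w))"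
    using assms(6) unfolding conformal_sphere_immersion_def by blast
  interpret conformally_immersed M \<Phi> u
    by unfold_locales (use assms imm u in auto)
  show ?thesis by (rule injective_if_parabolic[OF assms(1,7)])
qed

end
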